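(* Let $P$ be a set of $n$ points in the plane in general position (no three collinear, no two with the same $x$-coordinate), and let $\mathfrak{C}^{\mathsf{sc}}_P$ be the set of crossing-free spanning cycles on $P$, each regarded as a set of segments. Then there exists a combination graph of size $\mathrm{O}(4^n n^3)$ that represents $\mathfrak{C}^{\mathsf{sc}}_P$, and it can be constructed (given $P$) in $\mathrm{O}(4^n n^4)$ time. The constants in the $\mathrm{O}$-notation do not depend on $P$ or $n$.
   Context: $\mathcal{S}_P$ denotes the set of line segments whose two (distinct) endpoints are in $P$. Two different segments are non-crossing if they do not share internal points (i.e. their relative interiors are disjoint). A subset $C \subseteq \mathcal{S}_P$ is called a combination; it is crossing-free if every two different segments in $C$ are non-crossing. A crossing-free spanning cycle on $P$ is a crossing-free $C\subseteq\mathcal{S}_P$ such that in the graph with vertex set $P$ and edge set $C$ every point has degree $2$ and all points are connected. A combination graph is a directed acyclic multigraph $\Gamma$ with two distinguished vertices $\bot$ (source) and $\top$ (sink), such that all edges except those ending in $\top$ are labeled with a segment in $\mathcal{S}_P$ (edges ending in $\top$ are unlabeled), and $\top$ has no outgoing edges. The size of $\Gamma$ is its number of vertices plus its number of edges. A $\bot$-$\top$ path represents the combination consisting of the labels of the edges on the path. $\Gamma$ represents a set $\mathfrak{C}$ of combinations if mapping each $\bot$-$\top$ path to the combination it represents is a one-to-one correspondence between the $\bot$-$\top$ paths of $\Gamma$ and $\mathfrak{C}$. *)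

theory Defs
  imports
    "HOL-Analysis.Analysis"
    "HOL-Library.Landau_Symbols"
    "Graph_Theory.Arc_Walk"
begin

section \<open>Points, segments and crossing-free spanning cycles\<close>

type_synonym point = "real \<times> real"
type_synonym segment = "point set"

definition general_position :: "point set \<Rightarrow> bool" where
  "general_position P \<longleftrightarrow>
     (\<forall>p\<in>P. \<forall>q\<in>P. \<forall>r\<in>P. p \<noteq> q \<and> p \<noteq> r \<and> q \<noteq> r \<longrightarrow> \<not> collinear {p, q, r}) \<and>
     inj_on fst P"

definition segments :: "point set \<Rightarrow> segment set" where
  "segments P = {closed_segment p q | p q. p \<in> P \<and> q \<in> P \<and> p \<noteq> q}"

definition non_crossing :: "segment \<Rightarrow> segment \<Rightarrow> bool" where
  "non_crossing s t \<longleftrightarrow> rel_interior s \<inter> rel_interior t = {}"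

definition crossing_free :: "segment set \<Rightarrow> bool" where
  "crossing_free C \<longleftrightarrow> (\<forall>s\<in>C. \<forall>t\<in>C. s \<noteq> t \<longrightarrow> non_crossing s t)"

definition adjacency :: "segment set \<Rightarrow> (point \<times> point) set" where
  "adjacency C = {(p, q). p \<noteq> q \<and> closed_segment p q \<in> C}"

definition point_degree :: "segment set \<Rightarrow> point \<Rightarrow> nat" where
  "point_degree C p = card {s \<in> C. \<exists>q. q \<noteq> p \<and> s = closed_segment p q}"

definition crossing_free_spanning_cycles :: "point set \<Rightarrow> segment set set" where
  "crossing_free_spanning_cycles P =
     {C. C \<subseteq> segments P \<and> crossing_free C \<and>
         (\<forall>p\<in>P. point_degree C p = 2) \<and>
         (\<forall>p\<in>P. \<forall>q\<in>P. (p, q) \<in> (adjacency C)\<^sup>*)}"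

section \<open>Combination graphs\<close>

record ('v, 'e) comb_graph =
  multigraph :: "('v, 'e) pre_digraph"
  source :: 'v
  sink :: 'v
  label :: "'e \<Rightarrow> segment option"

definition combination_graph :: "point set \<Rightarrow> ('v, 'e) comb_graph \<Rightarrow> bool" where
  "combination_graph P \<Gamma> \<longleftrightarrow>
     (let G = multigraph \<Gamma> in
       fin_digraph G \<and> acyclic (arcs_ends G) \<and>
       source \<Gamma> \<in> verts G \<and> sink \<Gamma> \<in> verts G \<and> source \<Gamma> \<noteq> sink \<Gamma> \<and>
       out_arcs G (sink \<Gamma>) = {} \<and>
       (\<forall>e\<in>arcs G. if head G e = sink \<Gamma> then label \<Gamma> e = None
                   else \<exists>s\<in>segments P. label \<Gamma> e = Some s))"

definition graph_size :: "('v, 'e) comb_graph \<Rightarrow> nat" where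
  "graph_size \<Gamma> = card (verts (multigraph \<Gamma>)) + card (arcs (multigraph \<Gamma>))"

definition source_sink_paths :: "('v, 'e) comb_graph \<Rightarrow> 'e list set" where
  "source_sink_paths \<Gamma> = {p. pre_digraph.awalk (multigraph \<Gamma>) (source \<Gamma>) p (sink \<Gamma>)}"

definition path_combination :: "('v, 'e) comb_graph \<Rightarrow> 'e list \<Rightarrow> segment set" where
  "path_combination \<Gamma> p = {s. \<exists>e\<in>set p. label \<Gamma> e = Some s}"

definition represents :: "('v, 'e) comb_graph \<Rightarrow> segment set set \<Rightarrow> bool" where
  "represents \<Gamma> \<CC> \<longleftrightarrow> bij_betw (path_combination \<Gamma>) (source_sink_paths \<Gamma>) \<CC>"

section \<open>The model of computation\<close>

text \<open>
  Running times are unit-cost times on a real RAM that also has integer words: a program is a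
  while program over finitely many named, zero-initialised arrays of words and of exact reals
  (a scalar is an array used at index 0). Reals can be added, subtracted, multiplied, divided and
  compared, but not rounded to words, and real constants are integers. Words obey a word length
  \<open>w\<close>: a step whose target index or stored word is not below \<open>2 ^ w\<close> has no execution.
  Intermediate results in an expression need no check, since the expressions of a fixed program
  have bounded size, so that these results have \<open>O(w)\<close> bits.
\<close>

datatype iexp =
    IConst nat
  | IElem string iexp
  | IAdd iexp iexp
  | ISub iexp iexp
  | IMul iexp iexp
  | IDiv iexp iexp
  | IMod iexp iexp

datatype rexp =
    RConst int
  | RElem string iexp
  | RAdd rexp rexp
  | RSub rexp rexp
  | RMul rexp rexp
  | RDiv rexp rexp

datatype bexp =
    ILess iexp iexp
  | RLess rexp rexp
  | BNot bexp
  | BAnd bexp bexp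

datatype com =
    Skip
  | IAssign string iexp iexp
  | RAssign string iexp rexp
  | Seq com com
  | Cond bexp com com
  | While bexp com

record state =
  words :: "string \<Rightarrow> nat \<Rightarrow> nat"
  reals :: "string \<Rightarrow> nat \<Rightarrow> real"

primrec ival :: "iexp \<Rightarrow> state \<Rightarrow> nat" where
  "ival (IConst k) \<sigma> = k"
| "ival (IElem a i) \<sigma> = words \<sigma> a (ival i \<sigma>)"
| "ival (IAdd x y) \<sigma> = ival x \<sigma> + ival y \<sigma>"
| "ival (ISub x y) \<sigma> = ival x \<sigma> - ival y \<sigma>"
| "ival (IMul x y) \<sigma> = ival x \<sigma> * ival y \<sigma>"
| "ival (IDiv x y) \<sigma> = ival x \<sigma> div ival y \<sigma>"
| "ival (IMod x y) \<sigma> = ival x \<sigma> mod ival y \<sigma>"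

primrec rval :: "rexp \<Rightarrow> state \<Rightarrow> real" where
  "rval (RConst k) \<sigma> = of_int k"
| "rval (RElem a i) \<sigma> = reals \<sigma> a (ival i \<sigma>)"
| "rval (RAdd x y) \<sigma> = rval x \<sigma> + rval y \<sigma>"
| "rval (RSub x y) \<sigma> = rval x \<sigma> - rval y \<sigma>"
| "rval (RMul x y) \<sigma> = rval x \<sigma> * rval y \<sigma>"
| "rval (RDiv x y) \<sigma> = rval x \<sigma> / rval y \<sigma>"

primrec bval :: "bexp \<Rightarrow> state \<Rightarrow> bool" where
  "bval (ILess x y) \<sigma> \<longleftrightarrow> ival x \<sigma> < ival y \<sigma>"
| "bval (RLess x y) \<sigma> \<longleftrightarrow> rval x \<sigma> < rval y \<sigma>"
| "bval (BNot b) \<sigma> \<longleftrightarrow> \<not> bval b \<sigma>"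
| "bval (BAnd b c) \<sigma> \<longleftrightarrow> bval b \<sigma> \<and> bval c \<sigma>"

primrec icost :: "iexp \<Rightarrow> nat" where
  "icost (IConst k) = 1"
| "icost (IElem a i) = icost i + 1"
| "icost (IAdd x y) = icost x + icost y + 1"
| "icost (ISub x y) = icost x + icost y + 1"
| "icost (IMul x y) = icost x + icost y + 1"
| "icost (IDiv x y) = icost x + icost y + 1"
| "icost (IMod x y) = icost x + icost y + 1"

primrec rcost :: "rexp \<Rightarrow> nat" where
  "rcost (RConst k) = 1"
| "rcost (RElem a i) = icost i + 1"
| "rcost (RAdd x y) = rcost x + rcost y + 1"
| "rcost (RSub x y) = rcost x + rcost y + 1"
| "rcost (RMul x y) = rcost x + rcost y + 1"
| "rcost (RDiv x y) = rcost x + rcost y + 1"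

primrec bcost :: "bexp \<Rightarrow> nat" where
  "bcost (ILess x y) = icost x + icost y + 1"
| "bcost (RLess x y) = rcost x + rcost y + 1"
| "bcost (BNot b) = bcost b + 1"
| "bcost (BAnd b c) = bcost b + bcost c + 1"

definition set_word :: "string \<Rightarrow> nat \<Rightarrow> nat \<Rightarrow> state \<Rightarrow> state" where
  "set_word a i v \<sigma> = \<sigma>\<lparr>words := (words \<sigma>)(a := (words \<sigma> a)(i := v))\<rparr>"

definition set_real :: "string \<Rightarrow> nat \<Rightarrow> real \<Rightarrow> state \<Rightarrow> state" where
  "set_real a i v \<sigma> = \<sigma>\<lparr>reals := (reals \<sigma>)(a := (reals \<sigma> a)(i := v))\<rparr>"

text \<open>\<open>exec w c \<sigma> k \<tau>\<close>: with word length \<open>w\<close>, program \<open>c\<close> started in \<open>\<sigma>\<close> halts in \<open>\<tau>\<close> after \<open>k\<close> steps.\<close>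

inductive exec :: "nat \<Rightarrow> com \<Rightarrow> state \<Rightarrow> nat \<Rightarrow> state \<Rightarrow> bool" for w where
  Skip: "exec w Skip \<sigma> 1 \<sigma>"
| IAssign: "ival i \<sigma> < 2 ^ w \<Longrightarrow> ival x \<sigma> < 2 ^ w \<Longrightarrow>
    exec w (IAssign a i x) \<sigma> (icost i + icost x + 1) (set_word a (ival i \<sigma>) (ival x \<sigma>) \<sigma>)"
| RAssign: "ival i \<sigma> < 2 ^ w \<Longrightarrow>
    exec w (RAssign a i y) \<sigma> (icost i + rcost y + 1) (set_real a (ival i \<sigma>) (rval y \<sigma>) \<sigma>)"
| Seq: "exec w c \<sigma> k \<sigma>' \<Longrightarrow> exec w d \<sigma>' l \<tau> \<Longrightarrow> exec w (Seq c d) \<sigma> (k + l) \<tau>"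
| CondTrue: "bval b \<sigma> \<Longrightarrow> exec w c \<sigma> k \<tau> \<Longrightarrow> exec w (Cond b c d) \<sigma> (bcost b + k + 1) \<tau>"
| CondFalse: "\<not> bval b \<sigma> \<Longrightarrow> exec w d \<sigma> k \<tau> \<Longrightarrow> exec w (Cond b c d) \<sigma> (bcost b + k + 1) \<tau>"
| WhileFalse: "\<not> bval b \<sigma> \<Longrightarrow> exec w (While b c) \<sigma> (bcost b + 1) \<sigma>"
| WhileTrue: "bval b \<sigma> \<Longrightarrow> exec w c \<sigma> k \<sigma>' \<Longrightarrow> exec w (While b c) \<sigma>' l \<tau> \<Longrightarrow>
    exec w (While b c) \<sigma> (bcost b + k + l + 1) \<tau>"

definition input_state :: "point list \<Rightarrow> state" where
  "input_state ps =
     \<lparr>words = (\<lambda>a i. if a = ''n'' \<and> i = 0 then length ps else 0),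
      reals = (\<lambda>a i. if a = ''x'' \<and> i < length ps then fst (ps ! i)
                     else if a = ''y'' \<and> i < length ps then snd (ps ! i) else 0)\<rparr>"

text \<open>
  Output format: vertices and edges are numbered from 0; an edge label is given by the positions
  of its two endpoints in the input.
\<close>

definition output_graph :: "point list \<Rightarrow> state \<Rightarrow> (nat, nat) comb_graph" where
  "output_graph ps \<sigma> =
     \<lparr>multigraph =
        \<lparr>verts = {..<words \<sigma> ''verts'' 0}, arcs = {..<words \<sigma> ''arcs'' 0},
         tail = words \<sigma> ''tail'', head = words \<sigma> ''head''\<rparr>,
      source = words \<sigma> ''source'' 0,
      sink = words \<sigma> ''sink'' 0,
      label = (\<lambda>e. if words \<sigma> ''head'' e = words \<sigma> ''sink'' 0 then None
                   else Some (closed_segment (ps ! words \<sigma> ''p'' e) (ps ! words \<sigma> ''q'' e)))\<rparr>"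

definition constructs :: "nat \<Rightarrow> com \<Rightarrow> point list \<Rightarrow> nat \<Rightarrow> (nat, nat) comb_graph \<Rightarrow> bool" where
  "constructs w c ps k \<Gamma> \<longleftrightarrow> (\<exists>\<tau>. exec w c (input_state ps) k \<tau> \<and> \<Gamma> = output_graph ps \<tau>)"

end

theory Submission
  imports Defs
begin

text \<open>
  Number the points from left to right and build a crossing-free spanning cycle by adding its
  segments from below, always taking the leftmost segment below which nothing is missing. A sequence
  of segments arises in this way iff no segment comes before one that lies below it and no segment
  lies entirely to the left of its immediate predecessor, so that every cycle has exactly one such
  sequence. At each stage the segments chosen so far form paths whose ends are visible from above. A
  new segment spans only points that lie above it and are untouched, or lie below it and have
  degree two already; in particular, it joins consecutive ends of paths. Hence the pairs of ends of the same path form a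
  matching without crossings, which is a word of parentheses, and a stage is a word of length \<open>n\<close> over
  four letters (untouched, opening, closing, degree two). The words together with the left end of
  the last segment are the \<open>4 ^ n * (n + 1)\<close> vertices of the graph, each with at most one arc
  per pair of points. Every arc raises the sum of the letters by 3, so the graph is acyclic. A single
  arc is computed in linear time by scanning the word for the matching parenthesis.
\<close>

section \<open>Segments ordered from below\<close>

text \<open>A stage has to be reduced to data that forgets the chosen segments. This works because
  every point that can still take a segment lies above each chosen segment spanning it
  (\<open>covers_below\<close>), so the letters in the range of a new segment already decide whether
  it crosses an old one. The obstacle is a cycle that closes too early. If no open end lies between
  i and j, letters 1 and 2 at these positions belong to the two ends of one path
  (\<open>adjacent_partner\<close>). Such a join is allowed only if it completes the whole cycle,
  which can be seen from the letters: all of them become 3. With two points it would repeat the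
  segment that is present, hence the test \<open>3 \<le> n\<close>. The left end of the last segment
  is stored because otherwise one cycle would be read off from several sequences, while paths have
  to correspond to cycles one to one. The arcs out of a vertex are not compressed to the possible
  ones: each triple of a vertex, i and j has its own number, so that the program writes every arc at
  a known place. The \<open>4 ^ n * (n + 1) ^ 3\<close> numbers, at linear cost each, give the
  running time.\<close>

lemma affine_pos_interior:
  fixes f :: "real \<Rightarrow> real"
  assumes f: "\<And>x. f x = a + b * x" and "0 \<le> f l" "0 \<le> f h" "0 < f l \<or> 0 < f h" "l < x" "x < h"
  shows "0 < f x"
proof -
  \<comment> \<open>The interior value is a weighted mean of the end values with positive weights,
    so one positive end is enough.\<close>
  have "(h - l) * f x = (h - x) * f l + (x - l) * f h"
    unfolding f by (simp add: algebra_simps)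
  moreover have "0 < (h - x) * f l + (x - l) * f h"
  proof (cases "0 < f l")
    case True
    then show ?thesis using assms by (intro add_pos_nonneg) auto
  next
    case False
    then show ?thesis using assms by (intro add_nonneg_pos) auto
  qed
  ultimately show ?thesis
    using assms by (metis diff_gt_0_iff_gt less_trans zero_less_mult_pos)
qed

text \<open>Strict inequalities on the open interval pass to its closure as weak ones; strictness at
  an end will come from general position (\<open>height_neq\<close>).\<close>

lemma affine_nonneg_ends:
  fixes f :: "real \<Rightarrow> real"
  assumes f: "\<And>x. f x = a + b * x" and pos: "\<And>x. l < x \<Longrightarrow> x < h \<Longrightarrow> 0 < f x" and "l < h"
  shows "0 \<le> f l" "0 \<le> f h"
proof -
  have c: "continuous_on S f" for S
    by (simp add: f[abs_def] continuous_intros)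
  show "0 \<le> f l" "0 \<le> f h"
    using continuous_ge_on_closure[of "{l<..<h}" f _ 0] c pos \<open>l < h\<close> by (auto simp: less_imp_le)
qed

lemma affine_root:
  fixes f :: "real \<Rightarrow> real"
  assumes f: "\<And>x. f x = a + b * x" and "f x \<le> 0" "0 \<le> f y" "x \<in> {l<..<h}" "y \<in> {l<..<h}"
  obtains z where "z \<in> {l<..<h}" "f z = 0"
proof -
  have c: "continuous_on S f" for S
    by (simp add: f[abs_def] continuous_intros)
  have "\<exists>z\<in>{l<..<h}. f z = 0"
  proof (cases "x \<le> y")
    case True
    then show ?thesis using IVT'[of f x 0 y] c assms by force
  next
    case False
    then show ?thesis using IVT2'[of f x 0 y] c assms by force
  qed
  with that show ?thesis by blast
qed

section \<open>Segments as index pairs and their vertical order\<close>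

type_synonym edge = "nat \<times> nat"

definition index_pairs :: "nat \<Rightarrow> edge set" where
  "index_pairs n = {(i, j). i < j \<and> j < n}"

text \<open>Indices take the place of abscissae, since the points will be numbered from left to
  right. Sharing only an end is no overlap.\<close>

definition overlap :: "edge \<Rightarrow> edge \<Rightarrow> bool" where
  "overlap s t \<longleftrightarrow> max (fst s) (fst t) < min (snd s) (snd t)"

lemma overlap_sym: "overlap s t = overlap t s"
  by (auto simp: overlap_def max.commute min.commute)

lemma finite_index_pairs: "finite (index_pairs n)"
  by (rule finite_subset[of _ "{..<n} \<times> {..<n}"]) (auto simp: index_pairs_def)

locale ordered_points =
  fixes n :: nat and v :: "nat \<Rightarrow> point"
  assumes mono: "\<And>i j. i < j \<Longrightarrow> j < n \<Longrightarrow> fst (v i) < fst (v j)"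
    and not_collinear: "\<And>i k j. i < k \<Longrightarrow> k < j \<Longrightarrow> j < n \<Longrightarrow> \<not> collinear {v i, v k, v j}"
begin

abbreviation "X i \<equiv> fst (v i)"
abbreviation "Y i \<equiv> snd (v i)"

text \<open>The whole line through both ends, not restricted to the segment, so that differences of
  heights are affine on all reals.\<close>

definition height :: "edge \<Rightarrow> real \<Rightarrow> real" where
  "height s x = Y (fst s) + (x - X (fst s)) * ((Y (snd s) - Y (fst s)) / (X (snd s) - X (fst s)))"

definition seg :: "edge \<Rightarrow> segment" where
  "seg s = closed_segment (v (fst s)) (v (snd s))"

definition point_below :: "nat \<Rightarrow> nat \<Rightarrow> nat \<Rightarrow> bool" where
  "point_below i k j \<longleftrightarrow> Y k < height (i, j) (X k)"

text \<open>Strict over the open common range only, so that the segments may meet in an end. The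
  conjunct \<open>overlap\<close> rules out vacuous truth. The relation is not transitive: of three
  segments, the first and the last need not overlap.\<close>

definition below :: "edge \<Rightarrow> edge \<Rightarrow> bool" where
  "below s t \<longleftrightarrow> overlap s t \<and>
     (\<forall>x \<in> {max (X (fst s)) (X (fst t))<..<min (X (snd s)) (X (snd t))}. height s x < height t x)"

definition uncrossed :: "edge \<Rightarrow> edge \<Rightarrow> bool" where
  "uncrossed s t \<longleftrightarrow> (overlap s t \<longrightarrow> below s t \<or> below t s)"

lemma X_less_iff: "i < n \<Longrightarrow> j < n \<Longrightarrow> X i < X j \<longleftrightarrow> i < j"
  using mono by (metis less_asym' linorder_neqE_nat order_less_irrefl)

lemma X_le_iff: "i < n \<Longrightarrow> j < n \<Longrightarrow> X i \<le> X j \<longleftrightarrow> i \<le> j"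
  using X_less_iff by (meson linorder_not_less)

lemma X_max: "i < n \<Longrightarrow> j < n \<Longrightarrow> max (X i) (X j) = X (max i j)"
  by (simp add: max_def X_le_iff)

lemma X_min: "i < n \<Longrightarrow> j < n \<Longrightarrow> min (X i) (X j) = X (min i j)"
  by (simp add: min_def X_le_iff)

lemma v_eq_iff: "i < n \<Longrightarrow> j < n \<Longrightarrow> v i = v j \<longleftrightarrow> i = j"
  using X_less_iff by (metis less_irrefl linorder_neqE_nat)

lemma height_affine: "\<exists>a b. \<forall>x. height s x = a + b * x"
proof -
  define m where "m = (Y (snd s) - Y (fst s)) / (X (snd s) - X (fst s))"
  have "height s x = (Y (fst s) - X (fst s) * m) + m * x" for x
    by (simp add: height_def m_def[symmetric] algebra_simps)
  then show ?thesis by blast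
qed

lemma height_diff_affine: "\<exists>a b. \<forall>x. height s x - height t x = a + b * x"
proof -
  obtain a b c d where "\<forall>x. height s x = a + b * x" "\<forall>x. height t x = c + d * x"
    using height_affine by metis
  then have "height s x - height t x = (a - c) + (b - d) * x" for x
    by (simp add: algebra_simps)
  then show ?thesis by blast
qed

lemma height_fst [simp]: "height (i, j) (X i) = Y i"
  by (simp add: height_def)

lemma height_snd: "i < j \<Longrightarrow> j < n \<Longrightarrow> height (i, j) (X j) = Y j"
  using mono[of i j] by (simp add: height_def)

text \<open>A point at this height would be a convex combination of \<open>v i\<close> and
  \<open>v j\<close>, with a weight \<open>u\<close> that is computed from the abscissae
  alone.\<close>

lemma height_neq:
  assumes "i < k" "k < j" "j < n"
  shows "Y k \<noteq> height (i, j) (X k)"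
proof
  assume eq: "Y k = height (i, j) (X k)"
  define u where "u = (X j - X k) / (X j - X i)"
  have pos: "X i < X j" using assms mono by simp
  have u1: "1 - u = (X k - X i) / (X j - X i)"
    using pos by (simp add: u_def field_simps)
  have "(1 - u) * (X j - X i) = X k - X i"
    unfolding u1 using pos by (metis diff_gt_0_iff_gt less_irrefl nonzero_eq_divide_eq)
  then have "X k = u * X i + (1 - u) * X j"
    by (simp add: algebra_simps)
  moreover have "Y k = u * Y i + (1 - u) * Y j"
  proof -
    have "Y k = Y i + (1 - u) * (Y j - Y i)"
      unfolding eq u1 height_def by simp
    then show ?thesis by (simp add: algebra_simps)
  qed
  ultimately have "v k = u *\<^sub>R v i + (1 - u) *\<^sub>R v j"
    by (simp add: prod_eq_iff)
  then have "collinear {v i, v k, v j}"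
    unfolding collinear_3_expand by blast
  with not_collinear assms show False by blast
qed

lemma point_above: "i < k \<Longrightarrow> k < j \<Longrightarrow> j < n \<Longrightarrow> \<not> point_below i k j \<Longrightarrow> height (i, j) (X k) < Y k"
  using height_neq[of i k j] by (auto simp: point_below_def)

text \<open>Multiplying by the positive width removes the division. This product form is the
  orientation test that the program evaluates in \<open>below_exp\<close>.\<close>

lemma point_below_iff:
  assumes "i < k" "k < j" "j < n"
  shows "point_below i k j \<longleftrightarrow> (X j - X i) * (Y k - Y i) < (X k - X i) * (Y j - Y i)"
proof -
  have pos: "0 < X j - X i" using assms mono[of i j] by simp
  have "point_below i k j \<longleftrightarrow> Y k - Y i < (X k - X i) * (Y j - Y i) / (X j - X i)"
    by (auto simp: point_below_def height_def)
  also have "\<dots> \<longleftrightarrow> (Y k - Y i) * (X j - X i) < (X k - X i) * (Y j - Y i)"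
    using pos by (simp add: pos_less_divide_eq)
  finally show ?thesis by (simp add: mult.commute)
qed

lemma common_range_nonempty:
  assumes "s \<in> index_pairs n" "t \<in> index_pairs n" "overlap s t"
  shows "max (X (fst s)) (X (fst t)) < min (X (snd s)) (X (snd t))"
  using assms by (auto simp: index_pairs_def overlap_def X_less_iff)

lemma below_overlap: "below s t \<Longrightarrow> overlap s t"
  by (simp add: below_def)

lemma belowD:
  assumes "below s t" "x \<in> {X (fst s)<..<X (snd s)}" "x \<in> {X (fst t)<..<X (snd t)}"
  shows "height s x < height t x"
  using assms by (simp add: below_def)

lemma below_asym:
  assumes "s \<in> index_pairs n" "t \<in> index_pairs n" "below s t"
  shows "\<not> below t s"
proof
  assume "below t s"
  obtain x where "max (X (fst s)) (X (fst t)) < x" "x < min (X (snd s)) (X (snd t))"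
    using common_range_nonempty[OF assms(1,2) below_overlap[OF assms(3)]] dense by metis
  then have x: "x \<in> {X (fst s)<..<X (snd s)}" "x \<in> {X (fst t)<..<X (snd t)}" by auto
  show False
    using belowD[OF assms(3) x] belowD[OF \<open>below t s\<close> x(2,1)] by linarith
qed

text \<open>The difference of the heights is affine, so it only has to be examined at the two ends
  of the common range, each of which is an end of one of the segments. At a shared end it vanishes;
  \<open>(i, j) \<noteq> (k, l)\<close> ensures that at least one comparison is strict.\<close>

lemma belowI:
  assumes st: "i < j" "j < n" "k < l" "l < n" and ov: "overlap (i, j) (k, l)" and ne: "(i, j) \<noteq> (k, l)"
    and "k < i \<Longrightarrow> \<not> point_below k i l"
    and "i < k \<Longrightarrow> point_below i k j"
    and "j < l \<Longrightarrow> \<not> point_below k j l"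
    and "l < j \<Longrightarrow> point_below i l j"
  shows "below (k, l) (i, j)"
proof -
  obtain a b where f: "\<And>x. height (i, j) x - height (k, l) x = a + b * x"
    using height_diff_affine by blast
  have il: "i < l" and kj: "k < j"
    using ov by (auto simp: overlap_def)
  have lo: "0 \<le> height (i, j) (X (max i k)) - height (k, l) (X (max i k)) \<and>
      (i \<noteq> k \<longrightarrow> 0 < height (i, j) (X (max i k)) - height (k, l) (X (max i k)))"
  proof (cases i k rule: linorder_cases)
    case less
    then show ?thesis using assms(8) by (simp add: point_below_def)
  next
    case greater
    then show ?thesis using assms(7) point_above[of k i l] il st by simp
  qed simp
  have hi: "0 \<le> height (i, j) (X (min j l)) - height (k, l) (X (min j l)) \<and>
      (j \<noteq> l \<longrightarrow> 0 < height (i, j) (X (min j l)) - height (k, l) (X (min j l)))"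
  proof (cases j l rule: linorder_cases)
    case less
    then show ?thesis using assms(9) point_above[of k j l] kj st by (simp add: height_snd)
  next
    case greater
    then show ?thesis using assms(10) st by (simp add: point_below_def height_snd)
  next
    case equal
    then show ?thesis using st by (simp add: height_snd)
  qed
  have "0 < height (i, j) x - height (k, l) x" if "X (max i k) < x" "x < X (min j l)" for x
    using affine_pos_interior[where f = "\<lambda>x. height (i, j) x - height (k, l) x", OF f] lo hi ne that by blast
  then show ?thesis
    unfolding below_def using st ov by (auto simp: X_max X_min overlap_sym max.commute min.commute)
qed

text \<open>By continuity the order over the common range extends weakly to the abscissa of
  \<open>k\<close>, where general position excludes equality. So the position of the single point
  \<open>k\<close> decides which segment is the lower one.\<close>

lemma incident_below:
  assumes s: "i < k" "k < j" "j < n" and t: "t \<in> index_pairs n" "fst t = k \<or> snd t = k"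
    and "uncrossed (i, j) t"
  shows "overlap (i, j) t"
    and "point_below i k j \<Longrightarrow> below t (i, j)"
    and "\<not> point_below i k j \<Longrightarrow> below (i, j) t"
proof -
  show ov: "overlap (i, j) t"
    using s t by (auto simp: overlap_def index_pairs_def)
  have ht: "height t (X k) = Y k"
    using t by (cases t) (auto simp: index_pairs_def height_snd)
  have tn: "fst t < n" "snd t < n" "fst t < snd t" "i < n"
    using s t by (auto simp: index_pairs_def)
  let ?l = "max i (fst t)" and ?h = "min j (snd t)"
  have lh: "?l < ?h" "?l < n" "?h < n" and k: "k = ?l \<or> k = ?h"
    using ov s tn t by (auto simp: overlap_def)
  have X_lh: "X ?l < X ?h" using lh mono by blast
  have or: "below (i, j) t \<or> below t (i, j)"
    using assms ov by (auto simp: uncrossed_def)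
  have 1: "Y k < height (i, j) (X k)" if b: "below t (i, j)"
  proof -
    obtain a b where f: "\<And>x. height (i, j) x - height t x = a + b * x"
      using height_diff_affine by blast
    have "0 < height (i, j) x - height t x" if "X ?l < x" "x < X ?h" for x
      using b that s tn by (auto simp: below_def X_max X_min max.commute min.commute)
    from affine_nonneg_ends[where f = "\<lambda>x. height (i, j) x - height t x", OF f this X_lh] k
    have "0 \<le> height (i, j) (X k) - height t (X k)" by auto
    with ht height_neq[of i k j] s show ?thesis by auto
  qed
  have 2: "height (i, j) (X k) < Y k" if b: "below (i, j) t"
  proof -
    obtain a b where f: "\<And>x. height t x - height (i, j) x = a + b * x"
      using height_diff_affine by blast
    have "0 < height t x - height (i, j) x" if "X ?l < x" "x < X ?h" for x
      using b that s tn by (auto simp: below_def X_max X_min)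
    from affine_nonneg_ends[where f = "\<lambda>x. height t x - height (i, j) x", OF f this X_lh] k
    have "0 \<le> height t (X k) - height (i, j) (X k)" by auto
    with ht height_neq[of i k j] s show ?thesis by auto
  qed
  show "point_below i k j \<Longrightarrow> below t (i, j)" "\<not> point_below i k j \<Longrightarrow> below (i, j) t"
    using or 1 2 by (auto simp: point_below_def)
qed

text \<open>
  Just left of the right end of \<open>s\<close>, the vertical line meets all three segments.
\<close>
lemma below_trans_right_end:
  assumes an: "a \<in> index_pairs n" "s \<in> index_pairs n" "m \<in> index_pairs n"
    and as: "below a s" and sm: "below s m"
    and r: "snd s \<le> snd a" "snd s \<le> snd m"
    and am: "a \<noteq> m \<Longrightarrow> uncrossed a m"
  shows "below a m"
proof -
  define l where "l = max (fst a) (max (fst s) (fst m))"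
  have "overlap a s" "overlap s m" using as sm below_overlap by blast+
  then have l: "l < snd s" using r by (auto simp: overlap_def l_def)
  have sn: "snd s < n" "snd a < n" "snd m < n" using an by (auto simp: index_pairs_def)
  have "X l < X (snd s)" by (rule mono[OF l sn(1)])
  then obtain x where x: "X l < x" "x < X (snd s)" using dense by metis
  have le: "fst a \<le> l" "fst s \<le> l" "fst m \<le> l" by (simp_all add: l_def)
  have ln: "l < n" using l sn by simp
  have X_le: "X p < x" if "p \<le> l" for p
    using X_le_iff[of p l] that ln x(1) by simp
  have X_ge: "x < X p" if "snd s \<le> p" "p < n" for p
    using X_le_iff[of "snd s" p] that sn(1) x(2) by simp
  have rng: "x \<in> {X (fst a)<..<X (snd a)}" "x \<in> {X (fst s)<..<X (snd s)}" "x \<in> {X (fst m)<..<X (snd m)}"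
    using X_le le X_ge r sn x(2) by simp_all
  have lt: "height a x < height m x"
    using belowD[OF as rng(1,2)] belowD[OF sm rng(2,3)] by linarith
  have "a \<noteq> m" using lt by auto
  moreover have "overlap a m"
    using l r by (simp add: overlap_def l_def)
  moreover have "\<not> below m a"
    using lt belowD[of m a x, OF _ rng(3,1)] by linarith
  ultimately show ?thesis
    using am by (auto simp: uncrossed_def)
qed

text \<open>Remove the segment \<open>s\<close> with the smallest right end and take a minimal
  \<open>m\<close> of the rest. Either \<open>s\<close> is not below \<open>m\<close>, which then
  stays minimal, or \<open>s\<close> itself is minimal, since anything below \<open>s\<close> would
  be below \<open>m\<close>. The choice of \<open>s\<close> provides the vertical line needed for
  \<open>below_trans_right_end\<close>.\<close>

lemma ex_minimal:
  assumes "finite S" "S \<noteq> {}" "S \<subseteq> index_pairs n" "\<And>s t. s \<in> S \<Longrightarrow> t \<in> S \<Longrightarrow> s \<noteq> t \<Longrightarrow> uncrossed s t"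
  shows "\<exists>m\<in>S. \<forall>t\<in>S. \<not> below t m"
  using assms
proof (induction "card S" arbitrary: S)
  case (Suc c)
  define s where "s = arg_min_on snd S"
  have s: "s \<in> S" "\<And>t. t \<in> S \<Longrightarrow> snd s \<le> snd t"
    using Suc.prems arg_min_if_finite(1)[of S snd] arg_min_least[of S _ snd] by (auto simp: s_def)
  have irr: "\<not> below t t" if "t \<in> S" for t
    using that Suc.prems(3) below_asym[of t t] by blast
  show ?case
  proof (cases "S = {s}")
    case True
    then show ?thesis using irr by blast
  next
    case False
    have "\<exists>m\<in>S - {s}. \<forall>t\<in>S - {s}. \<not> below t m"
      using Suc.prems Suc.hyps(2) s False by (intro Suc.hyps(1)) auto
    then obtain m where m: "m \<in> S" "m \<noteq> s" "\<forall>t\<in>S - {s}. \<not> below t m" by blast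
    show ?thesis
    proof (cases "below s m")
      case False
      then show ?thesis using m by blast
    next
      case sm: True
      have "\<not> below a s" if a: "a \<in> S" for a
      proof
        assume as: "below a s"
        have "below a m"
          using below_trans_right_end[OF _ _ _ as sm] a s m(1) Suc.prems(3,4) by blast
        then show False using m(3) a as irr[OF s(1)] by blast
      qed
      then show ?thesis using s by blast
    qed
  qed
qed simp

section \<open>Index pairs as subsets of the plane\<close>

lemma inj_on_seg: "inj_on seg (index_pairs n)"
proof (rule inj_onI)
  fix s t assume st: "s \<in> index_pairs n" "t \<in> index_pairs n" "seg s = seg t"
  then have "{v (fst s), v (snd s)} = {v (fst t), v (snd t)}"
    by (simp add: seg_def closed_segment_eq)
  then show "s = t"
    using st by (auto simp: index_pairs_def doubleton_eq_iff v_eq_iff)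
qed

text \<open>A common interior point thereby becomes an equality of two heights at one
  abscissa.\<close>

lemma rel_interior_seg:
  assumes "s \<in> index_pairs n"
  shows "rel_interior (seg s) = {p. fst p \<in> {X (fst s)<..<X (snd s)} \<and> snd p = height s (fst p)}"
proof -
  obtain i j where s: "s = (i, j)" "i < j" "j < n" using assms by (auto simp: index_pairs_def)
  have pos: "X i < X j" using s mono by simp
  have "rel_interior (seg s) = open_segment (v i) (v j)"
    using pos by (auto simp: seg_def s rel_interior_closed_segment)
  also have "\<dots> = {p. fst p \<in> {X i<..<X j} \<and> snd p = height s (fst p)}"
  proof (intro set_eqI iffI)
    fix p assume "p \<in> open_segment (v i) (v j)"
    then obtain u where u: "0 < u" "u < 1" "p = (1 - u) *\<^sub>R v i + u *\<^sub>R v j"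
      by (auto simp: in_segment)
    have d: "fst p - X i = u * (X j - X i)"
      by (simp add: u algebra_simps)
    have d2: "X j - fst p = (1 - u) * (X j - X i)"
      by (simp add: u algebra_simps)
    have "0 < fst p - X i" unfolding d using u pos by simp
    moreover have "0 < X j - fst p" unfolding d2 using u pos by simp
    moreover have "snd p = height s (fst p)"
    proof -
      have "u * (X j - X i) * ((Y j - Y i) / (X j - X i)) = u * (Y j - Y i)"
        using pos by simp
      then have "height s (fst p) = Y i + u * (Y j - Y i)"
        unfolding height_def s fst_conv snd_conv d by (rule arg_cong)
      then show ?thesis by (simp add: u(3) algebra_simps)
    qed
    ultimately show "p \<in> {p. fst p \<in> {X i<..<X j} \<and> snd p = height s (fst p)}" by simp
  next
    fix p assume "p \<in> {p. fst p \<in> {X i<..<X j} \<and> snd p = height s (fst p)}"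
    then have p: "X i < fst p" "fst p < X j" "snd p = height s (fst p)" by auto
    define u where "u = (fst p - X i) / (X j - X i)"
    have u: "0 < u" "u < 1" using p pos by (auto simp: u_def)
    have "fst p = (1 - u) * X i + u * X j"
    proof -
      have "u * (X j - X i) = fst p - X i" using pos by (simp add: u_def)
      then show ?thesis by (simp add: algebra_simps)
    qed
    moreover have "snd p = Y i + u * (Y j - Y i)"
      using p(3) by (simp add: height_def s u_def)
    then have "snd p = (1 - u) * Y i + u * Y j"
      by (simp add: algebra_simps)
    ultimately have "p = (1 - u) *\<^sub>R v i + u *\<^sub>R v j"
      by (simp add: prod_eq_iff)
    with u pos show "p \<in> open_segment (v i) (v j)"
      by (auto simp: in_segment)
  qed
  finally show ?thesis by (simp add: s)
qed

text \<open>If neither segment is below the other, the difference of heights takes both weak signs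
  on the common range. Its zero there is the abscissa of a common interior point.\<close>

lemma non_crossing_seg_iff:
  assumes st: "s \<in> index_pairs n" "t \<in> index_pairs n"
  shows "non_crossing (seg s) (seg t) \<longleftrightarrow> uncrossed s t"
proof
  let ?l = "max (X (fst s)) (X (fst t))" and ?h = "min (X (snd s)) (X (snd t))"
  assume nc: "non_crossing (seg s) (seg t)"
  show "uncrossed s t"
  proof (rule ccontr)
    assume "\<not> uncrossed s t"
    then obtain x y where xy: "x \<in> {?l<..<?h}" "\<not> height s x < height t x"
      "y \<in> {?l<..<?h}" "\<not> height t y < height s y"
      by (auto simp: uncrossed_def below_def max.commute min.commute overlap_sym)
    obtain a b where f: "\<And>x. height s x - height t x = a + b * x"
      using height_diff_affine by blast
    obtain z where "z \<in> {?l<..<?h}" "height s z - height t z = 0"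
      using affine_root[where f = "\<lambda>x. height s x - height t x", OF f, of y x ?l ?h] xy by auto
    then have "(z, height s z) \<in> rel_interior (seg s) \<inter> rel_interior (seg t)"
      using st by (simp add: rel_interior_seg)
    with nc show False by (auto simp: non_crossing_def)
  qed
next
  assume u: "uncrossed s t"
  show "non_crossing (seg s) (seg t)"
    unfolding non_crossing_def
  proof (rule ccontr)
    assume "rel_interior (seg s) \<inter> rel_interior (seg t) \<noteq> {}"
    then obtain p where "p \<in> rel_interior (seg s)" "p \<in> rel_interior (seg t)"
      by blast
    then obtain x where x: "x \<in> {X (fst s)<..<X (snd s)}" "x \<in> {X (fst t)<..<X (snd t)}"
      "height s x = height t x"
      using st by (auto simp: rel_interior_seg)
    then have "max (X (fst s)) (X (fst t)) < min (X (snd s)) (X (snd t))" by auto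
    then have "overlap s t"
      using st by (auto simp: overlap_def index_pairs_def X_less_iff)
    then show False using u x belowD[of s t x] belowD[of t s x] by (auto simp: uncrossed_def)
  qed
qed

end

section \<open>Canonical sequences\<close>

text \<open>The parameter is the left end of the preceding segment. Starting with 0 imposes nothing,
  since every right end is positive.\<close>

primrec advancing :: "nat \<Rightarrow> edge list \<Rightarrow> bool" where
  "advancing m [] = True"
| "advancing m (s # es) = (m < snd s \<and> advancing (fst s) es)"

context ordered_points
begin

text \<open>Linear extensions of \<open>below\<close> without repetitions. All pairs are compared,
  not only neighbours, because \<open>below\<close> is not transitive.\<close>

primrec bottom_up :: "edge list \<Rightarrow> bool" where
  "bottom_up [] = True"
| "bottom_up (s # es) = ((\<forall>t\<in>set es. t \<noteq> s \<and> \<not> below t s) \<and> bottom_up es)"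

definition planar :: "edge set \<Rightarrow> bool" where
  "planar C \<longleftrightarrow> C \<subseteq> index_pairs n \<and> (\<forall>s\<in>C. \<forall>t\<in>C. s \<noteq> t \<longrightarrow> uncrossed s t)"

lemma planar_subset: "planar C \<Longrightarrow> D \<subseteq> C \<Longrightarrow> planar D"
  unfolding planar_def by (meson subsetD subset_trans)

lemma planar_finite: "planar C \<Longrightarrow> finite C"
  using finite_index_pairs finite_subset[of C "index_pairs n"] by (simp add: planar_def)

lemma incomparable_left_right:
  assumes "planar C" "s \<in> C" "t \<in> C" "s \<noteq> t" "\<not> below s t" "\<not> below t s"
  shows "snd s \<le> fst t \<or> snd t \<le> fst s"
proof -
  have "uncrossed s t" using assms(1-4) unfolding planar_def by blast
  then have "\<not> overlap s t" using assms(5,6) by (simp add: uncrossed_def)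
  moreover have "fst s < snd s" "fst t < snd t"
    using assms(1-3) by (auto simp: planar_def index_pairs_def)
  ultimately show ?thesis by (simp add: overlap_def) linarith
qed

text \<open>If \<open>t\<close> is not the next segment \<open>u\<close>, then by induction
  \<open>t\<close> does not lie left of \<open>u\<close>. The two are incomparable, as
  \<open>t\<close> is minimal and comes later, so \<open>u\<close> lies left of \<open>t\<close>.
  Since \<open>u\<close> does not lie left of \<open>s\<close>, neither does
  \<open>t\<close>.\<close>

lemma minimal_not_left:
  assumes "planar (set (s # es))" "bottom_up (s # es)" "advancing (fst s) es"
    and "t \<in> set es" "\<forall>u\<in>set (s # es). \<not> below u t"
  shows "fst s < snd t"
  using assms
proof (induction es arbitrary: s)
  case (Cons u es)
  show ?case
  proof (cases "t = u")
    case True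
    then show ?thesis using Cons.prems by simp
  next
    case False
    then have t: "t \<in> set es" using Cons.prems by simp
    have "fst u < snd t"
      using Cons.prems t by (intro Cons.IH) (auto intro: planar_subset)
    moreover have "snd u \<le> fst t \<or> snd t \<le> fst u"
      using Cons.prems t False by (intro incomparable_left_right[OF Cons.prems(1)]) auto
    moreover have "fst t < snd t"
      using Cons.prems by (auto simp: planar_def index_pairs_def)
    ultimately show ?thesis using Cons.prems by auto
  qed
qed simp

text \<open>Both sequences have to start with the leftmost minimal segment.\<close>
lemma canonical_unique:
  assumes "planar (set es)" "set es' = set es"
    and "bottom_up es" "advancing m es" "bottom_up es'" "advancing m' es'"
  shows "es = es'"
  using assms
proof (induction es arbitrary: es' m m')
  case (Cons s es)
  then obtain s' fs where es': "es' = s' # fs" by (cases es') auto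
  have "s = s'"
  proof (rule ccontr)
    assume ne: "s \<noteq> s'"
    have mem: "s' \<in> set es" "s \<in> set fs" using Cons.prems es' ne by auto
    have irr: "\<not> below t t" if "t \<in> set (s # es)" for t
      using that Cons.prems(1) below_asym[of t t] unfolding planar_def by blast
    have min: "\<forall>u\<in>set (s # es). \<not> below u s" "\<forall>u\<in>set (s # es). \<not> below u s'"
      using Cons.prems(2,3,5) irr mem es' by auto
    \<comment> \<open>Two minimal segments are incomparable, so one of the heads would lie left of
      the other. But in each list the other head occurs later and, being minimal, does not lie left
      of the first element.\<close>
    have "fst s < snd s'"
      using Cons.prems mem min by (intro minimal_not_left[of s es s']) auto
    moreover have "fst s' < snd s"
      using Cons.prems mem min es' by (intro minimal_not_left[of s' fs s]) auto
    moreover have "snd s \<le> fst s' \<or> snd s' \<le> fst s"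
      using Cons.prems(1) mem min ne by (intro incomparable_left_right[of "set (s # es)"]) auto
    ultimately show False by simp
  qed
  moreover have "es = fs"
  proof (rule Cons.IH)
    show "planar (set es)" using Cons.prems(1) by (rule planar_subset) auto
    show "set fs = set es" using Cons.prems es' \<open>s = s'\<close> by auto
  qed (use Cons.prems es' in auto)
  ultimately show ?case by (simp add: es')
qed simp

text \<open>Among the minimal segments the one with the smallest left end is taken. If the next
  segment \<open>u\<close> were left of it, then \<open>u\<close> would have been minimal already,
  with a smaller left end.\<close>

lemma canonical_exists:
  assumes "planar C"
  shows "\<exists>es. set es = C \<and> bottom_up es \<and> advancing 0 es"
  using assms
proof (induction "card C" arbitrary: C)
  case 0
  then have "set [] = C" using planar_finite by auto
  then show ?case by (metis advancing.simps(1) bottom_up.simps(1))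
next
  case (Suc c)
  define M where "M = {s \<in> C. \<forall>t\<in>C. \<not> below t s}"
  have fin: "finite C" and C: "C \<subseteq> index_pairs n" using Suc.prems planar_finite by (auto simp: planar_def)
  have "C \<noteq> {}" using Suc.hyps by auto
  then have "M \<noteq> {}"
    using ex_minimal[of C] Suc.prems fin by (auto simp: M_def planar_def)
  moreover have "finite M" using fin by (simp add: M_def)
  ultimately obtain s where s: "s \<in> M" "\<And>t. t \<in> M \<Longrightarrow> fst s \<le> fst t"
    using arg_min_if_finite(1)[of M fst] arg_min_least[of M _ fst] by metis
  have sC: "s \<in> C" using s by (simp add: M_def)
  have "c = card (C - {s})" using Suc.hyps sC fin by simp
  then obtain es where es: "set es = C - {s}" "bottom_up es" "advancing 0 es"
    using Suc.hyps(1)[of "C - {s}"] Suc.prems planar_subset by blast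
  have "advancing (fst s) es"
  proof (cases es)
    case (Cons u fs)
    have u: "u \<in> C" "u \<noteq> s" using es Cons by auto
    have "fst s < snd u"
    proof (rule ccontr)
      assume "\<not> fst s < snd u"
      then have left: "snd u \<le> fst s" by simp
      have "\<not> below s u"
        using left by (auto dest!: below_overlap simp: overlap_def)
      moreover have "\<not> below u u"
        using u C below_asym by blast
      ultimately have "u \<in> M" using es Cons u by (auto simp: M_def)
      moreover have "fst u < snd u" using u C by (auto simp: index_pairs_def)
      ultimately show False using s(2)[of u] left by simp
    qed
    then show ?thesis using es Cons by simp
  qed simp
  moreover have "0 < snd s" using sC C by (auto simp: index_pairs_def)
  moreover have "\<forall>t\<in>set es. t \<noteq> s \<and> \<not> below t s" using s es by (auto simp: M_def)
  ultimately have "set (s # es) = C \<and> bottom_up (s # es) \<and> advancing 0 (s # es)"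
    using es sC by auto
  then show ?case by blast
qed

end

section \<open>Words describing the open paths\<close>

type_synonym word = "nat \<Rightarrow> nat"

section \<open>Connectivity and degrees in graphs on the indices\<close>

definition adj :: "edge set \<Rightarrow> edge set" where
  "adj D = D \<union> D\<inverse>"

definition conn :: "edge set \<Rightarrow> edge set" where
  "conn D = (adj D)\<^sup>*"

definition incident :: "edge set \<Rightarrow> nat \<Rightarrow> edge set" where
  "incident D k = {e \<in> D. fst e = k \<or> snd e = k}"

lemma conn_refl [simp]: "(a, a) \<in> conn D"
  by (simp add: conn_def)

lemma conn_sym: "(a, b) \<in> conn D \<Longrightarrow> (b, a) \<in> conn D"
  unfolding conn_def by (rule symD[OF sym_rtrancl]) (auto simp: adj_def sym_def)

lemma conn_trans: "(a, b) \<in> conn D \<Longrightarrow> (b, c) \<in> conn D \<Longrightarrow> (a, c) \<in> conn D"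
  unfolding conn_def by (rule rtrancl_trans)

lemma conn_edge: "(a, b) \<in> D \<Longrightarrow> (a, b) \<in> conn D"
  unfolding conn_def adj_def by auto

lemma conn_mono: "D \<subseteq> E \<Longrightarrow> (a, b) \<in> conn D \<Longrightarrow> (a, b) \<in> conn E"
  unfolding conn_def adj_def by (rule rev_subsetD[OF _ rtrancl_mono]) auto

text \<open>A path that uses the new edge several times can be shortened to a single use, in one of
  the two directions.\<close>

lemma conn_insertE:
  assumes "(a, b) \<in> conn (insert (i, j) D)"
  obtains "(a, b) \<in> conn D" | "(a, i) \<in> conn D" "(j, b) \<in> conn D" | "(a, j) \<in> conn D" "(i, b) \<in> conn D"
proof -
  have "adj (insert (i, j) D) = insert (i, j) (insert (j, i) (adj D))"
    by (auto simp: adj_def)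
  then have "(a, b) \<in> conn D \<or> ((a, i) \<in> conn D \<and> (j, b) \<in> conn D) \<or> ((a, j) \<in> conn D \<and> (i, b) \<in> conn D)"
    using assms by (simp add: conn_def rtrancl_insert) (metis rtrancl_trans)
  with that show thesis by blast
qed

text \<open>A set that no edge leaves contains the components of its points. It will be applied to
  an isolated point, to a lone segment and to a closed cycle.\<close>

lemma conn_closed:
  assumes "(a, b) \<in> conn D" "a \<in> S" "\<And>e. e \<in> D \<Longrightarrow> fst e \<in> S \<longleftrightarrow> snd e \<in> S"
  shows "b \<in> S"
  using assms(1) unfolding conn_def
proof (induction rule: rtrancl_induct)
  case (step y z)
  then show ?case using assms(3)[of "(y, z)"] assms(3)[of "(z, y)"] by (auto simp: adj_def)
qed (rule assms(2))

lemma conn_isolated: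
  assumes "incident D a = {}" "(a, b) \<in> conn D"
  shows "b = a"
  using conn_closed[OF assms(2), of "{a}"] assms(1) by (auto simp: incident_def)

lemma incident_insert:
  "incident (insert (i, j) D) k = (if k = i \<or> k = j then insert (i, j) (incident D k) else incident D k)"
  by (auto simp: incident_def)

lemma card_incident_insert:
  assumes "finite (incident D k)" "(i, j) \<notin> D"
  shows "card (incident (insert (i, j) D) k) = card (incident D k) + (if k = i \<or> k = j then 1 else 0)"
proof -
  have "(i, j) \<notin> incident D k" using assms(2) by (simp add: incident_def)
  then show ?thesis using assms(1) by (simp add: incident_insert)
qed

text \<open>
  The words describing an intermediate stage have the letters 0 (untouched point), 1 and 2
  (left and right end of a path, an opening and a closing parenthesis) and 3 (point of degree two).
  \<open>p\<close> maps each end of a path to the other one.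
\<close>
locale linking =
  fixes n :: nat and D :: "edge set" and d :: word and p :: "nat \<Rightarrow> nat"
  assumes pairs: "D \<subseteq> index_pairs n"
    and letters: "k < n \<Longrightarrow> d k \<le> 3"
    and degree: "k < n \<Longrightarrow> card (incident D k) = (if d k = 0 then 0 else if d k = 3 then 2 else 1)"
    and partner_lt: "k < n \<Longrightarrow> d k \<in> {1, 2} \<Longrightarrow> p k < n"
    and partner_open: "k < n \<Longrightarrow> d k \<in> {1, 2} \<Longrightarrow> d (p k) \<in> {1, 2}"
    and partner_neq: "k < n \<Longrightarrow> d k \<in> {1, 2} \<Longrightarrow> p k \<noteq> k"
    and partner_partner: "k < n \<Longrightarrow> d k \<in> {1, 2} \<Longrightarrow> p (p k) = k"
    and partner_conn: "k < n \<Longrightarrow> d k \<in> {1, 2} \<Longrightarrow> (k, p k) \<in> conn D"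
    and partner_less: "k < n \<Longrightarrow> d k \<in> {1, 2} \<Longrightarrow> d k = 1 \<longleftrightarrow> k < p k"
    and nested: "a < n \<Longrightarrow> d a \<in> {1, 2} \<Longrightarrow> c < n \<Longrightarrow> d c \<in> {1, 2} \<Longrightarrow> c \<noteq> a \<Longrightarrow> c \<noteq> p a \<Longrightarrow>
      ((a < c) \<noteq> (p a < c)) = ((a < p c) \<noteq> (p a < p c))"
    and full_conn: "k < n \<Longrightarrow> d k = 3 \<Longrightarrow> \<exists>e<n. d e \<in> {1, 2} \<and> (k, e) \<in> conn D"
    and conn_open: "e < n \<Longrightarrow> d e \<in> {1, 2} \<Longrightarrow> f < n \<Longrightarrow> d f \<in> {1, 2} \<Longrightarrow> (e, f) \<in> conn D \<Longrightarrow> f = e \<or> f = p e"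

lemma linking_empty: "linking n {} (\<lambda>k. 0) id"
  by unfold_locales (auto simp: incident_def)

text \<open>If one of the points is untouched, the path grows to it and the letter moves along. The
  letter stays correct because there is no open end between the two points that the moving end could
  pass.\<close>

definition joined :: "word \<Rightarrow> nat \<Rightarrow> nat \<Rightarrow> word" where
  "joined d i j = d(i := if d i = 0 then (if d j = 0 then 1 else d j) else 3,
                    j := if d j = 0 then (if d i = 0 then 2 else d i) else 3)"

text \<open>Joining two left ends merges the nested pairs \<open>i < j < p j < p i\<close> into one
  path from \<open>p j\<close> to \<open>p i\<close>, so \<open>p j\<close> turns from a right end
  into a left one. Two right ends are the mirror image.\<close>

definition relabeled :: "(nat \<Rightarrow> nat) \<Rightarrow> word \<Rightarrow> nat \<Rightarrow> nat \<Rightarrow> word" where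
  "relabeled p d i j =
     (if d i = 1 \<and> d j = 1 then (joined d i j)(p j := 1)
      else if d i = 2 \<and> d j = 2 then (joined d i j)(p i := 2)
      else joined d i j)"

context linking
begin

lemma finite_D: "finite D"
  using pairs finite_index_pairs finite_subset by blast

lemma finite_incident: "finite (incident D k)"
  using finite_D by (simp add: incident_def)

lemma isolated: "k < n \<Longrightarrow> d k = 0 \<Longrightarrow> (k, b) \<in> conn D \<Longrightarrow> b = k"
  using degree[of k] finite_incident[of k] conn_isolated[of D k b] by simp

lemma isolated': "k < n \<Longrightarrow> d k = 0 \<Longrightarrow> (b, k) \<in> conn D \<Longrightarrow> b = k"
  using isolated conn_sym by blast

text \<open>Otherwise the partner of \<open>i\<close> lies right of \<open>j\<close> and the partner
  of \<open>j\<close> left of \<open>i\<close>, so that the two pairs cross. Hence joining these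
  letters always closes a cycle.\<close>

lemma adjacent_partner:
  assumes ij: "i < j" "j < n" and gap: "\<And>k. i < k \<Longrightarrow> k < j \<Longrightarrow> d k \<in> {0, 3}"
    and "d i = 1" "d j = 2"
  shows "p i = j"
proof (rule ccontr)
  assume ne: "p i \<noteq> j"
  have o: "i < n" "d i \<in> {1, 2}" "j < n" "d j \<in> {1, 2}" using assms by auto
  have i: "i < p i" using partner_less[of i] o assms(4) by simp
  have "\<not> (i < p i \<and> p i < j)" using gap[of "p i"] partner_open[of i] o by auto
  then have i': "j < p i" using i ne by simp
  have j: "p j < j" using partner_less[of j] partner_neq[of j] o assms(5) by simp
  have pj: "p j \<noteq> i" using partner_partner[of j] o ne by auto
  have "\<not> (i < p j \<and> p j < j)" using gap[of "p j"] partner_open[of j] o by auto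
  then have j': "p j < i" using j pj by simp
  show False
    using nested[of i j] o ne ij i i' j j' by auto
qed

text \<open>The new path runs between the far ends \<open>A\<close> and \<open>B\<close> of the two
  old ones. Nesting survives because no open end lies between \<open>i\<close> and \<open>j\<close>:
  no other pair separates any two of \<open>A\<close>, \<open>i\<close>, \<open>j\<close> and
  \<open>B\<close>. The excluded letters are those of the two ends of a single path.\<close>

lemma linking_insert:
  assumes ij: "i < j" "j < n" and ne3: "d i \<noteq> 3" "d j \<noteq> 3"
    and gap: "\<And>k. i < k \<Longrightarrow> k < j \<Longrightarrow> d k \<in> {0, 3}"
    and no_close: "\<not> (d i = 1 \<and> d j = 2)"
  shows "\<exists>p'. linking n (insert (i, j) D) (relabeled p d i j) p'"
proof -
  \<comment> \<open>An untouched point counts as a path of its own, whose far end is the point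
    itself.\<close>
  define A where "A = (if d i = 0 then i else p i)"
  define B where "B = (if d j = 0 then j else p j)"
  define p' where "p' = p(A := B, B := A)"
  define d' where "d' = relabeled p d i j"
  define op where "op k \<longleftrightarrow> k < n \<and> d k \<in> {1, 2}" for k
  have i_n: "i < n" using ij by simp
  have op_cases: "d i = 0 \<or> op i" "d j = 0 \<or> op j"
    using letters[of i] letters[of j] ij ne3 by (auto simp: op_def)
  have op_p: "op (p k)" "p k \<noteq> k" "p (p k) = k" "(k, p k) \<in> conn D" "d k = 1 \<longleftrightarrow> k < p k" if "op k" for k
    using that partner_lt partner_open partner_neq partner_partner partner_conn partner_less
    unfolding op_def by blast+
  have nest: "((a < c) \<noteq> (p a < c)) = ((a < p c) \<noteq> (p a < p c))" if "op a" "op c" "c \<noteq> a" "c \<noteq> p a" for a c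
    using nested that unfolding op_def by blast
  have op_0: "\<not> op k" if "d k = 0" for k using that by (simp add: op_def)
  have op_2: "d k = 2" if "op k" "d k \<noteq> 1" for k using that by (simp add: op_def)
  have gap': "k < i \<or> j < k" if "op k" "k \<noteq> i" "k \<noteq> j" for k
    using gap[of k] that by (cases k i rule: linorder_cases; cases k j rule: linorder_cases) (auto simp: op_def)
  \<comment> \<open>Partners \<open>i < j\<close> would have the letters 1 and 2, which is the
    excluded case.\<close>
  have pij: "p i \<noteq> j" if "op i" "op j"
    using op_p(5)[of i] op_p(5)[of j] op_p(3)[of i] that ij no_close op_2[of j] by fastforce
  have pji: "p j \<noteq> i" if "op i" "op j"
    using pij that op_p(3)[of j] by auto
  have Aj: "A \<noteq> j" using op_cases ij pij op_p op_0 by (metis A_def less_irrefl)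
  have Bi: "B \<noteq> i" using op_cases ij pji op_p op_0 by (metis B_def less_irrefl)
  have AB: "A \<noteq> B"
    unfolding A_def B_def using op_cases ij op_p op_0 by (metis less_irrefl)
  have A_out: "A = i \<and> d i = 0 \<or> A \<noteq> i \<and> op i \<and> op A \<and> p A = i \<and> p i = A \<and> (A < i \<or> j < A)"
    using op_cases(1)
  proof
    assume "op i"
    then have "A = p i" using op_0 by (auto simp: A_def)
    then show ?thesis using \<open>op i\<close> op_p[of i] gap'[of A] Aj by auto
  qed (simp add: A_def)
  have B_out: "B = j \<and> d j = 0 \<or> B \<noteq> j \<and> op j \<and> op B \<and> p B = j \<and> p j = B \<and> (B < i \<or> j < B)"
    using op_cases(2)
  proof
    assume "op j"
    then have "B = p j" using op_0 by (auto simp: B_def)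
    then show ?thesis using \<open>op j\<close> op_p[of j] gap'[of B] Bi by auto
  qed (simp add: B_def)
  have AB_n: "A < n" "B < n" using A_out B_out ij by (auto simp: op_def)

  have Aii: "A \<noteq> i" "A = p i" if "op i" using A_out that op_0 by auto
  have Bjj: "B \<noteq> j" "B = p j" if "op j" using B_out that op_0 by auto
  have op_12: "op i" if "d i \<in> {1, 2}" using that i_n by (simp add: op_def)
  have op_12': "op j" if "d j \<in> {1, 2}" using that ij by (simp add: op_def)
  have jn: "joined d i j i = (if d i = 0 then (if d j = 0 then 1 else d j) else 3)"
    "joined d i j j = (if d j = 0 then (if d i = 0 then 2 else d i) else 3)"
    "\<And>k. k \<noteq> i \<Longrightarrow> k \<noteq> j \<Longrightarrow> joined d i j k = d k"
    using ij by (simp_all add: joined_def)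
  consider (open_open) "d i = 1" "d j = 1" "op i" "op j" "d' = (joined d i j)(B := 1)"
    | (close_close) "d i = 2" "d j = 2" "op i" "op j" "d' = (joined d i j)(A := 2)"
    | (other) "\<not> (d i = 1 \<and> d j = 1)" "\<not> (d i = 2 \<and> d j = 2)" "d' = joined d i j"
  proof -
    have "d' = joined d i j" if "\<not> (d i = 1 \<and> d j = 1)" "\<not> (d i = 2 \<and> d j = 2)"
      unfolding d'_def relabeled_def by (simp only: that if_False)
    moreover have "d' = (joined d i j)(B := 1)" if "d i = 1" "d j = 1"
      using that op_12' Bjj(2) by (simp add: d'_def relabeled_def)
    moreover have "d' = (joined d i j)(A := 2)" if "d i = 2" "d j = 2"
      using that op_12 Aii(2) by (simp add: d'_def relabeled_def)
    ultimately show thesis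
      using open_open close_close other op_12 op_12' by blast
  qed
  note d'_cases = this
  have d'_i: "d' i = (if d i = 0 then (if d j = 0 then 1 else d j) else 3)"
    by (cases rule: d'_cases) (use Aii Bi jn in simp_all)
  have d'_j: "d' j = (if d j = 0 then (if d i = 0 then 2 else d i) else 3)"
    by (cases rule: d'_cases) (use Bjj Aj jn in simp_all)
  have d'_other: "d' k = d k" if "k \<noteq> i" "k \<noteq> j" "k \<noteq> A" "k \<noteq> B" for k
    by (cases rule: d'_cases) (use that jn in simp_all)
  have d'_AB: "d' A \<in> {1, 2} \<and> d' B \<in> {1, 2} \<and> (d' A = 1 \<longleftrightarrow> A < B) \<and> (d' B = 1 \<longleftrightarrow> B < A)"
  proof (cases "d i = 0"; cases "d j = 0")
    assume "d i = 0" "d j = 0"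
    then have "A = i" "B = j" by (auto simp: A_def B_def)
    then show ?thesis using d'_i d'_j ij \<open>d i = 0\<close> \<open>d j = 0\<close> by simp
  next
    assume 0: "d i = 0" "d j \<noteq> 0"
    then have "A = i" "B = p j" "op j" using op_cases by (auto simp: A_def B_def)
    moreover have "d' B = d B" "d' i = d j"
      using 0 Bi d'_i Bjj jn \<open>op j\<close> by (cases rule: d'_cases; simp)+
    moreover have "d j \<in> {1, 2}" "d B \<in> {1, 2}" "d j = 1 \<longleftrightarrow> j < B" "d B = 1 \<longleftrightarrow> B < j"
      using \<open>op j\<close> B_out 0 op_p(5)[of j] op_p(5)[of B] by (auto simp: op_def)
    ultimately show ?thesis using B_out 0 ij by auto
  next
    assume 0: "d i \<noteq> 0" "d j = 0"
    then have "B = j" "A = p i" "op i" using op_cases by (auto simp: A_def B_def)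
    moreover have "d' A = d A" "d' j = d i"
      using 0 Aj d'_j Aii jn \<open>op i\<close> by (cases rule: d'_cases; simp)+
    moreover have "d i \<in> {1, 2}" "d A \<in> {1, 2}" "d i = 1 \<longleftrightarrow> i < A" "d A = 1 \<longleftrightarrow> A < i"
      using \<open>op i\<close> A_out 0 op_p(5)[of i] op_p(5)[of A] by (auto simp: op_def)
    ultimately show ?thesis using A_out 0 ij by auto
  next
    assume 0: "d i \<noteq> 0" "d j \<noteq> 0"
    then have o: "op i" "op j" "A = p i" "B = p j" "op A" "op B" "p A = i" "p B = j"
      using op_cases A_out B_out by (auto simp: A_def B_def op_0)
    have lt: "d i = 1 \<longleftrightarrow> i < A" "d j = 1 \<longleftrightarrow> j < B" "d A = 1 \<longleftrightarrow> A < i" "d B = 1 \<longleftrightarrow> B < j"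
      using o op_p(5)[of i] op_p(5)[of j] op_p(5)[of A] op_p(5)[of B] by auto
    \<comment> \<open>The nesting of the two old pairs and the letters of \<open>i\<close> and
      \<open>j\<close> together determine which of \<open>A\<close> and \<open>B\<close> is the left
      end.\<close>
    have "((i < j) \<noteq> (A < j)) = ((i < B) \<noteq> (A < B))"
      using nest[of i j] o ij Aj by auto
    moreover have "d k = 1 \<or> d k = 2" if "k \<in> {i, j, A, B}" for k
      using that o by (auto simp: op_def)
    moreover have "A < i \<or> j < A" "B < i \<or> j < B" using A_out B_out op_0 o by auto
    moreover have "d' A = (if d i = 2 \<and> d j = 2 then 2 else d A)"
      using Aii Aj AB jn o by (cases rule: d'_cases) auto
    moreover have "d' B = (if d i = 1 \<and> d j = 1 then 1 else d B)"
      using Bjj Bi AB jn o by (cases rule: d'_cases) auto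
    ultimately show ?thesis
      using lt ij AB no_close by (smt (verit) insertI1 insert_iff less_asym' less_trans linorder_neqE_nat)
  qed
  define op' where "op' k \<longleftrightarrow> k < n \<and> d' k \<in> {1, 2}" for k
  have op'_iff: "op' k \<longleftrightarrow> k = A \<or> k = B \<or> op k \<and> k \<noteq> i \<and> k \<noteq> j" for k
  proof (cases "k = A \<or> k = B")
    case True
    then show ?thesis using d'_AB AB_n by (auto simp: op'_def)
  next
    case kAB: False
    show ?thesis
    proof (cases "k = i \<or> k = j")
      case True
      then have "d' k = 3"
        using kAB d'_i d'_j A_out B_out op_0 by (auto simp: A_def B_def split: if_splits)
      then show ?thesis using True kAB by (auto simp: op'_def)
    next
      case False
      then show ?thesis using kAB d'_other[of k] by (auto simp: op'_def op_def)
    qed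
  qed
  have p'_AB: "p' A = B" "p' B = A" using AB by (auto simp: p'_def)
  have p'_other: "p' k = p k" if "k \<noteq> A" "k \<noteq> B" for k using that by (simp add: p'_def)
  have other: "op k \<and> k \<noteq> i \<and> k \<noteq> j \<and> p k \<noteq> i \<and> p k \<noteq> j \<and> p k \<noteq> A \<and> p k \<noteq> B \<and> op (p k)"
    if "op' k" "k \<noteq> A" "k \<noteq> B" for k
  proof -
    have k: "op k" "k \<noteq> i" "k \<noteq> j" using that op'_iff by auto
    then show ?thesis using op_p[of k] A_out B_out that by (metis op_0)
  qed
  \<comment> \<open>The side is followed along \<open>A\<close>, \<open>i\<close>, \<open>j\<close>,
    \<open>B\<close>: the outer two steps stay within an old pair, and the middle step passes no
    open end.\<close>
  have sep: "((a < A) \<noteq> (p a < A)) = ((a < B) \<noteq> (p a < B))" if "op' a" "a \<noteq> A" "a \<noteq> B" for a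
  proof -
    note a = other[OF that]
    have "((a < A) \<noteq> (p a < A)) = ((a < i) \<noteq> (p a < i))"
    proof (cases "A = i")
      case False
      then have "op i" "p i = A" using A_out by blast+
      then show ?thesis using nest[of a i] a by simp
    qed simp
    moreover have "((a < B) \<noteq> (p a < B)) = ((a < j) \<noteq> (p a < j))"
    proof (cases "B = j")
      case False
      then have "op j" "p j = B" using B_out by blast+
      then show ?thesis using nest[of a j] a by simp
    qed simp
    moreover have "a < i \<or> j < a" "p a < i \<or> j < p a"
      using gap'[of a] gap'[of "p a"] a by blast+
    then have "(a < i) = (a < j)" "(p a < i) = (p a < j)"
      using ij by linarith+
    ultimately show ?thesis by simp
  qed
  have Ai: "(A, i) \<in> conn D" "(B, j) \<in> conn D"
    using A_out B_out op_p(4) by (metis conn_refl conn_sym)+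
  let ?D = "insert (i, j) D"
  have mono: "(a, b) \<in> conn ?D" if "(a, b) \<in> conn D" for a b
    using conn_mono[OF subset_insertI that] .
  have AB_conn: "(A, B) \<in> conn ?D"
    using mono[OF Ai(1)] mono[OF conn_sym[OF Ai(2)]] conn_edge[of i j ?D] conn_trans by blast
  \<comment> \<open>A segment already present would make \<open>i\<close> and \<open>j\<close>
    connected open ends, hence partners.\<close>
  have notin: "(i, j) \<notin> D"
  proof
    assume "(i, j) \<in> D"
    then have c: "(i, j) \<in> conn D" by (rule conn_edge)
    then have "op i" "op j"
      using op_cases isolated[of i j] isolated'[of j i] ij i_n by auto
    then have "j = p i" using conn_open[of i j] c ij by (auto simp: op_def)
    with pij \<open>op i\<close> \<open>op j\<close> show False by simp
  qed
  \<comment> \<open>This keeps the merged component from having a third open end.\<close>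
  have only_A: "e = A" if "op' e" "(e, i) \<in> conn D" for e
    using op_cases(1)
  proof
    assume "d i = 0"
    then show ?thesis using isolated'[OF i_n, of e] that by (simp add: A_def)
  next
    assume oi: "op i"
    then have A: "A = p i" using A_out op_0 by auto
    show ?thesis
    proof (cases "op e")
      case True
      then have "e = i \<or> e = p i"
        using conn_open[of i e] conn_sym[OF that(2)] oi by (auto simp: op_def)
      moreover have "\<not> op' i" using op'_iff[of i] A_out oi op_0 Bi by auto
      ultimately show ?thesis using that A by auto
    next
      case False
      then have "e = A \<or> e = B" using that op'_iff by blast
      then show ?thesis
      proof
        assume "e = B"
        then have "e = j" "d j = 0" using B_out False by auto
        then show ?thesis using isolated[of j i] that ij by auto
      qed
    qed
  qed
  have only_B: "e = B" if "op' e" "(e, j) \<in> conn D" for e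
    using op_cases(2)
  proof
    assume "d j = 0"
    then show ?thesis using isolated'[OF ij(2), of e] that by (simp add: B_def)
  next
    assume oj: "op j"
    then have B: "B = p j" using B_out op_0 by auto
    show ?thesis
    proof (cases "op e")
      case True
      then have "e = j \<or> e = p j"
        using conn_open[of j e] conn_sym[OF that(2)] oj by (auto simp: op_def)
      moreover have "\<not> op' j" using op'_iff[of j] B_out oj op_0 Aj by auto
      ultimately show ?thesis using that B by auto
    next
      case False
      then have "e = A \<or> e = B" using that op'_iff by blast
      then show ?thesis
      proof
        assume "e = A"
        then have "e = i" "d i = 0" using A_out False by auto
        then show ?thesis using isolated[of i j] that ij by auto
      qed
    qed
  qed
  have "linking n ?D d' p'"
  proof unfold_locales
    show "?D \<subseteq> index_pairs n" using pairs ij by (auto simp: index_pairs_def)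
    show "d' k \<le> 3" if "k < n" for k
    proof -
      have "d' i \<le> 3" "d' j \<le> 3" "d' A \<le> 3" "d' B \<le> 3"
        using letters[OF i_n] letters[OF ij(2)] d'_i d'_j d'_AB by auto
      then show ?thesis using d'_other[of k] letters[OF that] by metis
    qed
    show "card (incident ?D k) = (if d' k = 0 then 0 else if d' k = 3 then 2 else 1)" if k: "k < n" for k
    proof (cases "k = i \<or> k = j")
      case True
      then have "card (incident ?D k) = Suc (card (incident D k))"
        using notin finite_incident by (simp add: card_incident_insert)
      then show ?thesis
        using True degree[OF k] d'_i d'_j ne3 by (auto split: if_splits)
    next
      case False
      then have 1: "card (incident ?D k) = card (incident D k)" by (auto simp: incident_insert)
      show ?thesis
      proof (cases "k = A \<or> k = B")
        case True
        then have "op k" using False A_out B_out by blast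
        then have "d k \<noteq> 0" "d k \<noteq> 3" by (auto simp: op_def)
        moreover have "d' k \<noteq> 0" "d' k \<noteq> 3" using True d'_AB by force+
        ultimately show ?thesis using 1 degree[OF k] by simp
      next
        case kAB: False
        then show ?thesis using 1 degree[OF k] d'_other[of k] False by simp
      qed
    qed
    fix k assume "k < n" "d' k \<in> {1, 2}"
    then have k: "op' k" by (simp add: op'_def)
    have *: "op' (p' k) \<and> p' k \<noteq> k \<and> p' (p' k) = k \<and> (k, p' k) \<in> conn ?D \<and> (d' k = 1 \<longleftrightarrow> k < p' k)"
    proof (cases "k = A \<or> k = B")
      case True
      then show ?thesis using p'_AB AB AB_conn conn_sym[OF AB_conn] d'_AB op'_iff by auto
    next
      case False
      then have o: "op k \<and> k \<noteq> i \<and> k \<noteq> j \<and> p k \<noteq> i \<and> p k \<noteq> j \<and> p k \<noteq> A \<and> p k \<noteq> B \<and> op (p k)"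
        using other k by blast
      then show ?thesis
        using False p'_other d'_other[of k] op_p[of k] mono op'_iff[of "p k"] by auto
    qed
    then show "p' k < n" "d' (p' k) \<in> {1, 2}" "p' k \<noteq> k" "p' (p' k) = k" "(k, p' k) \<in> conn ?D"
      "d' k = 1 \<longleftrightarrow> k < p' k"
      by (auto simp: op'_def)
  next
    fix a c assume "a < n" "d' a \<in> {1, 2}" "c < n" "d' c \<in> {1, 2}" and ca: "c \<noteq> a" "c \<noteq> p' a"
    then have ac: "op' a" "op' c" by (auto simp: op'_def)
    show "((a < c) \<noteq> (p' a < c)) = ((a < p' c) \<noteq> (p' a < p' c))"
    proof (cases "a = A \<or> a = B")
      case aAB: True
      then have c: "c \<noteq> A" "c \<noteq> B" using ca p'_AB by auto
      note oc = other[OF ac(2) c]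
      have "(A < c) = (\<not> c < A)" "(B < c) = (\<not> c < B)"
        "(A < p c) = (\<not> p c < A)" "(B < p c) = (\<not> p c < B)"
        using c oc by linarith+
      with sep[OF ac(2) c] have "((A < c) \<noteq> (B < c)) = ((A < p c) \<noteq> (B < p c))" by blast
      moreover from this have "((B < c) \<noteq> (A < c)) = ((B < p c) \<noteq> (A < p c))" by blast
      ultimately show ?thesis
        using aAB p'_AB p'_other[OF c] by metis
    next
      case False
      then have a: "a \<noteq> A" "a \<noteq> B" by auto
      note oa = other[OF ac(1) a]
      show ?thesis
      proof (cases "c = A \<or> c = B")
        case True
        then show ?thesis using sep[OF ac(1) a] p'_AB p'_other[OF a] by auto
      next
        case False
        then have c: "c \<noteq> A" "c \<noteq> B" by auto
        then show ?thesis
          using nest[of a c] other[OF ac(2) c] oa ca unfolding p'_other[OF a] p'_other[OF c] by blast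
      qed
    qed
  next
    fix k assume k: "k < n" "d' k = 3"
    have op'_AB: "op' A" "op' B" using op'_iff by auto
    have "\<exists>e. op' e \<and> (k, e) \<in> conn ?D"
    proof (cases "k = i \<or> k = j")
      case True
      then show ?thesis using mono[OF conn_sym[OF Ai(1)]] mono[OF conn_sym[OF Ai(2)]] op'_AB by auto
    next
      case False
      moreover have "k \<noteq> A" "k \<noteq> B" using k d'_AB by auto
      ultimately have "d k = 3" using d'_other k by simp
      then obtain e where e: "op e" "(k, e) \<in> conn D" using full_conn k by (auto simp: op_def)
      consider "e = i" | "e = j" | "op' e" using e op'_iff by blast
      then show ?thesis
      proof cases
        case 1
        then show ?thesis
          using e conn_trans[OF mono mono[OF conn_sym[OF Ai(1)]]] op'_AB by blast
      next
        case 2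
        then show ?thesis
          using e conn_trans[OF mono mono[OF conn_sym[OF Ai(2)]]] op'_AB by blast
      next
        case 3
        then show ?thesis using e mono by blast
      qed
    qed
    then show "\<exists>e<n. d' e \<in> {1, 2} \<and> (k, e) \<in> conn ?D" by (auto simp: op'_def)
  next
    fix e f assume "e < n" "d' e \<in> {1, 2}" "f < n" "d' f \<in> {1, 2}" and ef: "(e, f) \<in> conn ?D"
    then have o: "op' e" "op' f" by (auto simp: op'_def)
    from ef show "f = e \<or> f = p' e"
    proof (cases rule: conn_insertE)
      case 1
      show ?thesis
      proof (cases "e = A \<or> e = B")
        case True
        then have "(f, i) \<in> conn D \<or> (f, j) \<in> conn D"
          using 1 Ai conn_sym conn_trans by metis
        then have "f = A \<or> f = B" using only_A only_B o by blast
        then show ?thesis using True p'_AB by auto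
      next
        case False
        then have oe: "op e" "p' e = p e" using other o p'_other by auto
        show ?thesis
        proof (cases "f = A \<or> f = B")
          case True
          then have "(e, i) \<in> conn D \<or> (e, j) \<in> conn D"
            using 1 Ai conn_trans by metis
          then show ?thesis using only_A only_B o False by blast
        next
          case f: False
          then have "op f" using other o by blast
          then show ?thesis using conn_open[of e f] oe 1 by (auto simp: op_def)
        qed
      qed
    next
      case 2
      then show ?thesis using only_A[of e] only_B[of f] o conn_sym p'_AB by auto
    next
      case 3
      then show ?thesis using only_B[of e] only_A[of f] o conn_sym p'_AB by auto
    qed
  qed
  then show ?thesis by (auto simp: d'_def)
qed

end

section \<open>Reading off partners and the accepted sequences\<close>

text \<open>\<open>c\<close> counts the letters \<open>u\<close> that still wait for their letter
  \<open>v\<close>; the answer is the first \<open>v\<close> that finds none waiting.\<close>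

primrec scan :: "nat \<Rightarrow> nat \<Rightarrow> word \<Rightarrow> nat \<Rightarrow> nat list \<Rightarrow> nat option" where
  "scan u v d c [] = None"
| "scan u v d c (k # ks) =
     (if d k = v then (if c = 0 then Some k else scan u v d (c - 1) ks)
      else scan u v d (if d k = u then c + 1 else c) ks)"

abbreviation occurrences :: "nat \<Rightarrow> word \<Rightarrow> nat list \<Rightarrow> nat" where
  "occurrences v d ks \<equiv> length (filter (\<lambda>k. d k = v) ks)"

text \<open>The prefix condition keeps the counter from being exhausted within \<open>xs\<close>, so
  the search does not stop there.\<close>

lemma scan_append:
  assumes "u \<noteq> v" "\<And>t. t \<le> length xs \<Longrightarrow> occurrences v d (take t xs) \<le> c + occurrences u d (take t xs)"
  shows "scan u v d c (xs @ ys) = scan u v d (c + occurrences u d xs - occurrences v d xs) ys"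
  using assms(2)
proof (induction xs arbitrary: c)
  case (Cons x xs)
  consider "d x = v" | "d x = u" "d x \<noteq> v" | "d x \<noteq> u" "d x \<noteq> v" by blast
  then show ?case
  proof cases
    case 1
    have "0 < c" using Cons.prems[of 1] 1 \<open>u \<noteq> v\<close> by simp
    moreover have "scan u v d (c - 1) (xs @ ys) = scan u v d (c - 1 + occurrences u d xs - occurrences v d xs) ys"
    proof (rule Cons.IH)
      show "occurrences v d (take t xs) \<le> c - 1 + occurrences u d (take t xs)" if "t \<le> length xs" for t
        using Cons.prems[of "Suc t"] that 1 \<open>u \<noteq> v\<close> \<open>0 < c\<close> by simp
    qed
    ultimately show ?thesis using 1 \<open>u \<noteq> v\<close> by simp
  next
    case 2
    have "scan u v d (c + 1) (xs @ ys) = scan u v d (c + 1 + occurrences u d xs - occurrences v d xs) ys"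
    proof (rule Cons.IH)
      show "occurrences v d (take t xs) \<le> c + 1 + occurrences u d (take t xs)" if "t \<le> length xs" for t
        using Cons.prems[of "Suc t"] that 2 by simp
    qed
    then show ?thesis using 2 by simp
  next
    case 3
    have "scan u v d c (xs @ ys) = scan u v d (c + occurrences u d xs - occurrences v d xs) ys"
    proof (rule Cons.IH)
      show "occurrences v d (take t xs) \<le> c + occurrences u d (take t xs)" if "t \<le> length xs" for t
        using Cons.prems[of "Suc t"] that 3 by simp
    qed
    then show ?thesis using 3 by simp
  qed
qed simp

lemma scan_finds:
  assumes "u \<noteq> v" "d b = v" "occurrences u d xs \<le> occurrences v d xs"
    and "\<And>t. t \<le> length xs \<Longrightarrow> occurrences v d (take t xs) \<le> occurrences u d (take t xs)"
  shows "scan u v d 0 (xs @ b # ys) = Some b"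
  using scan_append[OF assms(1), of xs d 0 "b # ys"] assms by simp

lemma scan_SomeD: "scan u v d c ks = Some r \<Longrightarrow> r \<in> set ks \<and> d r = v"
  by (induction ks arbitrary: c) (auto split: if_splits)

text \<open>The partner map injects the positions of \<open>u\<close> into those of
  \<open>v\<close>, as it does not leave the list.\<close>

lemma occurrences_le:
  assumes "distinct ks" "\<And>k. k \<in> set ks \<Longrightarrow> d k = u \<Longrightarrow> p k \<in> set ks \<and> d (p k) = v \<and> p (p k) = k"
  shows "occurrences u d ks \<le> occurrences v d ks"
proof -
  have c: "occurrences w d ks = card {k \<in> set ks. d k = w}" for w
    using assms(1) distinct_card[of "filter (\<lambda>k. d k = w) ks"] by (simp add: Int_def)
  have "inj_on p {k \<in> set ks. d k = u}"
    by (rule inj_on_inverseI[of _ p]) (use assms(2) in blast)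
  moreover have "p ` {k \<in> set ks. d k = u} \<subseteq> {k \<in> set ks. d k = v}"
    using assms(2) by blast
  ultimately show ?thesis
    unfolding c by (intro card_inj_on_le) auto
qed

text \<open>Only the word is given, not the partner map, so partners are found by scanning. For a
  word that describes no stage a scan may fail, and then there is no successor. Joining 1 to 2 is
  reserved for the last segment of the cycle.\<close>

definition next_word :: "nat \<Rightarrow> word \<Rightarrow> nat \<Rightarrow> nat \<Rightarrow> word option" where
  "next_word n d i j =
     (if d i = 1 \<and> d j = 1
      then map_option (\<lambda>r. (joined d i j)(r := 1)) (scan 1 2 d 0 [Suc j..<n])
      else if d i = 2 \<and> d j = 2
      then map_option (\<lambda>r. (joined d i j)(r := 2)) (scan 2 1 d 0 (rev [0..<i]))
      else if d i = 1 \<and> d j = 2 \<and> \<not> (3 \<le> n \<and> (\<forall>k<n. joined d i j k = 3)) then None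
      else Some (joined d i j))"

context linking
begin

lemma letter_open:
  assumes "k < n" "d k \<noteq> 0" "d k \<noteq> 3"
  shows "d k \<in> {1, 2}"
proof -
  have "d k = 1 \<or> d k = 2" using letters[OF assms(1)] assms by linarith
  then show ?thesis by simp
qed

lemma partner_inside:
  assumes "a < n" "d a = 1" "a < x" "x < p a" "d x \<in> {1, 2}"
  shows "a < p x" "p x < p a"
proof -
  have pa: "p a < n" using assms partner_lt by simp
  then have xn: "x < n" using assms by simp
  have ne: "p x \<noteq> a" "p x \<noteq> p a"
    using partner_partner[of x] partner_partner[of a] xn assms by auto
  have "((a < x) \<noteq> (p a < x)) = ((a < p x) \<noteq> (p a < p x))"
    using nested[of a x] assms xn by auto
  then have "(a < p x) \<noteq> (p a < p x)" using assms by simp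
  then show "a < p x" "p x < p a" using ne assms by linarith+
qed

lemma open_letter_less: "x < n \<Longrightarrow> d x = 1 \<Longrightarrow> x < p x \<and> d (p x) = 2"
  using partner_less[of x] partner_open[of x] partner_less[of "p x"] partner_lt[of x] partner_partner[of x]
  by auto

lemma close_letter_less: "x < n \<Longrightarrow> d x = 2 \<Longrightarrow> p x < x \<and> d (p x) = 1"
  using partner_less[of x] partner_open[of x] partner_less[of "p x"] partner_lt[of x] partner_partner[of x]
    partner_neq[of x]
  by auto

text \<open>The open letters strictly between \<open>j\<close> and its partner are paired among
  themselves. So they balance, and no prefix has more closing than opening letters, since the
  partner of a closing letter precedes it but still comes after \<open>j\<close>.\<close>

lemma scan_right:
  assumes j: "j < n" "d j = 1"
  shows "scan 1 2 d 0 [Suc j..<n] = Some (p j)"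
proof -
  have b: "j < p j" "d (p j) = 2" "p j < n" using open_letter_less[OF j] partner_lt j by auto
  have split: "[Suc j..<n] = [Suc j..<p j] @ p j # [Suc (p j)..<n]"
    using b upt_add_eq_append[of "Suc j" "p j" "n - p j"] upt_conv_Cons[of "p j" n] by simp
  show ?thesis unfolding split
  proof (rule scan_finds)
    show "occurrences 1 d [Suc j..<p j] \<le> occurrences 2 d [Suc j..<p j]"
    proof (rule occurrences_le)
      fix k assume k: "k \<in> set [Suc j..<p j]" "d k = 1"
      then have "k < n" "j < k" "k < p j" using b by auto
      then show "p k \<in> set [Suc j..<p j] \<and> d (p k) = 2 \<and> p (p k) = k"
        using partner_inside[of j k] j k open_letter_less[of k] partner_partner[of k] by auto
    qed simp
    fix t assume t: "t \<le> length [Suc j..<p j]"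
    have "take t [Suc j..<p j] = [Suc j..<Suc j + t]" using t b by (simp add: take_upt)
    moreover have "occurrences 2 d [Suc j..<Suc j + t] \<le> occurrences 1 d [Suc j..<Suc j + t]"
    proof (rule occurrences_le)
      fix k assume k: "k \<in> set [Suc j..<Suc j + t]" "d k = 2"
      then have "k < n" "j < k" "k < p j" using b t by auto
      then show "p k \<in> set [Suc j..<Suc j + t] \<and> d (p k) = 1 \<and> p (p k) = k"
        using partner_inside[of j k] j k close_letter_less[of k] partner_partner[of k] by auto
    qed simp
    ultimately show "occurrences 2 d (take t [Suc j..<p j]) \<le> occurrences 1 d (take t [Suc j..<p j])"
      by simp
  qed (use b in auto)
qed

text \<open>Mirror image of \<open>scan_right\<close>: read from right to left, the closing letters
  are the ones that raise the counter.\<close>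

lemma scan_left:
  assumes i: "i < n" "d i = 2"
  shows "scan 2 1 d 0 (rev [0..<i]) = Some (p i)"
proof -
  have b: "p i < i" "d (p i) = 1" "p i < n" "p (p i) = i"
    using close_letter_less[OF i] partner_lt partner_partner i by auto
  have "[0..<i] = [0..<p i] @ p i # [Suc (p i)..<i]"
    using b upt_add_eq_append[of 0 "p i" "i - p i"] upt_conv_Cons[of "p i" i] by simp
  then have split: "rev [0..<i] = rev [Suc (p i)..<i] @ p i # rev [0..<p i]" by simp
  show ?thesis unfolding split
  proof (rule scan_finds)
    show "occurrences 2 d (rev [Suc (p i)..<i]) \<le> occurrences 1 d (rev [Suc (p i)..<i])"
    proof (rule occurrences_le)
      fix k assume k: "k \<in> set (rev [Suc (p i)..<i])" "d k = 2"
      then have "k < n" "p i < k" "k < i" using i by auto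
      then show "p k \<in> set (rev [Suc (p i)..<i]) \<and> d (p k) = 1 \<and> p (p k) = k"
        using partner_inside[of "p i" k] b i k close_letter_less[of k] partner_partner[of k] by auto
    qed simp
    fix t assume t: "t \<le> length (rev [Suc (p i)..<i])"
    have "Suc (p i) + (i - Suc (p i) - t) = i - t" using t b by simp
    then have "take t (rev [Suc (p i)..<i]) = rev [i - t..<i]"
      by (simp only: take_rev drop_upt length_upt)
    moreover have "occurrences 1 d (rev [i - t..<i]) \<le> occurrences 2 d (rev [i - t..<i])"
    proof (rule occurrences_le)
      fix k assume k: "k \<in> set (rev [i - t..<i])" "d k = 1"
      then have "k < n" "p i < k" "k < i" using i t b by auto
      then show "p k \<in> set (rev [i - t..<i]) \<and> d (p k) = 2 \<and> p (p k) = k"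
        using partner_inside[of "p i" k] b i k open_letter_less[of k] partner_partner[of k] by auto
    qed simp
    ultimately show "occurrences 1 d (take t (rev [Suc (p i)..<i])) \<le> occurrences 2 d (take t (rev [Suc (p i)..<i]))"
      by simp
  qed (use b in auto)
qed

lemma next_word_relabeled:
  assumes "i < j" "j < n" "\<not> (d i = 1 \<and> d j = 2)"
  shows "next_word n d i j = Some (relabeled p d i j)"
  using assms scan_right[of j] scan_left[of i] by (auto simp: next_word_def relabeled_def)

text \<open>Every point of degree two is connected to an open end (\<open>full_conn\<close>), and
  \<open>i\<close> and \<open>j\<close> are the only open ends left.\<close>

lemma all_connected:
  assumes "i < n" "j < n" "p i = j" "d i = 1" "d j = 2" "\<And>k. k < n \<Longrightarrow> k \<noteq> i \<Longrightarrow> k \<noteq> j \<Longrightarrow> d k = 3" "k < n"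
  shows "(i, k) \<in> conn D"
proof -
  have ij: "(i, j) \<in> conn D" using partner_conn[of i] assms by auto
  show ?thesis
  proof (cases "k = i \<or> k = j")
    case False
    then obtain e where e: "e < n" "d e \<in> {1, 2}" "(k, e) \<in> conn D"
      using full_conn[of k] assms(6,7) by blast
    then have "d e \<noteq> 3" by auto
    then have "e = i \<or> e = j" using assms(6)[of e] e(1) by blast
    then show ?thesis using ij conn_sym[OF e(3)] conn_trans[of i j D k] by blast
  qed (use ij in auto)
qed

lemma incident_le_one:
  assumes "k < n" "d k \<in> {1, 2}" "e \<in> D" "fst e = k \<or> snd e = k" "f \<in> D" "fst f = k \<or> snd f = k"
  shows "e = f"
proof -
  have "card (incident D k) = 1" using degree[of k] assms by auto
  then obtain g where "incident D k = {g}" by (rule card_1_singletonE)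
  moreover have "e \<in> incident D k" "f \<in> incident D k" using assms by (auto simp: incident_def)
  ultimately show ?thesis by simp
qed

text \<open>If the segment were present, the degree one of \<open>i\<close> and \<open>j\<close>
  would make it a component of its own, but a third point is connected to them as well.\<close>

lemma closing_notin:
  assumes ij: "i < n" "j < n" "p i = j" "d i = 1" "d j = 2" "\<And>k. k < n \<Longrightarrow> k \<noteq> i \<Longrightarrow> k \<noteq> j \<Longrightarrow> d k = 3"
    and n: "3 \<le> n"
  shows "(i, j) \<notin> D"
proof
  assume D: "(i, j) \<in> D"
  have "\<exists>k<n. k \<noteq> i \<and> k \<noteq> j"
  proof (rule ccontr)
    assume "\<not> (\<exists>k<n. k \<noteq> i \<and> k \<noteq> j)"
    then have "{..<n} \<subseteq> {i, j}" by auto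
    then have "card {..<n} \<le> card {i, j}" by (intro card_mono) auto
    then show False using n card_insert_le_m1[of 2 "{j}" i] by simp
  qed
  then obtain k where k: "k < n" "k \<noteq> i" "k \<noteq> j" by blast
  have "k \<in> {i, j}"
  proof (rule conn_closed[OF all_connected[OF ij k(1)]])
    fix e assume e: "e \<in> D"
    have "e = (i, j)" if "fst e = i \<or> snd e = i"
      using incident_le_one[of i e "(i, j)"] that D e ij(1,4) by simp
    moreover have "e = (i, j)" if "fst e = j \<or> snd e = j"
      using incident_le_one[of j e "(i, j)"] that D e ij(2,5) by simp
    ultimately show "fst e \<in> {i, j} \<longleftrightarrow> snd e \<in> {i, j}"
      by (metis fst_conv insertCI insertE singletonD snd_conv)
  qed simp_all
  with k show False by simp
qed

text \<open>The path from \<open>i\<close> to \<open>j\<close> together with the closing segment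
  gives each of its points degree two. Hence no further segment of \<open>C\<close> touches these
  points, and by connectedness they are all the points.\<close>

lemma closing_full:
  assumes ij: "i < n" "j < n" "p i = j" "d i = 1" "d j = 2" and i_j: "i < j"
    and C: "finite C" "D \<subseteq> C" "(i, j) \<in> C" "(i, j) \<notin> D"
    and deg: "\<And>k. k < n \<Longrightarrow> card (incident C k) = 2"
    and con: "\<And>a b. a < n \<Longrightarrow> b < n \<Longrightarrow> (a, b) \<in> conn C"
    and pairs_C: "C \<subseteq> index_pairs n"
    and k: "k < n" "k \<noteq> i" "k \<noteq> j"
  shows "d k = 3"
proof -
  define S where "S = {k. (i, k) \<in> conn D}"
  have S3: "d k = 3" if "k \<in> S" "k < n" "k \<noteq> i" "k \<noteq> j" for k
  proof -
    have "d k \<noteq> 0" using isolated'[of k i] that by (auto simp: S_def)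
    moreover have "d k \<notin> {1, 2}" using conn_open[of i k] that ij by (auto simp: S_def)
    ultimately show ?thesis using letters[of k] that by auto
  qed
  \<comment> \<open>Two segments at \<open>k\<close> are known and its degree in \<open>C\<close> is
    two, so there are no others.\<close>
  have inc: "e \<in> D \<or> e = (i, j)" if e: "e \<in> C" "fst e = k \<or> snd e = k" and k: "k \<in> S" "k < n" for e k
  proof -
    let ?E = "if k = i \<or> k = j then insert (i, j) (incident D k) else incident D k"
    have "(i, j) \<notin> incident D k" using C by (simp add: incident_def)
    then have "card ?E = 2"
      using degree[of i] degree[of j] degree[of k] ij S3[OF k] k finite_incident[of k] by auto
    moreover have "?E \<subseteq> incident C k" using C by (auto simp: incident_def)
    moreover have "finite (incident C k)" using C by (simp add: incident_def)
    ultimately have "?E = incident C k" using deg[OF k(2)] by (intro card_subset_eq) auto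
    moreover have "e \<in> incident C k" using e by (simp add: incident_def)
    ultimately show ?thesis by (auto simp: incident_def split: if_splits)
  qed
  have jS: "j \<in> S" using partner_conn[of i] ij by (auto simp: S_def)
  have "k \<in> S"
  proof (rule conn_closed[OF con[OF ij(1) k(1)]])
    show "i \<in> S" by (simp add: S_def)
    fix e assume e: "e \<in> C"
    have en: "fst e < n" "snd e < n" using e pairs_C by (auto simp: index_pairs_def)
    have step: "fst e \<in> S \<longleftrightarrow> snd e \<in> S" if "e \<in> D"
    proof -
      have c: "(fst e, snd e) \<in> conn D" using that by (intro conn_edge) simp
      show ?thesis
        using conn_trans[OF _ c, of i] conn_trans[OF _ conn_sym[OF c], of i] by (auto simp: S_def)
    qed
    show "fst e \<in> S \<longleftrightarrow> snd e \<in> S"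
    proof (cases "fst e \<in> S \<or> snd e \<in> S")
      case True
      then have "e \<in> D \<or> e = (i, j)" using inc[OF e] en by blast
      then show ?thesis using step jS \<open>i \<in> S\<close> by auto
    qed simp
  qed
  then show ?thesis using S3 k by blast
qed

end

section \<open>An automaton that reads segments\<close>

context ordered_points
begin

text \<open>\<open>point_below\<close> is the only access of the automaton to the coordinates.
  Points below the new segment must be finished because it hides them; points above must be
  untouched because all their segments lie above it and have to come later.\<close>

definition admissible :: "word \<Rightarrow> nat \<Rightarrow> nat \<Rightarrow> bool" where
  "admissible d i j \<longleftrightarrow> i < j \<and> j < n \<and> d i \<noteq> 3 \<and> d j \<noteq> 3 \<and>
     (\<forall>k. i < k \<longrightarrow> k < j \<longrightarrow> d k = (if point_below i k j then 3 else 0))"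

text \<open>A deterministic automaton whose state consists of a word and a left end. The final
  condition holds after closing, and from the start if \<open>n = 0\<close>, where the empty
  sequence stands for the empty cycle.\<close>

primrec accepts :: "word \<Rightarrow> nat \<Rightarrow> edge list \<Rightarrow> bool" where
  "accepts d m [] = (\<forall>k<n. d k = 3)"
| "accepts d m (s # es) = (admissible d (fst s) (snd s) \<and> m < snd s \<and>
     (\<exists>d'. next_word n d (fst s) (snd s) = Some d' \<and> accepts d' (fst s) es))"

definition spanning_cycle :: "edge set \<Rightarrow> bool" where
  "spanning_cycle C \<longleftrightarrow> planar C \<and> (\<forall>k<n. card (incident C k) = 2) \<and> (\<forall>a<n. \<forall>b<n. (a, b) \<in> conn C)"

text \<open>Visibility from above: no chosen segment hides a point that can still receive
  one.\<close>

definition covers_below :: "edge set \<Rightarrow> word \<Rightarrow> bool" where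
  "covers_below D d \<longleftrightarrow> (\<forall>t\<in>D. \<forall>k. fst t < k \<longrightarrow> k < snd t \<longrightarrow> d k \<noteq> 3 \<longrightarrow> \<not> point_below (fst t) k (snd t))"

lemma admissible_gap: "admissible d i j \<Longrightarrow> i < k \<Longrightarrow> k < j \<Longrightarrow> d k \<in> {0, 3}"
  by (simp add: admissible_def)

text \<open>The four conditions of \<open>belowI\<close> come from the letters. An end of
  \<open>t\<close> between \<open>i\<close> and \<open>j\<close> is touched, so its letter is 3 and
  it lies below the new segment. An end of the new segment within the range of \<open>t\<close> has
  another letter than 3, so it lies above \<open>t\<close>.\<close>

lemma admissible_above:
  assumes L: "linking n D d p" and cov: "covers_below D d" and adm: "admissible d i j"
    and t: "t \<in> D" "t \<noteq> (i, j)"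
  shows "uncrossed t (i, j)" "\<not> below (i, j) t"
proof -
  interpret linking n D d p by fact
  obtain k l where kl: "t = (k, l)" by (cases t)
  have tn: "k < l" "l < n" using pairs t(1) by (auto simp: kl index_pairs_def)
  have ij: "i < j" "j < n" "d i \<noteq> 3" "d j \<noteq> 3" using adm by (auto simp: admissible_def)
  have c: "(k, l) \<in> conn D" "(l, k) \<in> conn D"
    using t(1) conn_edge[of k l D] conn_sym[of k l D] by (simp_all add: kl)
  have touched: "d q \<noteq> 0" if q: "q = k \<or> q = l" for q
  proof
    assume 0: "d q = 0"
    from q show False
    proof
      assume "q = k"
      then show False using isolated[of k l] 0 c tn by simp
    next
      assume "q = l"
      then show False using isolated[of l k] 0 c tn by simp
    qed
  qed
  have mid: "point_below i q j" if "q = k \<or> q = l" "i < q" "q < j" for q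
    using adm touched[OF that(1)] that(2,3) by (auto simp: admissible_def split: if_splits)
  have inner: "\<not> point_below k q l" if "q = i \<or> q = j" "k < q" "q < l" for q
    using cov t(1) that ij unfolding covers_below_def kl by force
  have b: "below t (i, j)" if ov: "overlap (i, j) t"
    unfolding kl
  proof (rule belowI[OF ij(1,2) tn])
    have o: "k < j" "i < l" using ov by (auto simp: overlap_def kl)
    show "overlap (i, j) (k, l)" using ov by (simp add: kl)
    show "(i, j) \<noteq> (k, l)" using t(2) kl by auto
    show "k < i \<Longrightarrow> \<not> point_below k i l" using inner[of i] o by simp
    show "i < k \<Longrightarrow> point_below i k j" using mid[of k] o by simp
    show "j < l \<Longrightarrow> \<not> point_below k j l" using inner[of j] o by simp
    show "l < j \<Longrightarrow> point_below i l j" using mid[of l] o by simp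
  qed
  have tp: "t \<in> index_pairs n" "(i, j) \<in> index_pairs n" using tn ij by (auto simp: kl index_pairs_def)
  show "uncrossed t (i, j)" using b by (auto simp: uncrossed_def overlap_sym)
  show "\<not> below (i, j) t"
    using b below_asym[OF tp] below_overlap by blast
qed

lemma planar_insert:
  assumes "planar D" "s \<in> index_pairs n" "\<And>t. t \<in> D \<Longrightarrow> t \<noteq> s \<Longrightarrow> uncrossed t s"
  shows "planar (insert s D)"
proof -
  have "uncrossed s t" if "t \<in> D" "t \<noteq> s" for t
    using assms(3)[OF that] by (auto simp: uncrossed_def overlap_sym)
  then show ?thesis
    using assms unfolding planar_def by (metis insert_iff insert_subset)
qed

lemma next_word_3: "next_word n d i j = Some d' \<Longrightarrow> d k = 3 \<Longrightarrow> k \<noteq> i \<Longrightarrow> k \<noteq> j \<Longrightarrow> d' k = 3"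
  by (auto simp: next_word_def joined_def dest!: scan_SomeD split: if_splits)

text \<open>The letter 3 is never lost, so the old segments cause no trouble. In the range of the
  new segment every letter other than 3 is 0, which \<open>admissible\<close> permits only for
  points above it.\<close>

lemma covers_below_insert:
  assumes "covers_below D d" "admissible d i j" "next_word n d i j = Some d'" "D \<subseteq> index_pairs n"
  shows "covers_below (insert (i, j) D) d'"
  unfolding covers_below_def
proof (intro ballI allI impI)
  fix t k assume t: "t \<in> insert (i, j) D" and k: "fst t < k" "k < snd t" "d' k \<noteq> 3"
  have "d k \<noteq> 3 \<or> k = i \<or> k = j" using next_word_3[OF assms(3)] k(3) by blast
  then have d: "d k \<noteq> 3" using assms(2) by (auto simp: admissible_def)
  show "\<not> point_below (fst t) k (snd t)"
  proof (cases "t \<in> D")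
    case True
    then show ?thesis using assms(1) k d unfolding covers_below_def by blast
  next
    case False
    then have "t = (i, j)" using t by simp
    then show ?thesis using assms(2) k d by (auto simp: admissible_def)
  qed
qed

text \<open>By \<open>admissible_above\<close>, no admissible segment crosses a segment of
  \<open>D\<close> or lies below one. This preserves planarity and at the same time yields the
  bottom-up order.\<close>

lemma accepts_sound:
  assumes "linking n D d p" "covers_below D d" "planar D" "accepts d m es"
  shows "spanning_cycle (D \<union> set es) \<and> bottom_up es \<and> advancing m es \<and> set es \<inter> D = {} \<and>
    (\<forall>s\<in>D. \<forall>t\<in>set es. \<not> below t s)"
  using assms
proof (induction es arbitrary: D d p m)
  case Nil
  interpret linking n D d p by fact
  \<comment> \<open>In a linking a letter 3 requires an open end elsewhere, so all letters can be 3
    only without points. A nonempty cycle is therefore accepted through the closing case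
    below.\<close>
  have "n = 0"
  proof (rule ccontr)
    assume "n \<noteq> 0"
    then show False using full_conn[of 0] Nil.prems(4) by fastforce
  qed
  then show ?case using Nil.prems(3) unfolding spanning_cycle_def by simp
next
  case (Cons s es)
  interpret linking n D d p by fact
  obtain i j where s: "s = (i, j)" by (cases s)
  obtain d' where adm: "admissible d i j" and m: "m < j" and d': "next_word n d i j = Some d'"
    and acc: "accepts d' i es"
    using Cons.prems(4) by (auto simp: s)
  have ij: "i < j" "j < n" "d i \<noteq> 3" "d j \<noteq> 3" "s \<in> index_pairs n"
    using adm by (auto simp: admissible_def index_pairs_def s)
  note gap = admissible_gap[OF adm]
  note above = admissible_above[OF Cons.prems(1,2) adm, folded s]
  have pl: "planar (insert s D)" using planar_insert[OF Cons.prems(3) ij(5)] above(1) by blast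
  have min: "\<not> below s t" if "t \<in> D" for t
    using above(2)[OF that] below_asym[OF ij(5) ij(5)] by blast
  show ?case
  proof (cases "d i = 1 \<and> d j = 2")
    case False
    have r: "d' = relabeled p d i j" using next_word_relabeled[OF ij(1,2) False] d' by simp
    obtain p' where L: "linking n (insert s D) d' p'"
      using linking_insert[OF ij(1-4) gap False] unfolding s r by blast
    have "covers_below (insert s D) d'"
      using covers_below_insert[OF Cons.prems(2) adm d' pairs] unfolding s .
    from Cons.IH[OF L this pl acc] have IH: "spanning_cycle (insert s D \<union> set es)" "bottom_up es"
      "advancing i es" "set es \<inter> insert s D = {}" "\<forall>u\<in>insert s D. \<forall>t\<in>set es. \<not> below t u"
      by blast+
    have "s \<notin> D"
    proof
      assume "s \<in> D"
      then have c: "(i, j) \<in> conn D" "(j, i) \<in> conn D" using conn_edge conn_sym s by blast+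
      have "i < n" using ij by simp
      moreover have "d i \<noteq> 0" "d j \<noteq> 0"
        using isolated[of i j] isolated[of j i] c ij by auto
      ultimately have o: "i < n" "d i \<in> {1, 2}" "d j \<in> {1, 2}"
        using letter_open[of i] letter_open[of j] ij by blast+
      then have "p i = j" using conn_open[of i j] c ij by auto
      then show False using partner_less[of i] partner_less[of j] partner_partner[of i] o ij False by auto
    qed
    then show ?thesis using IH min m by (auto simp: s)
  next
    case True
    have g: "3 \<le> n" "\<forall>k<n. d' k = 3"
      using d' True by (auto simp: next_word_def split: if_splits)
    \<comment> \<open>An admissible pair needs two letters other than 3, and none are left.\<close>
    have "es = []"
    proof (rule ccontr)
      assume "es \<noteq> []"
      then obtain t fs where "es = t # fs" by (cases es) auto
      then have "admissible d' (fst t) (snd t)" using acc by simp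
      then show False using g(2) by (auto simp: admissible_def)
    qed
    have jd: "d' = joined d i j"
      using d' True by (auto simp: next_word_def split: if_splits)
    have rest: "d k = 3" if "k < n" "k \<noteq> i" "k \<noteq> j" for k
      using g(2) that by (auto simp: jd joined_def)
    have pij: "p i = j" using adjacent_partner[OF ij(1,2) gap] True by blast
    have i_n: "i < n" using ij by simp
    have dij: "d i = 1" "d j = 2" using True by auto
    have "s \<notin> D" using closing_notin[OF i_n ij(2) pij dij rest g(1)] unfolding s by blast
    have c: "(i, k) \<in> conn (insert s D)" if "k < n" for k
      using conn_mono[OF subset_insertI all_connected[OF i_n ij(2) pij dij rest that]] .
    have "spanning_cycle (insert s D)"
      unfolding spanning_cycle_def
    proof (intro conjI allI impI pl)
      fix k assume "k < n"
      then show "card (incident (insert s D) k) = 2"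
        using card_incident_insert[OF finite_incident \<open>s \<notin> D\<close>[unfolded s], of k] degree[of k] rest[of k] dij
        by (auto simp: s)
    next
      fix a b assume "a < n" "b < n"
      then show "(a, b) \<in> conn (insert s D)" using conn_trans[OF conn_sym[OF c] c] by blast
    qed
    then show ?thesis using \<open>s \<notin> D\<close> min m \<open>es = []\<close> by (auto simp: s)
  qed
qed

text \<open>Let \<open>s\<close> be the next segment. All segments at a point below \<open>s\<close>
  lie below \<open>s\<close>, so they have been placed and the degree there is two. All segments at
  a point above \<open>s\<close> lie above \<open>s\<close>, so they are still to come and the
  degree there is zero.\<close>

lemma accepts_complete:
  assumes "linking n D d p" "spanning_cycle (D \<union> set es)" "bottom_up es" "advancing m es"
    "set es \<inter> D = {}" "\<forall>s\<in>D. \<forall>t\<in>set es. \<not> below t s"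
  shows "accepts d m es"
  using assms
proof (induction es arbitrary: D d p m)
  case Nil
  interpret linking n D d p by fact
  have "d k = 3" if "k < n" for k
    using degree[OF that] Nil.prems(2) that by (auto simp: spanning_cycle_def split: if_splits)
  then show ?case by simp
next
  case (Cons s es)
  interpret linking n D d p by fact
  obtain i j where s: "s = (i, j)" by (cases s)
  let ?C = "D \<union> set (s # es)"
  have C: "planar ?C" "\<And>k. k < n \<Longrightarrow> card (incident ?C k) = 2"
    "\<And>a b. a < n \<Longrightarrow> b < n \<Longrightarrow> (a, b) \<in> conn ?C"
    using Cons.prems(2) by (auto simp: spanning_cycle_def)
  have finC: "finite ?C" using planar_finite[OF C(1)] .
  have pairsC: "?C \<subseteq> index_pairs n" using C(1) unfolding planar_def by blast
  have sD: "s \<notin> D" "s \<notin> set es" using Cons.prems(3,5) by auto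
  have ij: "i < j" "j < n" using pairsC by (auto simp: s index_pairs_def)
  have i_n: "i < n" using ij by simp
  have le2: "card (incident (insert s D) k) \<le> 2" if "k < n" for k
  proof -
    have "incident (insert s D) k \<subseteq> incident ?C k" by (auto simp: incident_def)
    moreover have "finite (incident ?C k)" using finC by (simp add: incident_def)
    ultimately show ?thesis using C(2)[OF that] card_mono by metis
  qed
  note ins = card_incident_insert[OF finite_incident sD(1)[unfolded s], folded s]
  \<comment> \<open>At an end with letter 3 the new segment would raise the degree above
    two.\<close>
  have ne3: "d i \<noteq> 3" "d j \<noteq> 3"
    using le2[of i] le2[of j] ins[of i] ins[of j] degree[of i] degree[of j] ij by (auto split: if_splits)
  have adm: "admissible d i j"
    unfolding admissible_def
  proof (intro conjI allI impI ij ne3)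
    fix k assume k: "i < k" "k < j"
    then have kn: "k < n" using ij by simp
    have inc: "overlap s t" "point_below i k j \<Longrightarrow> below t s" "\<not> point_below i k j \<Longrightarrow> below s t"
      if "t \<in> ?C" "fst t = k \<or> snd t = k" for t
    proof -
      have "t \<noteq> s" using that(2) k by (auto simp: s)
      then have "uncrossed (i, j) t" using C(1) that(1) unfolding planar_def s by auto
      moreover have "t \<in> index_pairs n" using pairsC that(1) by blast
      ultimately show "overlap s t" "point_below i k j \<Longrightarrow> below t s" "\<not> point_below i k j \<Longrightarrow> below s t"
        using incident_below[OF k ij(2)] that(2) unfolding s by blast+
    qed
    show "d k = (if point_below i k j then 3 else 0)"
    proof (cases "point_below i k j")
      case True
      have "t \<in> D" if "t \<in> incident ?C k" for t
      proof -
        have t: "t \<in> ?C" "fst t = k \<or> snd t = k" using that by (auto simp: incident_def)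
        then have "below t s" using inc True by blast
        then have "t \<notin> set es" using Cons.prems(3) by auto
        moreover have "t \<noteq> s" using t(2) k by (auto simp: s)
        ultimately show ?thesis using t(1) by simp
      qed
      then have "incident D k = incident ?C k" by (auto simp: incident_def)
      then have "card (incident D k) = 2" using C(2)[OF kn] by simp
      then show ?thesis using degree[OF kn] True by (simp split: if_splits)
    next
      case False
      have "t \<notin> D" if "fst t = k \<or> snd t = k" for t
      proof
        assume "t \<in> D"
        then have "below s t" using inc(3)[of t] that False by auto
        then show False using Cons.prems(6) \<open>t \<in> D\<close> by auto
      qed
      then have "incident D k = {}" by (auto simp: incident_def)
      then have "card (incident D k) = 0" by simp
      then show ?thesis using degree[OF kn] False by (simp split: if_splits)
    qed
  qed
  note gap = admissible_gap[OF adm]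
  have m: "m < j" "advancing i es" using Cons.prems(4) by (auto simp: s)
  show ?case
  proof (cases "d i = 1 \<and> d j = 2")
    case False
    obtain p' where L: "linking n (insert s D) (relabeled p d i j) p'"
      using linking_insert[OF ij ne3 gap False] unfolding s by blast
    have "accepts (relabeled p d i j) i es"
    proof (rule Cons.IH[OF L])
      show "spanning_cycle (insert s D \<union> set es)" using Cons.prems(2) by simp
      show "\<forall>u\<in>insert s D. \<forall>t\<in>set es. \<not> below t u" using Cons.prems(3,6) by auto
    qed (use Cons.prems sD m in auto)
    then show ?thesis
      using adm m next_word_relabeled[OF ij False] by (simp add: s)
  next
    case True
    then have dij: "d i = 1" "d j = 2" by auto
    have pij: "p i = j" using adjacent_partner[OF ij gap dij] .
    have rest: "d k = 3" if "k < n" "k \<noteq> i" "k \<noteq> j" for k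
      using closing_full[OF i_n ij(2) pij dij ij(1) finC _ _ sD(1)[unfolded s] C(2) C(3) pairsC that]
      by (auto simp: s)
    have full: "card (incident (insert s D) k) = 2" if "k < n" for k
      using ins[of k] degree[OF that] rest[OF that] dij by auto
    \<comment> \<open>After closing, all degrees have reached two, so a further segment would exceed
      them.\<close>
    have es: "es = []"
    proof (rule ccontr)
      assume "es \<noteq> []"
      then obtain t where t: "t \<in> set es" by (cases es) auto
      then have tn: "fst t < n" "t \<notin> insert s D"
        using pairsC Cons.prems(5) sD(2) by (auto simp: index_pairs_def)
      have "incident (insert s D) (fst t) = incident ?C (fst t)"
      proof (rule card_subset_eq)
        show "finite (incident ?C (fst t))" using finC by (simp add: incident_def)
        show "incident (insert s D) (fst t) \<subseteq> incident ?C (fst t)" by (auto simp: incident_def)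
        show "card (incident (insert s D) (fst t)) = card (incident ?C (fst t))"
          using full[OF tn(1)] C(2)[OF tn(1)] by simp
      qed
      moreover have "t \<in> incident ?C (fst t)" using t by (simp add: incident_def)
      ultimately have "t \<in> incident (insert s D) (fst t)" by blast
      then show False using tn(2) unfolding incident_def by blast
    qed
    have "3 \<le> n"
    proof -
      have "card (incident ?C i) = 2" using C(2)[OF i_n] .
      \<comment> \<open>A segment at \<open>i\<close> is determined by its other end, which is
        \<open>fst e + snd e - i\<close>; two segments require two further points.\<close>
      moreover have "incident ?C i \<subseteq> (\<lambda>l. (min i l, max i l)) ` ({..<n} - {i})"
      proof
        fix e assume "e \<in> incident ?C i"
        then have e: "e \<in> index_pairs n" "fst e = i \<or> snd e = i" using pairsC by (auto simp: incident_def)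
        then have "e = (min i (fst e + snd e - i), max i (fst e + snd e - i))"
          "fst e + snd e - i \<in> {..<n} - {i}"
          by (auto simp: index_pairs_def min_def max_def prod_eq_iff)
        then show "e \<in> (\<lambda>l. (min i l, max i l)) ` ({..<n} - {i})" by (rule image_eqI)
      qed
      ultimately have "2 \<le> card ((\<lambda>l. (min i l, max i l)) ` ({..<n} - {i}))"
        using card_mono[of "(\<lambda>l. (min i l, max i l)) ` ({..<n} - {i})" "incident ?C i"] by simp
      also have "\<dots> \<le> card ({..<n} - {i})" by (rule card_image_le) simp
      finally show ?thesis using i_n by simp
    qed
    moreover have "\<forall>k<n. joined d i j k = 3" using rest dij by (auto simp: joined_def)
    ultimately have "next_word n d i j = Some (joined d i j)"
      using dij by (simp add: next_word_def)
    then show ?thesis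
      using adm m es \<open>\<forall>k<n. joined d i j k = 3\<close> by (simp add: s)
  qed
qed

theorem accepts_iff:
  "accepts (\<lambda>k. 0) 0 es \<longleftrightarrow> spanning_cycle (set es) \<and> bottom_up es \<and> advancing 0 es"
  using accepts_sound[OF linking_empty, of 0 es] accepts_complete[OF linking_empty, of es 0]
  by (auto simp: covers_below_def planar_def)

end

section \<open>The combination graph\<close>

context ordered_points
begin

lemma segments_eq: "segments (v ` {..<n}) = seg ` index_pairs n"
proof
  show "segments (v ` {..<n}) \<subseteq> seg ` index_pairs n"
  proof
    fix s assume "s \<in> segments (v ` {..<n})"
    then obtain a b where ab: "s = closed_segment (v a) (v b)" "a < n" "b < n" "v a \<noteq> v b"
      unfolding segments_def by blast
    then have "a \<noteq> b" by auto
    then show "s \<in> seg ` index_pairs n"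
    proof (cases a b rule: linorder_cases)
      case less
      then show ?thesis using ab by (auto simp: index_pairs_def seg_def intro!: image_eqI[of _ _ "(a, b)"])
    next
      case greater
      then show ?thesis using ab
        by (auto simp: index_pairs_def seg_def closed_segment_commute intro!: image_eqI[of _ _ "(b, a)"])
    qed simp
  qed
  show "seg ` index_pairs n \<subseteq> segments (v ` {..<n})"
  proof
    fix s assume "s \<in> seg ` index_pairs n"
    then obtain a b where ab: "a < b" "b < n" "s = closed_segment (v a) (v b)"
      by (auto simp: index_pairs_def seg_def)
    then have "v a \<noteq> v b" using v_eq_iff[of a b] by simp
    moreover have "v a \<in> v ` {..<n}" "v b \<in> v ` {..<n}" using ab by simp_all
    ultimately show "s \<in> segments (v ` {..<n})" using ab(3) unfolding segments_def by blast
  qed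
qed

lemma crossing_free_seg:
  assumes "C \<subseteq> index_pairs n"
  shows "crossing_free (seg ` C) \<longleftrightarrow> planar C"
proof -
  have "seg s = seg t \<longleftrightarrow> s = t" "non_crossing (seg s) (seg t) \<longleftrightarrow> uncrossed s t" if "s \<in> C" "t \<in> C" for s t
    using inj_onD[OF inj_on_seg] non_crossing_seg_iff that assms by blast+
  then show ?thesis using assms unfolding crossing_free_def planar_def by auto
qed

lemma seg_endpoint:
  assumes "e \<in> index_pairs n" "k < n"
  shows "(\<exists>q. q \<noteq> v k \<and> seg e = closed_segment (v k) q) \<longleftrightarrow> fst e = k \<or> snd e = k"
proof -
  have e: "fst e < snd e" "fst e < n" "snd e < n" using assms by (auto simp: index_pairs_def)
  have "v (fst e) \<noteq> v (snd e)" "v (fst e) = v k \<longleftrightarrow> fst e = k" "v (snd e) = v k \<longleftrightarrow> snd e = k"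
    using e assms(2) v_eq_iff by auto
  then show ?thesis
    unfolding seg_def closed_segment_eq doubleton_eq_iff by metis
qed

lemma point_degree_seg:
  assumes "C \<subseteq> index_pairs n" "k < n"
  shows "point_degree (seg ` C) (v k) = card (incident C k)"
proof -
  have "{s \<in> seg ` C. \<exists>q. q \<noteq> v k \<and> s = closed_segment (v k) q} = seg ` incident C k"
    using seg_endpoint assms unfolding incident_def by blast
  moreover have "inj_on seg (incident C k)"
    by (rule inj_on_subset[OF inj_on_seg]) (use assms in \<open>auto simp: incident_def\<close>)
  ultimately show ?thesis by (simp add: point_degree_def card_image)
qed

lemma adjacency_seg:
  assumes "C \<subseteq> index_pairs n"
  shows "adjacency (seg ` C) = map_prod v v ` adj C"
proof (intro set_eqI iffI)
  fix x assume "x \<in> adjacency (seg ` C)"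
  then obtain p q e where x: "x = (p, q)" "p \<noteq> q" "e \<in> C" "closed_segment p q = seg e"
    unfolding adjacency_def by blast
  then have "p = v (fst e) \<and> q = v (snd e) \<or> p = v (snd e) \<and> q = v (fst e)"
    by (simp add: seg_def closed_segment_eq doubleton_eq_iff)
  then show "x \<in> map_prod v v ` adj C"
  proof
    assume "p = v (fst e) \<and> q = v (snd e)"
    then have "x = map_prod v v e" by (simp add: x(1) map_prod_def case_prod_beta)
    then show ?thesis using x(3) by (simp add: adj_def)
  next
    assume "p = v (snd e) \<and> q = v (fst e)"
    then have "x = map_prod v v (snd e, fst e)" by (simp add: x(1))
    moreover have "(snd e, fst e) \<in> adj C" using x(3) by (simp add: adj_def)
    ultimately show ?thesis by blast
  qed
next
  fix x assume "x \<in> map_prod v v ` adj C"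
  then obtain a b where ab: "x = (v a, v b)" "(a, b) \<in> C \<or> (b, a) \<in> C" by (auto simp: adj_def)
  then have "a \<noteq> b" "a < n" "b < n" using assms by (auto simp: index_pairs_def)
  then have "v a \<noteq> v b" using v_eq_iff by blast
  moreover have "closed_segment (v a) (v b) \<in> seg ` C"
  proof -
    have "closed_segment (v a) (v b) = seg (a, b)" "closed_segment (v a) (v b) = seg (b, a)"
      by (simp_all add: seg_def insert_commute)
    then show ?thesis using ab(2) by (metis imageI)
  qed
  ultimately show "x \<in> adjacency (seg ` C)" by (simp add: adjacency_def ab(1))
qed

text \<open>As \<open>v\<close> is injective on the indices below \<open>n\<close>, every walk along
  segments lifts to a walk on the indices.\<close>

lemma conn_seg:
  assumes C: "C \<subseteq> index_pairs n" and ab: "a < n" "b < n"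
  shows "(v a, v b) \<in> (adjacency (seg ` C))\<^sup>* \<longleftrightarrow> (a, b) \<in> conn C"
proof
  assume "(v a, v b) \<in> (adjacency (seg ` C))\<^sup>*"
  then have "\<exists>c<n. v b = v c \<and> (a, c) \<in> conn C"
  proof (induction rule: rtrancl_induct)
    case base
    then show ?case using ab by auto
  next
    case (step y z)
    then obtain c e f where c: "c < n" "y = v c" "(a, c) \<in> conn C" "y = v e" "z = v f" "(e, f) \<in> adj C"
      unfolding adjacency_seg[OF C] by auto
    then have "e < n" "f < n" using C by (auto simp: adj_def index_pairs_def)
    then have "c = e" using c v_eq_iff by metis
    then have "(a, f) \<in> conn C" using c unfolding conn_def by (meson rtrancl.rtrancl_into_rtrancl)
    then show ?case using c \<open>f < n\<close> by blast
  qed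
  then show "(a, b) \<in> conn C" using v_eq_iff ab by auto
next
  assume "(a, b) \<in> conn C"
  then show "(v a, v b) \<in> (adjacency (seg ` C))\<^sup>*"
    unfolding conn_def
  proof (induction rule: rtrancl_induct)
    case (step y z)
    then have "(v y, v z) \<in> adjacency (seg ` C)" unfolding adjacency_seg[OF C] by force
    with step show ?case by simp
  qed simp
qed

lemma crossing_free_spanning_cycles_eq:
  "crossing_free_spanning_cycles (v ` {..<n}) = (`) seg ` {C. spanning_cycle C}"
proof (intro set_eqI iffI)
  fix K assume K: "K \<in> crossing_free_spanning_cycles (v ` {..<n})"
  then have "K \<subseteq> seg ` index_pairs n"
    by (simp add: crossing_free_spanning_cycles_def segments_eq)
  then obtain C where C: "C \<subseteq> index_pairs n" "K = seg ` C" by (auto simp: subset_image_iff)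
  have "spanning_cycle C"
    using K point_degree_seg[OF C(1)] conn_seg[OF C(1)] crossing_free_seg[OF C(1)]
    by (auto simp: crossing_free_spanning_cycles_def spanning_cycle_def C(2))
  then show "K \<in> (`) seg ` {C. spanning_cycle C}" using C by blast
next
  fix K assume "K \<in> (`) seg ` {C. spanning_cycle C}"
  then obtain C where K: "K = seg ` C" "spanning_cycle C" by blast
  then have C: "C \<subseteq> index_pairs n" by (simp add: spanning_cycle_def planar_def)
  show "K \<in> crossing_free_spanning_cycles (v ` {..<n})"
    using K(2) point_degree_seg[OF C] conn_seg[OF C] crossing_free_seg[OF C] C
    by (auto simp: crossing_free_spanning_cycles_def spanning_cycle_def K(1) segments_eq)
qed

end

lemma div_mod_block:
  assumes "b < (N :: nat)"
  shows "(a * N + b) div N = a" "(a * N + b) mod N = b"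
  using assms by auto

section \<open>Words as numbers in base 4\<close>

definition digit :: "nat \<Rightarrow> nat \<Rightarrow> nat" where
  "digit c k = c div 4 ^ k mod 4"

definition code :: "nat \<Rightarrow> word \<Rightarrow> nat" where
  "code n d = (\<Sum>k<n. d k * 4 ^ k)"

text \<open>The letters beyond \<open>n\<close> are fixed to 0, so that a code determines its word
  as a function and \<open>digit\<close> inverts \<open>code\<close>.\<close>

definition is_word :: "nat \<Rightarrow> word \<Rightarrow> bool" where
  "is_word n d \<longleftrightarrow> (\<forall>k<n. d k < 4) \<and> (\<forall>k\<ge>n. d k = 0)"

lemma code_less: "\<forall>k<n. d k < 4 \<Longrightarrow> code n d < 4 ^ n"
proof (induction n)
  case (Suc n)
  then have "code n d < 4 ^ n" "d n \<le> 3" by (simp_all add: less_Suc_eq_le[symmetric])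
  then have "code n d + d n * 4 ^ n < 4 ^ n + 3 * 4 ^ n"
    by (intro add_less_le_mono mult_right_mono) auto
  then show ?case by (simp add: code_def)
qed (simp add: code_def)

lemma digit_add_high:
  assumes "k < n"
  shows "digit (a + b * 4 ^ n) k = digit a k"
proof -
  obtain m where n: "n = k + Suc m" using less_imp_Suc_add[OF assms] by auto
  have "a + b * 4 ^ n = a + 4 ^ k * (4 * (b * 4 ^ m))" by (simp add: n power_add)
  then have "(a + b * 4 ^ n) div 4 ^ k = a div 4 ^ k + 4 * (b * 4 ^ m)"
    by (metis add.commute div_mult_self2 power_not_zero zero_neq_numeral)
  then show ?thesis by (simp add: digit_def)
qed

lemma digit_code: "\<forall>k<n. d k < 4 \<Longrightarrow> k < n \<Longrightarrow> digit (code n d) k = d k"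
proof (induction n)
  case (Suc n)
  have c: "code (Suc n) d = code n d + d n * 4 ^ n" by (simp add: code_def)
  show ?case
  proof (cases "k = n")
    case True
    have "code n d < 4 ^ n" using Suc.prems by (intro code_less) simp
    then show ?thesis using Suc.prems by (simp add: True c digit_def)
  next
    case False
    then show ?thesis using Suc by (simp add: c digit_add_high)
  qed
qed simp

lemma is_word_digit: "c < 4 ^ n \<Longrightarrow> is_word n (digit c)"
proof -
  assume "c < 4 ^ n"
  have "c div 4 ^ k = 0" if "n \<le> k" for k
    by (rule div_less[OF less_le_trans[OF \<open>c < 4 ^ n\<close> power_increasing[OF that]]]) simp
  then show ?thesis by (auto simp: is_word_def digit_def)
qed

lemma code_digit: "c < 4 ^ n \<Longrightarrow> code n (digit c) = c"
proof (induction n arbitrary: c)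
  case (Suc n)
  have "code n (digit c) = code n (digit (c mod 4 ^ n))"
    unfolding code_def using digit_add_high[of _ n "c mod 4 ^ n" "c div 4 ^ n", unfolded mod_div_mult_eq]
    by (intro sum.cong) auto
  also have "\<dots> = c mod 4 ^ n" by (rule Suc.IH) simp
  finally have "code n (digit c) = c mod 4 ^ n" .
  moreover have "digit c n = c div 4 ^ n"
  proof -
    have "c div 4 ^ n < 4" using Suc.prems by (intro less_mult_imp_div_less) simp
    then show ?thesis by (simp add: digit_def)
  qed
  moreover have "code (Suc n) (digit c) = code n (digit c) + digit c n * 4 ^ n"
    by (simp add: code_def)
  ultimately show ?case by (simp only: mod_div_mult_eq)
qed (simp add: code_def)

lemma digit_code_word: "is_word n d \<Longrightarrow> digit (code n d) = d"
proof
  fix k assume d: "is_word n d"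
  show "digit (code n d) k = d k"
  proof (cases "k < n")
    case True
    then show ?thesis using d by (intro digit_code) (auto simp: is_word_def)
  next
    case False
    have "is_word n (digit (code n d))"
      using d by (intro is_word_digit code_less) (simp add: is_word_def)
    then show ?thesis using False d by (simp add: is_word_def)
  qed
qed

text \<open>Both sides are sums, which avoids truncated subtraction.\<close>

lemma code_upd:
  assumes k: "k < n"
  shows "code n (d(k := x)) + d k * 4 ^ k = code n d + x * 4 ^ k"
proof -
  have "code n (d(k := x)) = x * 4 ^ k + (\<Sum>l\<in>{..<n} - {k}. (d(k := x)) l * 4 ^ l)"
    unfolding code_def using k by (subst sum.remove[of _ k]) auto
  also have "(\<Sum>l\<in>{..<n} - {k}. (d(k := x)) l * 4 ^ l) = (\<Sum>l\<in>{..<n} - {k}. d l * 4 ^ l)"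
    by (intro sum.cong) auto
  finally show ?thesis
    unfolding code_def using k by (subst sum.remove[of "{..<n}" k "\<lambda>l. d l * 4 ^ l"]) auto
qed

lemma sum_upd:
  fixes d :: word
  assumes k: "k < n"
  shows "(\<Sum>l<n. (d(k := x)) l) + d k = (\<Sum>l<n. d l) + x"
proof -
  have "(\<Sum>l<n. (d(k := x)) l) = x + (\<Sum>l\<in>{..<n} - {k}. (d(k := x)) l)"
    using k by (subst sum.remove[of _ k]) auto
  also have "(\<Sum>l\<in>{..<n} - {k}. (d(k := x)) l) = (\<Sum>l\<in>{..<n} - {k}. d l)"
    by (intro sum.cong) auto
  finally show ?thesis
    using k by (subst sum.remove[of "{..<n}" k d]) auto
qed

text \<open>The values 4 and 2 are compensated by the relabelled partner, whose letter drops or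
  rises by 1, so that \<open>next_word_sum\<close> obtains 3 in all cases.\<close>

lemma sum_joined:
  assumes "i < j" "j < n" "d i \<le> 2" "d j \<le> 2"
  shows "(\<Sum>l<n. joined d i j l) =
    (\<Sum>l<n. d l) + (if d i = 1 \<and> d j = 1 then 4 else if d i = 2 \<and> d j = 2 then 2 else 3)"
proof -
  define a where "a = (if d i = 0 then (if d j = 0 then 1 else d j) else 3)"
  define b where "b = (if d j = 0 then (if d i = 0 then 2 else d i) else 3)"
  have "(\<Sum>l<n. (d(i := a, j := b)) l) + (d(i := a)) j = (\<Sum>l<n. (d(i := a)) l) + b"
    using assms by (intro sum_upd) simp
  moreover have "(\<Sum>l<n. (d(i := a)) l) + d i = (\<Sum>l<n. d l) + a"
    using assms by (intro sum_upd) simp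
  ultimately have "(\<Sum>l<n. joined d i j l) + d i + d j = (\<Sum>l<n. d l) + a + b"
    using assms(1) unfolding joined_def a_def[symmetric] b_def[symmetric] by simp
  moreover have "d i = 0 \<or> d i = 1 \<or> d i = 2" "d j = 0 \<or> d j = 1 \<or> d j = 2"
    using assms by linarith+
  then have "a + b = d i + d j + (if d i = 1 \<and> d j = 1 then 4 else if d i = 2 \<and> d j = 2 then 2 else 3)"
    by (auto simp: a_def b_def)
  ultimately show ?thesis by linarith
qed

lemma next_word_sum:
  assumes "i < j" "j < n" "d i \<le> 2" "d j \<le> 2" "next_word n d i j = Some d'"
  shows "(\<Sum>l<n. d' l) = (\<Sum>l<n. d l) + 3"
proof -
  consider (open_open) r where "d i = 1" "d j = 1" "scan 1 2 d 0 [Suc j..<n] = Some r" "d' = (joined d i j)(r := 1)"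
    | (close_close) r where "d i = 2" "d j = 2" "scan 2 1 d 0 (rev [0..<i]) = Some r" "d' = (joined d i j)(r := 2)"
    | (other) "\<not> (d i = 1 \<and> d j = 1)" "\<not> (d i = 2 \<and> d j = 2)" "d' = joined d i j"
    using assms(5) by (fastforce simp: next_word_def split: if_splits)
  then show ?thesis
  proof cases
    case open_open
    have r: "j < r" "r < n" "d r = 2" using scan_SomeD[OF open_open(3)] by auto
    then have "joined d i j r = 2" using assms by (simp add: joined_def)
    then show ?thesis
      using sum_upd[of r n "joined d i j" 1] sum_joined[OF assms(1-4)] open_open r by simp
  next
    case close_close
    have r: "r < i" "d r = 1" using scan_SomeD[OF close_close(3)] by auto
    then have "joined d i j r = 1" using assms by (simp add: joined_def)
    then show ?thesis
      using sum_upd[of r n "joined d i j" 2] sum_joined[OF assms(1-4)] close_close r assms by simp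
  next
    case other
    then show ?thesis using sum_joined[OF assms(1-4)] by simp
  qed
qed

lemma is_word_next:
  assumes "is_word n d" "i < j" "j < n" "next_word n d i j = Some d'"
  shows "is_word n d'"
proof -
  have "is_word n (joined d i j)"
    using assms(1-3) by (auto simp: is_word_def joined_def)
  then show ?thesis
    using assms by (auto simp: next_word_def is_word_def dest!: scan_SomeD split: if_splits)
qed

section \<open>Vertices and arcs as numbers\<close>

context ordered_points
begin

text \<open>
  A vertex is a number \<open>c * (n + 1) + m\<close> for a coded word \<open>c\<close> and the left end \<open>m\<close> of the last
  segment; two more vertices are the sink and its successor. The arcs to the sink from the words
  without a letter other than 3 have \<open>i = j = 0\<close>. All the remaining arc numbers describe arcs from
  the successor of the sink to the sink, which lie on no path from the source.
\<close>
definition sink_vertex :: nat where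
  "sink_vertex = 4 ^ n * (n + 1)"

definition transition :: "nat \<Rightarrow> nat \<Rightarrow> nat \<Rightarrow> word option" where
  "transition u i j =
     (if admissible (digit (u div (n + 1))) i j \<and> u mod (n + 1) < j
      then next_word n (digit (u div (n + 1))) i j else None)"

text \<open>\<open>i\<close> and \<open>j\<close> run up to \<open>n\<close>, so that the one
  divisor \<open>n + 1\<close> decodes vertices as well as arcs.\<close>

definition arc_number :: "nat \<Rightarrow> nat \<Rightarrow> nat \<Rightarrow> nat" where
  "arc_number u i j = (u * (n + 1) + i) * (n + 1) + j"

definition arc_tail :: "nat \<Rightarrow> nat \<Rightarrow> nat \<Rightarrow> nat" where
  "arc_tail u i j =
     (if transition u i j \<noteq> None \<or> i = 0 \<and> j = 0 \<and> u div (n + 1) + 1 = 4 ^ n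
      then u else sink_vertex + 1)"

definition arc_head :: "nat \<Rightarrow> nat \<Rightarrow> nat \<Rightarrow> nat" where
  "arc_head u i j =
     (case transition u i j of Some d \<Rightarrow> code n d * (n + 1) + i | None \<Rightarrow> sink_vertex)"

lemma arcs_eq: "4 ^ n * (n + 1) ^ 3 = sink_vertex * (n + 1) * (n + 1)"
  by (simp only: sink_vertex_def power3_eq_cube mult.assoc)

lemma arc_number_less:
  assumes "u < sink_vertex" "i \<le> n" "j \<le> n"
  shows "arc_number u i j < 4 ^ n * (n + 1) ^ 3"
proof -
  have less: "a * (n + 1) + b < c * (n + 1)" if "a < c" "b \<le> n" for a b c
  proof -
    have "a * (n + 1) + b < (a + 1) * (n + 1)" using that(2) by simp
    also have "\<dots> \<le> c * (n + 1)" using that(1) by (intro mult_le_mono1) simp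
    finally show ?thesis .
  qed
  show ?thesis
    using less[OF less[OF assms(1,2)] assms(3)]
    by (simp only: arc_number_def arcs_eq)
qed

lemma arc_number_cases:
  assumes "e < 4 ^ n * (n + 1) ^ 3"
  obtains u i j where "e = arc_number u i j" "u < sink_vertex" "i \<le> n" "j \<le> n"
proof
  show "e = arc_number (e div (n + 1) div (n + 1)) (e div (n + 1) mod (n + 1)) (e mod (n + 1))"
    by (simp only: arc_number_def div_mult_mod_eq)
  show "e div (n + 1) div (n + 1) < sink_vertex"
    using assms by (intro less_mult_imp_div_less) (simp only: arcs_eq)
  show "e div (n + 1) mod (n + 1) \<le> n" "e mod (n + 1) \<le> n"
    using mod_less_divisor[of "n + 1"] by (simp_all add: less_Suc_eq_le)
qed

lemma arc_number_decode:
  assumes "i \<le> n" "j \<le> n"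
  shows "arc_number u i j div (n + 1) div (n + 1) = u"
    and "arc_number u i j div (n + 1) mod (n + 1) = i" and "arc_number u i j mod (n + 1) = j"
proof -
  have "(a * (n + 1) + b) div (n + 1) = a" "(a * (n + 1) + b) mod (n + 1) = b" if "b \<le> n" for a b
    using div_mod_block[of b "n + 1" a] that by simp_all
  then show "arc_number u i j div (n + 1) div (n + 1) = u"
    and "arc_number u i j div (n + 1) mod (n + 1) = i" and "arc_number u i j mod (n + 1) = j"
    using assms by (simp_all only: arc_number_def)
qed

lemma transition_SomeD:
  assumes "transition u i j = Some d" "u < sink_vertex"
  shows "i < j" "j < n" "is_word n d" "code n d * (n + 1) + i < sink_vertex"
    and "(\<Sum>k<n. d k) = (\<Sum>k<n. digit (u div (n + 1)) k) + 3"
proof -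
  let ?d = "digit (u div (n + 1))"
  have adm: "admissible ?d i j" and nx: "next_word n ?d i j = Some d"
    using assms(1) by (auto simp: transition_def split: if_splits)
  show ij: "i < j" "j < n" using adm by (auto simp: admissible_def)
  have c: "u div (n + 1) < 4 ^ n" using assms(2) by (intro less_mult_imp_div_less) (simp add: sink_vertex_def)
  then show w: "is_word n d" using is_word_next[OF is_word_digit ij nx] by simp
  then have "code n d < 4 ^ n" by (intro code_less) (simp add: is_word_def)
  then have "(code n d + 1) * (n + 1) \<le> sink_vertex"
    unfolding sink_vertex_def by (intro mult_le_mono1) simp
  moreover have "code n d * (n + 1) + i < (code n d + 1) * (n + 1)" using ij by simp
  ultimately show "code n d * (n + 1) + i < sink_vertex" by linarith
  have "?d i < 4" "?d j < 4" by (simp_all add: digit_def)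
  moreover have "?d i \<noteq> 3" "?d j \<noteq> 3" using adm by (simp_all add: admissible_def)
  ultimately have "?d i \<le> 2" "?d j \<le> 2" by linarith+
  then show "(\<Sum>k<n. d k) = (\<Sum>k<n. ?d k) + 3" by (rule next_word_sum[OF ij _ _ nx])
qed

lemma vertex_code_less: "u < sink_vertex \<Longrightarrow> u div (n + 1) < 4 ^ n"
  by (intro less_mult_imp_div_less) (simp add: sink_vertex_def)

lemma arc_head_decode:
  assumes "transition u i j = Some d" "u < sink_vertex"
  shows "arc_head u i j div (n + 1) = code n d" "arc_head u i j mod (n + 1) = i"
    and "digit (arc_head u i j div (n + 1)) = d"
proof -
  note tr = transition_SomeD[OF assms]
  have "arc_head u i j = code n d * (n + 1) + i" using assms by (simp add: arc_head_def)
  then show 1: "arc_head u i j div (n + 1) = code n d" and "arc_head u i j mod (n + 1) = i"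
    using div_mod_block[of i "n + 1" "code n d"] tr(1,2) by simp_all
  show "digit (arc_head u i j div (n + 1)) = d"
    unfolding 1 by (rule digit_code_word[OF tr(3)])
qed

text \<open>The number \<open>4 ^ n - 1\<close> has all its digits 3 in base 4, so completion is
  tested by one comparison instead of a loop.\<close>

lemma code_all_3: "is_word n d \<Longrightarrow> code n d + 1 = 4 ^ n \<longleftrightarrow> (\<forall>k<n. d k = 3)"
proof -
  assume w: "is_word n d"
  have 3: "code m (\<lambda>k. 3) + 1 = 4 ^ m" for m by (induction m) (auto simp: code_def)
  have "code n (\<lambda>k. if k < n then 3 else 0) = code n (\<lambda>k. 3)" by (auto simp: code_def)
  then have c: "code n (\<lambda>k. if k < n then 3 else 0) + 1 = 4 ^ n" using 3 by simp
  show ?thesis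
  proof
    assume "code n d + 1 = 4 ^ n"
    then have "code n d = code n (\<lambda>k. if k < n then 3 else 0)" using c by simp
    then have "digit (code n d) = digit (code n (\<lambda>k. if k < n then 3 else 0))" by simp
    then have "d = (\<lambda>k. if k < n then 3 else 0)"
      using w digit_code_word[OF w] digit_code_word[of n "\<lambda>k. if k < n then 3 else 0"]
      by (simp add: is_word_def)
    then show "\<forall>k<n. d k = 3" by simp
  next
    assume "\<forall>k<n. d k = 3"
    then have "code n d = code n (\<lambda>k. 3)" by (simp add: code_def)
    then show "code n d + 1 = 4 ^ n" using 3 by simp
  qed
qed

text \<open>The triple \<open>u\<close>, 0, 0 is the unlabelled final arc. It cannot be confused
  with a transition, as transitions have \<open>i < j\<close>.\<close>

primrec walk :: "nat \<Rightarrow> edge list \<Rightarrow> nat list" where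
  "walk u [] = [arc_number u 0 0]"
| "walk u (s # es) = arc_number u (fst s) (snd s) # walk (arc_head u (fst s) (snd s)) es"

text \<open>The interface between the graph and the program. It leaves \<open>tail\<close>,
  \<open>head\<close> and \<open>label\<close> free outside the arc numbers, where the output arrays
  describe nothing.\<close>

definition represents_transitions :: "(nat, nat) comb_graph \<Rightarrow> bool" where
  "represents_transitions \<Gamma> \<longleftrightarrow>
     verts (multigraph \<Gamma>) = {..<sink_vertex + 2} \<and> arcs (multigraph \<Gamma>) = {..<4 ^ n * (n + 1) ^ 3} \<and>
     source \<Gamma> = 0 \<and> sink \<Gamma> = sink_vertex \<and>
     (\<forall>u<sink_vertex. \<forall>i\<le>n. \<forall>j\<le>n.
        tail (multigraph \<Gamma>) (arc_number u i j) = arc_tail u i j \<and>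
        head (multigraph \<Gamma>) (arc_number u i j) = arc_head u i j \<and>
        label \<Gamma> (arc_number u i j) = (if transition u i j = None then None else Some (seg (i, j))))"

lemma arc_head_less: "u < sink_vertex \<Longrightarrow> transition u i j = Some d \<Longrightarrow> arc_head u i j < sink_vertex"
  using transition_SomeD(4) by (simp add: arc_head_def)

section \<open>Paths to the sink and accepted sequences\<close>

context
  fixes \<Gamma> :: "(nat, nat) comb_graph"
  assumes \<Gamma>: "represents_transitions \<Gamma>"
begin

lemma graph_facts:
  "verts (multigraph \<Gamma>) = {..<sink_vertex + 2}" "arcs (multigraph \<Gamma>) = {..<4 ^ n * (n + 1) ^ 3}"
  "source \<Gamma> = 0" "sink \<Gamma> = sink_vertex"
  using \<Gamma> by (auto simp: represents_transitions_def)

lemma arc_facts: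
  assumes "u < sink_vertex" "i \<le> n" "j \<le> n"
  shows "tail (multigraph \<Gamma>) (arc_number u i j) = arc_tail u i j"
    and "head (multigraph \<Gamma>) (arc_number u i j) = arc_head u i j"
    and "label \<Gamma> (arc_number u i j) = (if transition u i j = None then None else Some (seg (i, j)))"
  using \<Gamma> assms by (auto simp: represents_transitions_def)

lemma arc_of_graph:
  assumes "e \<in> arcs (multigraph \<Gamma>)"
  obtains u i j where "e = arc_number u i j" "u < sink_vertex" "i \<le> n" "j \<le> n"
  using assms arc_number_cases[of e] by (auto simp: graph_facts)

text \<open>Every tail is below the sink or is the successor of the sink, so a walk stops as soon as
  it reaches the sink.\<close>

lemma cas_from_sink:
  assumes "set p \<subseteq> arcs (multigraph \<Gamma>)" "pre_digraph.cas (multigraph \<Gamma>) sink_vertex p w"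
  shows "p = []"
proof (cases p)
  case (Cons e es)
  obtain u i j where e: "e = arc_number u i j" "u < sink_vertex" "i \<le> n" "j \<le> n"
    using arc_of_graph[of e] assms(1) Cons by auto
  have "arc_tail u i j = sink_vertex"
    using assms(2) arc_facts(1)[OF e(2-4)] by (simp add: Cons e(1) pre_digraph.cas.simps)
  then show ?thesis using e(2) by (simp add: arc_tail_def split: if_splits)
qed

text \<open>Padding arcs start in the successor of the sink, so they never leave \<open>u\<close>.
  Any other arc is either a transition of the automaton or the final arc of a completed
  word.\<close>

lemma walk_iff:
  assumes "u < sink_vertex"
  shows "set p \<subseteq> arcs (multigraph \<Gamma>) \<and> pre_digraph.cas (multigraph \<Gamma>) u p sink_vertex \<longleftrightarrow>
    (\<exists>es. accepts (digit (u div (n + 1))) (u mod (n + 1)) es \<and> p = walk u es)"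
proof
  assume "set p \<subseteq> arcs (multigraph \<Gamma>) \<and> pre_digraph.cas (multigraph \<Gamma>) u p sink_vertex"
  with assms show "\<exists>es. accepts (digit (u div (n + 1))) (u mod (n + 1)) es \<and> p = walk u es"
  proof (induction p arbitrary: u)
    case Nil
    then show ?case by (simp add: pre_digraph.cas.simps)
  next
    case (Cons e p)
    obtain u' i j where e: "e = arc_number u' i j" "u' < sink_vertex" "i \<le> n" "j \<le> n"
      using arc_of_graph[of e] Cons.prems(2) by auto
    have t: "arc_tail u' i j = u" and p: "pre_digraph.cas (multigraph \<Gamma>) (arc_head u' i j) p sink_vertex"
      using Cons.prems(2) arc_facts(1,2)[OF e(2-4)] by (auto simp: e(1) pre_digraph.cas.simps)
    have u: "u' = u" using t Cons.prems(1) by (auto simp: arc_tail_def split: if_splits)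
    note c = vertex_code_less[OF Cons.prems(1)]
    show ?case
    proof (cases "transition u i j")
      case None
      then have ij: "i = 0" "j = 0" "u div (n + 1) + 1 = 4 ^ n"
        using t Cons.prems(1) by (auto simp: arc_tail_def u split: if_splits)
      have "p = []" using p Cons.prems(2) None cas_from_sink[of p] by (auto simp: u arc_head_def)
      moreover have "accepts (digit (u div (n + 1))) (u mod (n + 1)) []"
        using code_all_3[OF is_word_digit[OF c]] code_digit[OF c] ij(3) by simp
      ultimately show ?thesis using e(1) ij u by (intro exI[of _ "[]"]) simp
    next
      case (Some d)
      obtain es where es: "accepts d i es" "p = walk (arc_head u i j) es"
        using Cons.IH[OF arc_head_less[OF Cons.prems(1) Some]] p Cons.prems(2) u
        unfolding arc_head_decode(2,3)[OF Some Cons.prems(1)] by auto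
      have "accepts (digit (u div (n + 1))) (u mod (n + 1)) ((i, j) # es)"
        using Some es(1) by (auto simp: transition_def split: if_splits)
      then show ?thesis using es(2) e(1) u by (intro exI[of _ "(i, j) # es"]) simp
    qed
  qed
next
  assume "\<exists>es. accepts (digit (u div (n + 1))) (u mod (n + 1)) es \<and> p = walk u es"
  then obtain es where "accepts (digit (u div (n + 1))) (u mod (n + 1)) es" "p = walk u es" by blast
  with assms show "set p \<subseteq> arcs (multigraph \<Gamma>) \<and> pre_digraph.cas (multigraph \<Gamma>) u p sink_vertex"
  proof (induction es arbitrary: u p)
    case Nil
    note c = vertex_code_less[OF Nil.prems(1)]
    have "u div (n + 1) + 1 = 4 ^ n"
      using code_all_3[OF is_word_digit[OF c]] code_digit[OF c] Nil.prems(2) by simp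
    moreover have "transition u 0 0 = None" by (simp add: transition_def)
    ultimately have "arc_tail u 0 0 = u" "arc_head u 0 0 = sink_vertex"
      by (simp_all add: arc_tail_def arc_head_def)
    then show ?case
      using Nil.prems arc_facts(1,2)[OF Nil.prems(1)] arc_number_less[OF Nil.prems(1)]
      by (simp add: pre_digraph.cas.simps graph_facts)
  next
    case (Cons s es)
    obtain i j where s: "s = (i, j)" by (cases s)
    obtain d where d: "transition u i j = Some d" "accepts d i es"
      using Cons.prems(2) by (auto simp: s transition_def)
    note tr = transition_SomeD[OF d(1) Cons.prems(1)]
    have ijn: "i \<le> n" "j \<le> n" using tr by simp_all
    have "accepts (digit (arc_head u i j div (n + 1))) (arc_head u i j mod (n + 1)) es"
      unfolding arc_head_decode(2,3)[OF d(1) Cons.prems(1)] by (rule d(2))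
    then have IH: "set (walk (arc_head u i j) es) \<subseteq> arcs (multigraph \<Gamma>)"
      "pre_digraph.cas (multigraph \<Gamma>) (arc_head u i j) (walk (arc_head u i j) es) sink_vertex"
      using Cons.IH[OF arc_head_less[OF Cons.prems(1) d(1)]] by blast+
    have "arc_tail u i j = u" using d(1) by (simp add: arc_tail_def)
    then show ?case
      using Cons.prems(3) IH arc_facts(1,2)[OF Cons.prems(1) ijn] arc_number_less[OF Cons.prems(1) ijn]
      by (simp add: s pre_digraph.cas.simps graph_facts)
  qed
qed

lemma path_combination_walk:
  assumes "u < sink_vertex" "accepts (digit (u div (n + 1))) (u mod (n + 1)) es"
  shows "path_combination \<Gamma> (walk u es) = seg ` set es"
  using assms
proof (induction es arbitrary: u)
  case Nil
  have "transition u 0 0 = None" by (simp add: transition_def)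
  then show ?case using arc_facts(3)[OF Nil.prems(1), of 0 0] by (simp add: path_combination_def)
next
  case (Cons s es)
  obtain i j where s: "s = (i, j)" by (cases s)
  obtain d where d: "transition u i j = Some d" "accepts d i es"
    using Cons.prems(2) by (auto simp: s transition_def)
  note tr = transition_SomeD[OF d(1) Cons.prems(1)]
  have ijn: "i \<le> n" "j \<le> n" using tr by simp_all
  have "accepts (digit (arc_head u i j div (n + 1))) (arc_head u i j mod (n + 1)) es"
    unfolding arc_head_decode(2,3)[OF d(1) Cons.prems(1)] by (rule d(2))
  then have "path_combination \<Gamma> (walk (arc_head u i j) es) = seg ` set es"
    by (rule Cons.IH[OF arc_head_less[OF Cons.prems(1) d(1)]])
  moreover have "path_combination \<Gamma> (walk u (s # es)) =
      insert (seg s) (path_combination \<Gamma> (walk (arc_head u i j) es))"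
    using arc_facts(3)[OF Cons.prems(1) ijn] d(1) by (auto simp: path_combination_def s)
  ultimately show ?case by simp
qed

lemma sink_vertex_pos: "0 < sink_vertex"
  by (simp add: sink_vertex_def)

lemma source_sink_paths_eq:
  "source_sink_paths \<Gamma> = walk 0 ` {es. spanning_cycle (set es) \<and> bottom_up es \<and> advancing 0 es}"
proof -
  have 0: "digit (0 div (n + 1)) = (\<lambda>k. 0)" by (auto simp: digit_def)
  have "source_sink_paths \<Gamma> =
      {p. set p \<subseteq> arcs (multigraph \<Gamma>) \<and> pre_digraph.cas (multigraph \<Gamma>) 0 p sink_vertex}"
    by (auto simp: source_sink_paths_def pre_digraph.awalk_def graph_facts)
  also have "\<dots> = {p. \<exists>es. accepts (\<lambda>k. 0) 0 es \<and> p = walk 0 es}"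
    using walk_iff[OF sink_vertex_pos] unfolding 0 by simp
  finally show ?thesis using accepts_iff by auto
qed

text \<open>Paths correspond to accepted sequences, these to cycles of index pairs by existence and
  uniqueness of the canonical order, and index pairs to segments.\<close>

lemma represents_cycles: "represents \<Gamma> (crossing_free_spanning_cycles (v ` {..<n}))"
proof -
  let ?E = "{es. spanning_cycle (set es) \<and> bottom_up es \<and> advancing 0 es}"
  have 0: "digit (0 div (n + 1)) = (\<lambda>k. 0)" by (auto simp: digit_def)
  have pc: "path_combination \<Gamma> (walk 0 es) = seg ` set es" if "es \<in> ?E" for es
    using path_combination_walk[OF sink_vertex_pos, of es] that accepts_iff[of es] unfolding 0 by simp
  have sub: "set es \<subseteq> index_pairs n" if "es \<in> ?E" for es
    using that by (simp add: spanning_cycle_def planar_def)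
  show ?thesis
    unfolding represents_def
  proof (rule bij_betw_imageI)
    show "inj_on (path_combination \<Gamma>) (source_sink_paths \<Gamma>)"
      unfolding source_sink_paths_eq
    proof (rule inj_onI)
      fix p q assume pq: "p \<in> walk 0 ` ?E" "q \<in> walk 0 ` ?E" "path_combination \<Gamma> p = path_combination \<Gamma> q"
      then obtain es fs where es: "es \<in> ?E" "p = walk 0 es" and fs: "fs \<in> ?E" "q = walk 0 fs" by blast
      have "seg ` set es = seg ` set fs" using pq(3) pc es fs by simp
      then have eq: "set fs = set es" using inj_on_image_eq_iff[OF inj_on_seg sub[OF es(1)] sub[OF fs(1)]] by simp
      have "spanning_cycle (set es)" "bottom_up es" "advancing 0 es" "bottom_up fs" "advancing 0 fs"
        using es(1) fs(1) by blast+
      moreover from this(1) have "planar (set es)" by (simp add: spanning_cycle_def)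
      ultimately have "es = fs" using canonical_unique[OF _ eq] by blast
      then show "p = q" by (simp add: es(2) fs(2))
    qed
    have "set ` ?E = {C. spanning_cycle C}"
    proof (intro set_eqI iffI)
      fix C assume "C \<in> {C. spanning_cycle C}"
      then have "spanning_cycle C" "planar C" by (simp_all add: spanning_cycle_def)
      moreover from this obtain es where "set es = C" "bottom_up es" "advancing 0 es"
        using canonical_exists by blast
      ultimately show "C \<in> set ` ?E" by blast
    qed auto
    moreover have "path_combination \<Gamma> ` walk 0 ` ?E = (`) seg ` set ` ?E"
      unfolding image_image by (rule image_cong[OF refl pc])
    ultimately show "path_combination \<Gamma> ` source_sink_paths \<Gamma> = crossing_free_spanning_cycles (v ` {..<n})"
      by (simp add: source_sink_paths_eq crossing_free_spanning_cycles_eq)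
  qed
qed

lemma arc_tail_less: "u < sink_vertex \<Longrightarrow> arc_tail u i j < sink_vertex + 2"
  by (simp add: arc_tail_def)

text \<open>\<open>4 * n + 1\<close> exceeds every sum of letters, and the value 0 at the successor
  of the sink makes the padding arcs ascend too.\<close>

definition potential :: "nat \<Rightarrow> nat" where
  "potential u = (if u < sink_vertex then \<Sum>k<n. digit (u div (n + 1)) k
                  else if u = sink_vertex then 4 * n + 1 else 0)"

lemma potential_increases:
  assumes "u < sink_vertex" "i \<le> n" "j \<le> n"
  shows "potential (arc_tail u i j) < potential (arc_head u i j)"
proof (cases "transition u i j")
  case None
  have "(\<Sum>k<n. digit c k) \<le> (\<Sum>k<n. 4)" for c
    by (intro sum_mono) (simp add: digit_def less_imp_le)
  then have "(\<Sum>k<n. digit c k) < 4 * n + 1" for c by (simp add: less_Suc_eq_le mult.commute)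
  then show ?thesis using None assms(1) by (auto simp: arc_head_def arc_tail_def potential_def)
next
  case (Some d)
  note tr = transition_SomeD[OF Some assms(1)]
  have "potential (arc_head u i j) = (\<Sum>k<n. d k)"
    using arc_head_less[OF assms(1) Some] arc_head_decode(3)[OF Some assms(1)] by (simp add: potential_def)
  moreover have "potential (arc_tail u i j) = (\<Sum>k<n. digit (u div (n + 1)) k)"
    using Some assms(1) by (simp add: arc_tail_def potential_def)
  ultimately show ?thesis using tr(5) by simp
qed

lemma combination_graph_transitions: "combination_graph (v ` {..<n}) \<Gamma>"
proof -
  let ?G = "multigraph \<Gamma>"
  have wf: "fin_digraph ?G"
  proof
    fix e assume "e \<in> arcs ?G"
    then obtain u i j where e: "e = arc_number u i j" "u < sink_vertex" "i \<le> n" "j \<le> n"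
      by (rule arc_of_graph)
    show "tail ?G e \<in> verts ?G" using arc_facts[OF e(2-4)] arc_tail_less[OF e(2)] by (simp add: e graph_facts)
    have "arc_head u i j \<le> sink_vertex"
      using arc_head_less[OF e(2), of i j] by (cases "transition u i j") (auto simp: arc_head_def)
    then show "head ?G e \<in> verts ?G" using arc_facts[OF e(2-4)] by (simp add: e graph_facts)
  qed (simp_all add: graph_facts)
  have "arcs_ends ?G \<subseteq> Wellfounded.measure potential"
  proof
    fix x assume "x \<in> arcs_ends ?G"
    then obtain e where e': "e \<in> arcs ?G" "x = (tail ?G e, head ?G e)" by (auto simp: arcs_ends_conv)
    then obtain u i j where e: "e = arc_number u i j" "u < sink_vertex" "i \<le> n" "j \<le> n"
      using arc_of_graph by metis
    show "x \<in> Wellfounded.measure potential"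
      using potential_increases[OF e(2-4)] arc_facts[OF e(2-4)] by (simp add: e'(2) e(1))
  qed
  then have ac: "acyclic (arcs_ends ?G)"
    by (rule acyclic_subset[OF wf_acyclic[OF wf_measure]])
  have out: "out_arcs ?G (sink \<Gamma>) = {}"
  proof (rule ccontr)
    assume "out_arcs ?G (sink \<Gamma>) \<noteq> {}"
    then obtain e where e': "e \<in> arcs ?G" "tail ?G e = sink_vertex" by (auto simp: out_arcs_def graph_facts)
    then have "[e] = []"
      by (intro cas_from_sink[where w = "head ?G e"]) (simp_all add: pre_digraph.cas.simps)
    then show False by simp
  qed
  have lab: "if head ?G e = sink \<Gamma> then label \<Gamma> e = None else \<exists>s\<in>segments (v ` {..<n}). label \<Gamma> e = Some s"
    if a: "e \<in> arcs ?G" for e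
  proof -
    obtain u i j where e: "e = arc_number u i j" "u < sink_vertex" "i \<le> n" "j \<le> n"
      using arc_of_graph[OF a] by metis
    show ?thesis
    proof (cases "transition u i j")
      case None
      then show ?thesis using arc_facts[OF e(2-4)] by (simp add: e(1) arc_head_def graph_facts)
    next
      case (Some d)
      then have "(i, j) \<in> index_pairs n" using transition_SomeD[OF Some e(2)] by (simp add: index_pairs_def)
      then show ?thesis
        using arc_facts[OF e(2-4)] Some arc_head_less[OF e(2) Some]
        by (simp add: e(1) graph_facts segments_eq)
    qed
  qed
  show ?thesis
    unfolding combination_graph_def Let_def
    using wf ac out lab sink_vertex_pos by (simp add: graph_facts)
qed

lemma graph_size_transitions: "graph_size \<Gamma> = 4 ^ n * (n + 1) + 2 + 4 ^ n * (n + 1) ^ 3"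
  by (simp add: graph_size_def graph_facts sink_vertex_def)

end

end

section \<open>Reasoning about programs\<close>

lemma words_set_word [simp]:
  "words (set_word a i x \<sigma>) b = (if b = a then (words \<sigma> a)(i := x) else words \<sigma> b)"
  by (simp add: set_word_def)

lemma reals_set_word [simp]: "reals (set_word a i x \<sigma>) = reals \<sigma>"
  by (simp add: set_word_def)

text \<open>Asserts that a halting execution exists. This excludes word overflow as well, because an
  overflowing step has no execution.\<close>

definition runs :: "nat \<Rightarrow> com \<Rightarrow> state \<Rightarrow> nat \<Rightarrow> (state \<Rightarrow> bool) \<Rightarrow> bool" where
  "runs w c \<sigma> K Q \<longleftrightarrow> (\<exists>k \<tau>. exec w c \<sigma> k \<tau> \<and> k \<le> K \<and> Q \<tau>)"

lemma runs_mono: "runs w c \<sigma> K Q \<Longrightarrow> K \<le> K' \<Longrightarrow> (\<And>\<tau>. Q \<tau> \<Longrightarrow> Q' \<tau>) \<Longrightarrow> runs w c \<sigma> K' Q'"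
  unfolding runs_def by (meson le_trans)

lemma runs_Seq:
  assumes "runs w c \<sigma> K Q" "\<And>\<tau>. Q \<tau> \<Longrightarrow> runs w d \<tau> L R"
  shows "runs w (Seq c d) \<sigma> (K + L) R"
proof -
  obtain k \<sigma>' where 1: "exec w c \<sigma> k \<sigma>'" "k \<le> K" "Q \<sigma>'" using assms(1) by (auto simp: runs_def)
  obtain l \<tau> where 2: "exec w d \<sigma>' l \<tau>" "l \<le> L" "R \<tau>" using assms(2)[OF 1(3)] by (auto simp: runs_def)
  show ?thesis
    unfolding runs_def using exec.Seq[OF 1(1) 2(1)] 1(2) 2(2,3) by (intro exI conjI) auto
qed

text \<open>\<open>T\<close> rounds, each with its guard, and the final evaluation of the
  guard.\<close>

definition while_cost :: "nat \<Rightarrow> bexp \<Rightarrow> nat \<Rightarrow> nat" where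
  "while_cost T b K = T * (bcost b + K + 1) + bcost b + 1"

lemma while_cost_mono: "S \<le> T \<Longrightarrow> while_cost S b K \<le> while_cost T b K"
  unfolding while_cost_def by (intro add_right_mono mult_le_mono1)

text \<open>The number \<open>T\<close> of rounds is known in advance. The invariant is indexed by
  the round, and the induction shifts that index.\<close>

lemma runs_While:
  assumes "I 0 \<sigma>" "\<And>t \<tau>. t < T \<Longrightarrow> I t \<tau> \<Longrightarrow> bval b \<tau> \<and> runs w c \<tau> K (I (Suc t))"
    "\<And>\<tau>. I T \<tau> \<Longrightarrow> \<not> bval b \<tau>"
  shows "runs w (While b c) \<sigma> (while_cost T b K) (I T)"
  unfolding while_cost_def using assms
proof (induction T arbitrary: I \<sigma>)
  case 0
  then have "exec w (While b c) \<sigma> (bcost b + 1) \<sigma>" by (intro exec.WhileFalse) auto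
  then show ?case using 0 unfolding runs_def by (intro exI conjI) auto
next
  case (Suc T)
  have "bval b \<sigma>" "runs w c \<sigma> K (I (Suc 0))" using Suc.prems(1) Suc.prems(2)[of 0] by auto
  then obtain k \<sigma>' where 1: "exec w c \<sigma> k \<sigma>'" "k \<le> K" "I (Suc 0) \<sigma>'" by (auto simp: runs_def)
  have "runs w (While b c) \<sigma>' (T * (bcost b + K + 1) + bcost b + 1) (I (Suc T))"
    using Suc.prems(2,3) 1(3) by (intro Suc.IH[where I = "\<lambda>t. I (Suc t)"]) auto
  then obtain l \<tau> where 2: "exec w (While b c) \<sigma>' l \<tau>" "l \<le> T * (bcost b + K + 1) + bcost b + 1" "I (Suc T) \<tau>"
    by (auto simp: runs_def)
  show ?case
    unfolding runs_def using exec.WhileTrue[OF \<open>bval b \<sigma>\<close> 1(1) 2(1)] 1(2) 2(2,3)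
    by (intro exI conjI) auto
qed

text \<open>Meant for loop-free code: loops get \<open>False\<close> and are left to
  \<open>runs_While\<close>. This is what allows \<open>cost_bound\<close> to give them the value
  0.\<close>

primrec wp :: "nat \<Rightarrow> com \<Rightarrow> (state \<Rightarrow> bool) \<Rightarrow> state \<Rightarrow> bool" where
  "wp w Skip Q \<sigma> = Q \<sigma>"
| "wp w (IAssign a i x) Q \<sigma> =
     (ival i \<sigma> < 2 ^ w \<and> ival x \<sigma> < 2 ^ w \<and> Q (set_word a (ival i \<sigma>) (ival x \<sigma>) \<sigma>))"
| "wp w (RAssign a i y) Q \<sigma> = (ival i \<sigma> < 2 ^ w \<and> Q (set_real a (ival i \<sigma>) (rval y \<sigma>) \<sigma>))"
| "wp w (Seq c d) Q \<sigma> = wp w c (wp w d Q) \<sigma>"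
| "wp w (Cond b c d) Q \<sigma> = ((bval b \<sigma> \<longrightarrow> wp w c Q \<sigma>) \<and> (\<not> bval b \<sigma> \<longrightarrow> wp w d Q \<sigma>))"
| "wp w (While b c) Q \<sigma> = False"

text \<open>Adding both branches of a conditional gives a bound that depends on the program text
  alone.\<close>

primrec cost_bound :: "com \<Rightarrow> nat" where
  "cost_bound Skip = 1"
| "cost_bound (IAssign a i x) = icost i + icost x + 1"
| "cost_bound (RAssign a i y) = icost i + rcost y + 1"
| "cost_bound (Seq c d) = cost_bound c + cost_bound d"
| "cost_bound (Cond b c d) = bcost b + (cost_bound c + cost_bound d) + 1"
| "cost_bound (While b c) = 0"

lemma runs_wp: "wp w c Q \<sigma> \<Longrightarrow> runs w c \<sigma> (cost_bound c) Q"
proof (induction c arbitrary: Q \<sigma>)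
  case (Seq c d)
  then show ?case using runs_Seq[OF Seq.IH(1) Seq.IH(2)] by simp
next
  case (Cond b c d)
  show ?case
  proof (cases "bval b \<sigma>")
    case True
    then have "runs w c \<sigma> (cost_bound c) Q" using Cond by simp
    then obtain k \<tau> where k: "exec w c \<sigma> k \<tau>" "k \<le> cost_bound c" "Q \<tau>" by (auto simp: runs_def)
    then show ?thesis
      unfolding runs_def using exec.CondTrue[OF True k(1)] by (intro exI conjI) auto
  next
    case False
    then have "runs w d \<sigma> (cost_bound d) Q" using Cond by simp
    then obtain k \<tau> where k: "exec w d \<sigma> k \<tau>" "k \<le> cost_bound d" "Q \<tau>" by (auto simp: runs_def)
    then show ?thesis
      unfolding runs_def using exec.CondFalse[OF False k(1)] by (intro exI conjI) auto
  qed
next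
  case Skip
  then show ?case unfolding runs_def using exec.Skip[of w \<sigma>] by auto
next
  case (IAssign a i x)
  then show ?case unfolding runs_def using exec.IAssign[of i \<sigma> w x a] by auto
next
  case (RAssign a i y)
  then show ?case unfolding runs_def using exec.RAssign[of i \<sigma> w a y] by auto
qed simp

abbreviation var :: "string \<Rightarrow> iexp" where "var a \<equiv> IElem a (IConst 0)"
abbreviation var_less :: "string \<Rightarrow> string \<Rightarrow> bexp" where "var_less a b \<equiv> ILess (var a) (var b)"
abbreviation assign :: "string \<Rightarrow> iexp \<Rightarrow> com" where "assign a x \<equiv> IAssign a (IConst 0) x"
abbreviation equal :: "iexp \<Rightarrow> iexp \<Rightarrow> bexp" where
  "equal x y \<equiv> BAnd (BNot (ILess x y)) (BNot (ILess y x))"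

text \<open>A frame condition for whole arrays. The reals are always kept, since the program only
  reads the coordinates.\<close>

definition agree :: "string set \<Rightarrow> state \<Rightarrow> state \<Rightarrow> bool" where
  "agree A \<sigma> \<tau> \<longleftrightarrow> (\<forall>a. a \<notin> A \<longrightarrow> words \<tau> a = words \<sigma> a) \<and> reals \<tau> = reals \<sigma>"

lemma agree_refl [simp]: "agree A \<sigma> \<sigma>"
  by (simp add: agree_def)

lemma agree_set_word [simp]: "a \<in> A \<Longrightarrow> agree A \<sigma> (set_word a i x \<tau>) \<longleftrightarrow> agree A \<sigma> \<tau>"
  unfolding agree_def by auto

lemma agree_words: "agree A \<sigma> \<tau> \<Longrightarrow> a \<notin> A \<Longrightarrow> words \<tau> a = words \<sigma> a"
  by (simp add: agree_def)

lemma agree_trans: "agree A \<sigma> \<tau> \<Longrightarrow> agree B \<tau> \<rho> \<Longrightarrow> agree (A \<union> B) \<sigma> \<rho>"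
  by (simp add: agree_def)

section \<open>The program\<close>

definition count_body :: com where
  "count_body =
     Seq (Cond (RLess (RElem ''x'' (var ''b'')) (RElem ''x'' (var ''a'')))
           (assign ''r'' (IAdd (var ''r'') (IConst 1))) Skip)
       (assign ''b'' (IAdd (var ''b'') (IConst 1)))"

definition count_init :: com where
  "count_init = Seq (assign ''r'' (IConst 0)) (assign ''b'' (IConst 0))"

definition count_prog :: com where
  "count_prog = Seq count_init (While (var_less ''b'' ''n'') count_body)"

definition store_rank :: com where
  "store_rank = Seq (IAssign ''o'' (var ''r'') (var ''a'')) (assign ''a'' (IAdd (var ''a'') (IConst 1)))"

text \<open>Sorting by counting, for each point, the points to its left; \<open>o\<close> receives
  the inverse of the ranking. The quadratic time is dominated by the loop over the arcs.\<close>

definition rank_prog :: com where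
  "rank_prog = While (var_less ''a'' ''n'') (Seq count_prog store_rank)"

text \<open>The machine has no exponentiation, so the powers of 4 are tabulated once, up to
  \<open>4 ^ n\<close>, which the tests for completion use.\<close>

definition power_body :: com where
  "power_body =
     Seq (IAssign ''w'' (IAdd (var ''k'') (IConst 1)) (IMul (IConst 4) (IElem ''w'' (var ''k''))))
       (assign ''k'' (IAdd (var ''k'') (IConst 1)))"

definition power_init :: com where
  "power_init = IAssign ''w'' (IConst 0) (IConst 1)"

definition power_prog :: com where
  "power_prog = Seq power_init (While (var_less ''k'' ''n'') power_body)"

definition size_prog :: com where
  "size_prog =
     Seq (assign ''N'' (IAdd (var ''n'') (IConst 1)))
    (Seq (assign ''sink'' (IMul (IElem ''w'' (var ''n'')) (var ''N'')))
    (Seq (assign ''verts'' (IAdd (var ''sink'') (IConst 2)))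
         (assign ''arcs'' (IMul (IMul (var ''sink'') (var ''N'')) (var ''N'')))))"

definition digit_exp :: "iexp \<Rightarrow> iexp" where
  "digit_exp k = IMod (IDiv (var ''c'') (IElem ''w'' k)) (IConst 4)"

text \<open>\<open>ok\<close> records the conditions that do not concern the points in between, and
  \<open>k\<close> is placed at the first of these points.\<close>

definition decode_prog :: com where
  "decode_prog =
     Seq (assign ''u'' (IDiv (IDiv (var ''e'') (var ''N'')) (var ''N'')))
    (Seq (assign ''i'' (IMod (IDiv (var ''e'') (var ''N'')) (var ''N'')))
    (Seq (assign ''j'' (IMod (var ''e'') (var ''N'')))
    (Seq (assign ''c'' (IDiv (var ''u'') (var ''N'')))
    (Seq (assign ''di'' (digit_exp (var ''i'')))
    (Seq (assign ''dj'' (digit_exp (var ''j'')))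
    (Seq (Cond (BAnd (var_less ''i'' ''j'') (BAnd (var_less ''j'' ''n'')
            (BAnd (ILess (IMod (var ''u'') (var ''N'')) (var ''j''))
            (BAnd (ILess (var ''di'') (IConst 3)) (ILess (var ''dj'') (IConst 3))))))
           (assign ''ok'' (IConst 1)) (assign ''ok'' (IConst 0)))
         (assign ''k'' (IAdd (var ''i'') (IConst 1)))))))))"

definition coordinate_diff :: "string \<Rightarrow> iexp \<Rightarrow> iexp \<Rightarrow> rexp" where
  "coordinate_diff z k l = RSub (RElem z (IElem ''o'' k)) (RElem z (IElem ''o'' l))"

definition below_exp :: bexp where
  "below_exp =
     RLess (RMul (coordinate_diff ''x'' (var ''j'') (var ''i'')) (coordinate_diff ''y'' (var ''k'') (var ''i'')))
           (RMul (coordinate_diff ''x'' (var ''k'') (var ''i'')) (coordinate_diff ''y'' (var ''j'') (var ''i'')))"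

definition check_body :: com where
  "check_body =
     Seq (Cond below_exp
           (Cond (ILess (digit_exp (var ''k'')) (IConst 3)) (assign ''ok'' (IConst 0)) Skip)
           (Cond (ILess (IConst 0) (digit_exp (var ''k''))) (assign ''ok'' (IConst 0)) Skip))
         (assign ''k'' (IAdd (var ''k'') (IConst 1)))"

definition check_prog :: com where
  "check_prog = While (var_less ''k'' ''j'') check_body"

text \<open>The value \<open>n\<close> of \<open>res\<close> means that no partner has been found.\<close>

definition scan_step :: "string \<Rightarrow> nat \<Rightarrow> nat \<Rightarrow> com" where
  "scan_step res x y =
     Cond (ILess (var res) (var ''n'')) Skip
       (Cond (equal (digit_exp (var ''k'')) (IConst y))
         (Cond (ILess (IConst 0) (var ''h'')) (assign ''h'' (ISub (var ''h'') (IConst 1)))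
           (assign res (var ''k'')))
         (Cond (equal (digit_exp (var ''k'')) (IConst x)) (assign ''h'' (IAdd (var ''h'') (IConst 1))) Skip))"

definition scan_init :: "string \<Rightarrow> iexp \<Rightarrow> com" where
  "scan_init res k = Seq (assign res (var ''n'')) (Seq (assign ''h'' (IConst 0)) (assign ''k'' k))"

definition right_body :: com where
  "right_body = Seq (scan_step ''r'' 1 2) (assign ''k'' (IAdd (var ''k'') (IConst 1)))"

definition right_init :: com where
  "right_init = scan_init ''r'' (IAdd (var ''j'') (IConst 1))"

definition right_prog :: com where
  "right_prog = Seq right_init (While (var_less ''k'' ''n'') right_body)"

text \<open>The decrement comes before the reading, so that \<open>k\<close> is the number of unread
  positions and the loop can stop at 0.\<close>

definition left_body :: com where
  "left_body = Seq (assign ''k'' (ISub (var ''k'') (IConst 1))) (scan_step ''l'' 2 1)"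

definition left_init :: com where
  "left_init = scan_init ''l'' (var ''i'')"

definition left_prog :: com where
  "left_prog = Seq left_init (While (ILess (IConst 0) (var ''k'')) left_body)"

definition letters_prog :: com where
  "letters_prog =
     Cond (equal (var ''di'') (IConst 0))
       (Cond (equal (var ''dj'') (IConst 0))
         (Seq (assign ''a'' (IConst 1)) (assign ''b'' (IConst 2)))
         (Seq (assign ''a'' (var ''dj'')) (assign ''b'' (IConst 3))))
       (Seq (assign ''a'' (IConst 3))
         (Cond (equal (var ''dj'') (IConst 0)) (assign ''b'' (var ''di'')) (assign ''b'' (IConst 3))))"

text \<open>The difference of the two letters may be negative, so the exchange of a digit is written
  as an addition followed by a subtraction.\<close>

definition replace_exp :: "iexp \<Rightarrow> iexp \<Rightarrow> iexp \<Rightarrow> iexp \<Rightarrow> iexp" where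
  "replace_exp g k old new = ISub (IAdd g (IMul new (IElem ''w'' k))) (IMul old (IElem ''w'' k))"

definition join_prog :: com where
  "join_prog =
     Seq (assign ''g'' (replace_exp (var ''c'') (var ''i'') (var ''di'') (var ''a'')))
         (assign ''g'' (replace_exp (var ''g'') (var ''j'') (var ''dj'') (var ''b'')))"

definition relabel_prog :: com where
  "relabel_prog =
     Cond (BAnd (equal (var ''di'') (IConst 1)) (equal (var ''dj'') (IConst 1)))
       (Cond (var_less ''r'' ''n'')
         (assign ''g'' (replace_exp (var ''g'') (var ''r'') (IConst 2) (IConst 1)))
         (assign ''ok'' (IConst 0)))
    (Cond (BAnd (equal (var ''di'') (IConst 2)) (equal (var ''dj'') (IConst 2)))
       (Cond (var_less ''l'' ''n'')
         (assign ''g'' (replace_exp (var ''g'') (var ''l'') (IConst 1) (IConst 2)))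
         (assign ''ok'' (IConst 0)))
    (Cond (BAnd (BAnd (equal (var ''di'') (IConst 1)) (equal (var ''dj'') (IConst 2)))
             (BNot (BAnd (ILess (IConst 2) (var ''n''))
                         (equal (IElem ''w'' (var ''n'')) (IAdd (var ''g'') (IConst 1))))))
       (assign ''ok'' (IConst 0)) Skip))"

definition update_prog :: com where
  "update_prog = Cond (ILess (IConst 0) (var ''ok'')) (Seq letters_prog (Seq join_prog relabel_prog)) Skip"

text \<open>The padding arc is written by default and overwritten if the triple describes a
  transition or a final arc. Labels are read from \<open>p\<close> and \<open>q\<close> only when
  the head is not the sink, so only transitions write them.\<close>

definition emit_prog :: com where
  "emit_prog =
     Seq (IAssign ''tail'' (var ''e'') (IAdd (var ''sink'') (IConst 1)))
    (Seq (IAssign ''head'' (var ''e'') (var ''sink''))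
    (Seq (Cond (ILess (IConst 0) (var ''ok''))
           (Seq (IAssign ''tail'' (var ''e'') (var ''u''))
           (Seq (IAssign ''head'' (var ''e'') (IAdd (IMul (var ''g'') (var ''N'')) (var ''i'')))
           (Seq (IAssign ''p'' (var ''e'') (IElem ''o'' (var ''i'')))
                (IAssign ''q'' (var ''e'') (IElem ''o'' (var ''j''))))))
           (Cond (BAnd (equal (var ''i'') (IConst 0)) (BAnd (equal (var ''j'') (IConst 0))
                    (equal (IAdd (var ''c'') (IConst 1)) (IElem ''w'' (var ''n'')))))
             (IAssign ''tail'' (var ''e'') (var ''u'')) Skip))
         (assign ''e'' (IAdd (var ''e'') (IConst 1)))))"

definition arc_prog :: com where
  "arc_prog =
     Seq decode_prog (Seq check_prog (Seq right_prog (Seq left_prog (Seq update_prog emit_prog))))"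

definition arcs_prog :: com where
  "arcs_prog = While (var_less ''e'' ''arcs'') arc_prog"

definition cycle_prog :: com where
  "cycle_prog = Seq rank_prog (Seq power_prog (Seq size_prog arcs_prog))"

section \<open>The input points numbered from left to right\<close>

locale ranked_points =
  fixes ps :: "point list"
  assumes distinct: "distinct ps" and general: "general_position (set ps)"
begin

definition n :: nat where "n = length ps"

definition x_rank :: "nat \<Rightarrow> nat" where
  "x_rank a = card {b. b < n \<and> fst (ps ! b) < fst (ps ! a)}"

text \<open>The input position of the point with a given rank.\<close>

definition ord :: "nat \<Rightarrow> nat" where
  "ord = inv_into {..<n} x_rank"

definition v :: "nat \<Rightarrow> point" where
  "v k = ps ! ord k"

lemma rank_mono:
  assumes "a < n" "fst (ps ! a) < fst (ps ! b)"
  shows "x_rank a < x_rank b"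
  unfolding x_rank_def
proof (rule psubset_card_mono)
  show "{c. c < n \<and> fst (ps ! c) < fst (ps ! a)} \<subset> {c. c < n \<and> fst (ps ! c) < fst (ps ! b)}"
    using assms by (intro psubsetI) (auto dest: less_trans)
qed simp

lemma x_inj: "a < n \<Longrightarrow> b < n \<Longrightarrow> fst (ps ! a) = fst (ps ! b) \<Longrightarrow> a = b"
  using general distinct nth_eq_iff_index_eq[of ps a b] inj_onD[of fst "set ps" "ps ! a" "ps ! b"]
  by (simp add: general_position_def n_def)

lemma rank_less: "a < n \<Longrightarrow> x_rank a < n"
proof -
  assume "a < n"
  then have "{b. b < n \<and> fst (ps ! b) < fst (ps ! a)} \<subset> {..<n}" by auto
  then have "x_rank a < card {..<n}" unfolding x_rank_def by (intro psubset_card_mono) auto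
  then show ?thesis by simp
qed

text \<open>Ranks are injective because the abscissae are distinct, and an injective self-map of a
  finite set is onto.\<close>

lemma bij_rank: "bij_betw x_rank {..<n} {..<n}"
proof -
  have inj: "inj_on x_rank {..<n}"
  proof (rule inj_onI)
    fix a b assume ab: "a \<in> {..<n}" "b \<in> {..<n}" "x_rank a = x_rank b"
    then have "fst (ps ! a) = fst (ps ! b)"
      using rank_mono[of a b] rank_mono[of b a] by (cases "fst (ps ! a)" "fst (ps ! b)" rule: linorder_cases) auto
    then show "a = b" using x_inj ab by simp
  qed
  moreover have "x_rank ` {..<n} \<subseteq> {..<n}" using rank_less by auto
  ultimately show ?thesis by (simp add: bij_betw_def endo_inj_surj)
qed

lemma ord_rank: "a < n \<Longrightarrow> ord (x_rank a) = a"
  unfolding ord_def using bij_rank by (simp add: bij_betw_def inv_into_f_f)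

lemma rank_ord: "k < n \<Longrightarrow> x_rank (ord k) = k"
  unfolding ord_def using bij_betw_inv_into_right[OF bij_rank] by simp

lemma ord_less: "k < n \<Longrightarrow> ord k < n"
  unfolding ord_def using bij_betw_apply[OF bij_betw_inv_into[OF bij_rank]] by simp

lemma ordered: "i < j \<Longrightarrow> j < n \<Longrightarrow> fst (v i) < fst (v j)"
proof (rule ccontr)
  assume ij: "i < j" "j < n" and "\<not> fst (v i) < fst (v j)"
  then consider "fst (ps ! ord j) < fst (ps ! ord i)" | "fst (ps ! ord i) = fst (ps ! ord j)"
    by (fastforce simp: v_def)
  then show False
  proof cases
    case 1
    then show False using rank_mono[OF ord_less[OF ij(2)] 1] rank_ord ij by simp
  next
    case 2
    then have "ord i = ord j" using x_inj[OF ord_less ord_less] ij by simp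
    then show False using rank_ord[of i] rank_ord[of j] ij by simp
  qed
qed

lemma v_image: "v ` {..<n} = set ps"
proof -
  have "ord ` {..<n} = {..<n}"
    using bij_betw_inv_into[OF bij_rank] by (simp add: bij_betw_def ord_def)
  moreover have "v ` {..<n} = (!) ps ` ord ` {..<n}" by (simp add: v_def image_image)
  ultimately have "v ` {..<n} = (!) ps ` {..<n}" by simp
  also have "\<dots> = set ps" by (auto simp: n_def set_conv_nth)
  finally show ?thesis .
qed

sublocale ordered_points n v
proof
  show "fst (v i) < fst (v j)" if "i < j" "j < n" for i j using ordered that .
  show "\<not> collinear {v i, v k, v j}" if "i < k" "k < j" "j < n" for i k j
  proof -
    have "v i \<noteq> v k" "v i \<noteq> v j" "v k \<noteq> v j"
      using ordered[of i k] ordered[of i j] ordered[of k j] that by auto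
    moreover have "v i \<in> set ps" "v k \<in> set ps" "v j \<in> set ps"
      using that v_image by auto
    ultimately show ?thesis
      using general unfolding general_position_def by blast
  qed
qed

definition input_reals :: "state \<Rightarrow> bool" where
  "input_reals \<sigma> \<longleftrightarrow> reals \<sigma> = reals (input_state ps)"

lemma input_reals_agree: "agree A \<sigma> \<tau> \<Longrightarrow> input_reals \<sigma> \<Longrightarrow> input_reals \<tau>"
  by (simp add: agree_def input_reals_def)

lemma read_x: "input_reals \<sigma> \<Longrightarrow> a < n \<Longrightarrow> reals \<sigma> ''x'' a = fst (ps ! a)"
  by (simp add: input_reals_def input_state_def n_def)

lemma read_y: "input_reals \<sigma> \<Longrightarrow> a < n \<Longrightarrow> reals \<sigma> ''y'' a = snd (ps ! a)"
  by (simp add: input_reals_def input_state_def n_def)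

end

section \<open>Correctness of the program on words of sufficient length\<close>

locale ranked_points_machine = ranked_points +
  fixes w :: nat
  assumes big: "4 ^ n * (n + 1) ^ 3 + 4 < 2 ^ w"
begin

text \<open>Up to a small additive constant, no stored word exceeds the number of arcs. The slack of
  4 covers this constant, as well as the letters and \<open>sink_vertex + 2\<close> when
  \<open>n = 0\<close>.\<close>

lemma bounds:
  "n + 1 \<le> sink_vertex" "sink_vertex \<le> 4 ^ n * (n + 1) ^ 3" "4 ^ n \<le> sink_vertex"
  "sink_vertex + 4 < 2 ^ w" "n + 4 < 2 ^ w" "4 < (2 :: nat) ^ w"
proof -
  have "1 * (n + 1) \<le> 4 ^ n * (n + 1)" by (rule mult_le_mono1) simp
  then show 1: "n + 1 \<le> sink_vertex" unfolding sink_vertex_def by (simp only: mult_1)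
  show 2: "sink_vertex \<le> 4 ^ n * (n + 1) ^ 3" unfolding arcs_eq by simp
  show "4 ^ n \<le> sink_vertex" unfolding sink_vertex_def by simp
  show "sink_vertex + 4 < 2 ^ w" "n + 4 < 2 ^ w" "4 < (2 :: nat) ^ w" using 1 2 big by linarith+
qed

definition count_cost :: nat where
  "count_cost = cost_bound count_init + while_cost n (var_less ''b'' ''n'') (cost_bound count_body)"

definition rank_cost :: nat where
  "rank_cost = while_cost n (var_less ''a'' ''n'') (count_cost + cost_bound store_rank)"

definition power_cost :: nat where
  "power_cost = cost_bound power_init + while_cost n (var_less ''k'' ''n'') (cost_bound power_body)"

lemma runs_count:
  assumes "input_reals \<sigma>" "words \<sigma> ''n'' 0 = n" "words \<sigma> ''a'' 0 = a" "a < n"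
  shows "runs w count_prog \<sigma> count_cost
    (\<lambda>\<tau>. agree {''r'', ''b''} \<sigma> \<tau> \<and> words \<tau> ''r'' 0 = x_rank a)"
proof -
  let ?R = "\<lambda>t. card {b. b < t \<and> fst (ps ! b) < fst (ps ! a)}"
  let ?I = "\<lambda>t \<tau>. agree {''r'', ''b''} \<sigma> \<tau> \<and> words \<tau> ''r'' 0 = ?R t \<and> words \<tau> ''b'' 0 = t"
  have R_le: "?R t \<le> t" for t
    using card_mono[of "{..<t}" "{b. b < t \<and> fst (ps ! b) < fst (ps ! a)}"] by auto
  have R_Suc: "?R (Suc t) = (if fst (ps ! t) < fst (ps ! a) then ?R t + 1 else ?R t)" for t
  proof -
    have "{b. b < Suc t \<and> fst (ps ! b) < fst (ps ! a)} =
        (if fst (ps ! t) < fst (ps ! a) then insert t {b. b < t \<and> fst (ps ! b) < fst (ps ! a)}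
         else {b. b < t \<and> fst (ps ! b) < fst (ps ! a)})"
      by (auto simp: less_Suc_eq)
    then show ?thesis by simp
  qed
  have 1: "runs w count_init \<sigma> (cost_bound count_init) (?I 0)"
    by (rule runs_wp) (simp add: count_init_def)
  have 2: "runs w (While (var_less ''b'' ''n'') count_body) \<tau>
      (while_cost n (var_less ''b'' ''n'') (cost_bound count_body)) (?I n)" if "?I 0 \<tau>" for \<tau>
  proof (rule runs_While[where I = ?I])
    fix t \<rho> assume t: "t < n" and I: "?I t \<rho>"
    have "words \<rho> ''n'' 0 = n" "words \<rho> ''a'' 0 = a" "input_reals \<rho>"
      using I assms by (simp_all add: agree_def input_reals_def)
    then have f: "words \<rho> ''n'' 0 = n" "words \<rho> ''a'' 0 = a" "reals \<rho> ''x'' a = fst (ps ! a)"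
      "reals \<rho> ''x'' t = fst (ps ! t)"
      using read_x t assms(4) by auto
    have "?R t + 1 < 2 ^ w" "t + 1 < 2 ^ w" using R_le[of t] t bounds(5) by linarith+
    then have "runs w count_body \<rho> (cost_bound count_body) (?I (Suc t))"
      using f I by (intro runs_wp) (simp add: count_body_def R_Suc)
    then show "bval (var_less ''b'' ''n'') \<rho> \<and> runs w count_body \<rho> (cost_bound count_body) (?I (Suc t))"
      using f I t by simp
  next
    show "?I 0 \<tau>" by (rule that)
    show "\<not> bval (var_less ''b'' ''n'') \<rho>" if "?I n \<rho>" for \<rho>
      using that assms(2) by (simp add: agree_def)
  qed
  show ?thesis
    unfolding count_prog_def count_cost_def
    by (rule runs_mono[OF runs_Seq[OF 1 2]]) (auto simp: x_rank_def)
qed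

lemma runs_rank:
  "runs w rank_prog (input_state ps) rank_cost
    (\<lambda>\<tau>. agree {''r'', ''b'', ''o'', ''a''} (input_state ps) \<tau> \<and> (\<forall>k<n. words \<tau> ''o'' k = ord k))"
proof -
  let ?s = "input_state ps" and ?A = "{''r'', ''b'', ''o'', ''a''}"
  let ?I = "\<lambda>t \<tau>. agree ?A ?s \<tau> \<and> words \<tau> ''a'' 0 = t \<and> (\<forall>a<t. words \<tau> ''o'' (x_rank a) = a)"
  have "runs w rank_prog ?s rank_cost (?I n)"
    unfolding rank_prog_def rank_cost_def
  proof (rule runs_While[where I = ?I])
    show "?I 0 ?s" by (simp add: input_state_def)
    have nn: "words \<rho> ''n'' 0 = n" if "agree ?A ?s \<rho>" for \<rho>
      using agree_words[OF that, of "''n''"] by (simp add: input_state_def n_def)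
    then show "\<not> bval (var_less ''a'' ''n'') \<rho>" if "?I n \<rho>" for \<rho>
      using that by auto
    fix t \<rho> assume t: "t < n" and I: "?I t \<rho>"
    have f: "words \<rho> ''n'' 0 = n" using I nn by blast
    have r: "input_reals \<rho>" using input_reals_agree[of ?A ?s \<rho>] I by (simp add: input_reals_def)
    have c: "runs w count_prog \<rho> count_cost (\<lambda>\<tau>. agree {''r'', ''b''} \<rho> \<tau> \<and> words \<tau> ''r'' 0 = x_rank t)"
      by (rule runs_count) (use f r I t in auto)
    have "runs w (Seq count_prog store_rank) \<rho> (count_cost + cost_bound store_rank) (?I (Suc t))"
    proof (rule runs_Seq[OF c])
      fix \<tau> assume \<tau>: "agree {''r'', ''b''} \<rho> \<tau> \<and> words \<tau> ''r'' 0 = x_rank t"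
      have "words \<tau> ''a'' = words \<rho> ''a''" "words \<tau> ''o'' = words \<rho> ''o''"
        using \<tau> by (simp_all add: agree_def)
      moreover have "agree ?A ?s \<tau>"
        using I \<tau> agree_trans[of ?A ?s \<rho> "{''r'', ''b''}" \<tau>] by (simp add: insert_commute)
      moreover have "x_rank t < 2 ^ w" "t + 1 < 2 ^ w" using rank_less[OF t] t bounds(5) by linarith+
      \<comment> \<open>Ranks are distinct, so the new entry of \<open>o\<close> overwrites none of
        the earlier ones.\<close>
      moreover have "x_rank a \<noteq> x_rank t" if "a < t" for a
        using ord_rank[of a] ord_rank[of t] that t by auto
      ultimately show "runs w store_rank \<tau> (cost_bound store_rank) (?I (Suc t))"
        using I \<tau> by (intro runs_wp) (auto simp: store_rank_def less_Suc_eq)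
    qed
    then show "bval (var_less ''a'' ''n'') \<rho> \<and>
      runs w (Seq count_prog store_rank) \<rho> (count_cost + cost_bound store_rank) (?I (Suc t))"
      using f I t by simp
  qed
  then show ?thesis
  proof (rule runs_mono)
    fix \<tau> assume I: "?I n \<tau>"
    have "words \<tau> ''o'' k = ord k" if "k < n" for k
    proof -
      have "words \<tau> ''o'' (x_rank (ord k)) = ord k" using I ord_less[OF that] by blast
      then show ?thesis by (simp only: rank_ord[OF that])
    qed
    then show "agree ?A ?s \<tau> \<and> (\<forall>k<n. words \<tau> ''o'' k = ord k)" using I by blast
  qed simp
qed

lemma runs_power:
  assumes "words \<sigma> ''k'' 0 = 0" "words \<sigma> ''n'' 0 = n"
  shows "runs w power_prog \<sigma> power_cost
    (\<lambda>\<tau>. agree {''w'', ''k''} \<sigma> \<tau> \<and> (\<forall>k\<le>n. words \<tau> ''w'' k = 4 ^ k))"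
proof -
  let ?I = "\<lambda>t \<tau>. agree {''w'', ''k''} \<sigma> \<tau> \<and> words \<tau> ''k'' 0 = t \<and> (\<forall>k\<le>t. words \<tau> ''w'' k = 4 ^ k)"
  have 1: "runs w power_init \<sigma> (cost_bound power_init) (?I 0)"
    using assms bounds(6) by (intro runs_wp) (simp add: power_init_def)
  have 2: "runs w (While (var_less ''k'' ''n'') power_body) \<tau>
      (while_cost n (var_less ''k'' ''n'') (cost_bound power_body)) (?I n)" if "?I 0 \<tau>" for \<tau>
  proof (rule runs_While[where I = ?I])
    fix t \<rho> assume t: "t < n" and I: "?I t \<rho>"
    have f: "words \<rho> ''n'' 0 = n" using I assms by (simp add: agree_def)
    have "(4 :: nat) ^ Suc t \<le> 4 ^ n" using t by (intro power_increasing) auto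
    then have "4 * 4 ^ t < (2 :: nat) ^ w" "t + 1 < 2 ^ w" using t bounds by auto
    then have "runs w power_body \<rho> (cost_bound power_body) (?I (Suc t))"
      using f I by (intro runs_wp) (auto simp: power_body_def le_Suc_eq)
    then show "bval (var_less ''k'' ''n'') \<rho> \<and> runs w power_body \<rho> (cost_bound power_body) (?I (Suc t))"
      using f I t by simp
  next
    show "?I 0 \<tau>" by (rule that)
    show "\<not> bval (var_less ''k'' ''n'') \<rho>" if "?I n \<rho>" for \<rho>
      using that assms(2) by (simp add: agree_def)
  qed
  show ?thesis
    unfolding power_prog_def power_cost_def
    by (rule runs_mono[OF runs_Seq[OF 1 2]]) auto
qed

text \<open>The data that the loop over the arcs keeps unchanged. \<open>source\<close> has its
  initial value 0, as it is never written.\<close>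

definition prepared :: "state \<Rightarrow> bool" where
  "prepared \<sigma> \<longleftrightarrow> input_reals \<sigma> \<and> words \<sigma> ''n'' 0 = n \<and> (\<forall>k<n. words \<sigma> ''o'' k = ord k) \<and>
     (\<forall>k\<le>n. words \<sigma> ''w'' k = 4 ^ k) \<and> words \<sigma> ''N'' 0 = n + 1 \<and> words \<sigma> ''sink'' 0 = sink_vertex \<and>
     words \<sigma> ''verts'' 0 = sink_vertex + 2 \<and> words \<sigma> ''arcs'' 0 = 4 ^ n * (n + 1) ^ 3 \<and>
     words \<sigma> ''source'' 0 = 0"

lemma prepared_agree:
  assumes "agree A \<sigma> \<tau>" "A \<inter> {''n'', ''o'', ''w'', ''N'', ''sink'', ''verts'', ''arcs'', ''source''} = {}" "prepared \<sigma>"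
  shows "prepared \<tau>"
proof -
  have "words \<tau> a = words \<sigma> a" if "a \<in> {''n'', ''o'', ''w'', ''N'', ''sink'', ''verts'', ''arcs'', ''source''}" for a
    using agree_words[OF assms(1)] assms(2) that by blast
  then show ?thesis
    using assms(3) input_reals_agree[OF assms(1)] by (simp add: prepared_def)
qed

lemma runs_size:
  assumes "input_reals \<sigma>" "words \<sigma> ''n'' 0 = n" "\<forall>k<n. words \<sigma> ''o'' k = ord k"
    "\<forall>k\<le>n. words \<sigma> ''w'' k = 4 ^ k" "words \<sigma> ''source'' 0 = 0"
  shows "runs w size_prog \<sigma> (cost_bound size_prog)
    (\<lambda>\<tau>. agree {''N'', ''sink'', ''verts'', ''arcs''} \<sigma> \<tau> \<and> prepared \<tau>)"
proof -
  let ?A = "{''N'', ''sink'', ''verts'', ''arcs''}"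
  have "sink_vertex * (n + 1) * (n + 1) < 2 ^ w" unfolding arcs_eq[symmetric] using big by linarith
  moreover have "4 ^ n * (n + 1) = sink_vertex" by (simp add: sink_vertex_def)
  ultimately have "runs w size_prog \<sigma> (cost_bound size_prog)
    (\<lambda>\<tau>. agree ?A \<sigma> \<tau> \<and> words \<tau> ''N'' 0 = n + 1 \<and> words \<tau> ''sink'' 0 = sink_vertex \<and>
     words \<tau> ''verts'' 0 = sink_vertex + 2 \<and> words \<tau> ''arcs'' 0 = sink_vertex * (n + 1) * (n + 1))"
    using assms bounds by (intro runs_wp) (simp add: size_prog_def)
  then show ?thesis
  proof (rule runs_mono)
    fix \<tau>
    assume "agree ?A \<sigma> \<tau> \<and> words \<tau> ''N'' 0 = n + 1 \<and> words \<tau> ''sink'' 0 = sink_vertex \<and>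
      words \<tau> ''verts'' 0 = sink_vertex + 2 \<and> words \<tau> ''arcs'' 0 = sink_vertex * (n + 1) * (n + 1)"
    then have 1: "agree ?A \<sigma> \<tau>" "words \<tau> ''N'' 0 = n + 1" "words \<tau> ''sink'' 0 = sink_vertex"
      "words \<tau> ''verts'' 0 = sink_vertex + 2" "words \<tau> ''arcs'' 0 = sink_vertex * (n + 1) * (n + 1)"
      by blast+
    then have "words \<tau> ''n'' = words \<sigma> ''n''" "words \<tau> ''o'' = words \<sigma> ''o''" "words \<tau> ''w'' = words \<sigma> ''w''"
      "words \<tau> ''source'' = words \<sigma> ''source''"
      by (simp_all add: agree_def)
    then show "agree ?A \<sigma> \<tau> \<and> prepared \<tau>"
      using 1 assms input_reals_agree unfolding prepared_def arcs_eq by auto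
  qed simp
qed

definition decoded :: "nat \<Rightarrow> nat \<Rightarrow> nat \<Rightarrow> state \<Rightarrow> bool" where
  "decoded u i j \<sigma> \<longleftrightarrow> prepared \<sigma> \<and> words \<sigma> ''e'' 0 = arc_number u i j \<and> words \<sigma> ''u'' 0 = u \<and>
     words \<sigma> ''i'' 0 = i \<and> words \<sigma> ''j'' 0 = j \<and> words \<sigma> ''c'' 0 = u div (n + 1) \<and>
     words \<sigma> ''di'' 0 = digit (u div (n + 1)) i \<and> words \<sigma> ''dj'' 0 = digit (u div (n + 1)) j"

lemma decoded_agree:
  assumes "agree A \<sigma> \<tau>" "decoded u i j \<sigma>"
    and "A \<inter> {''n'', ''o'', ''w'', ''N'', ''sink'', ''verts'', ''arcs'', ''source''} = {}"
    and "A \<inter> {''e'', ''u'', ''i'', ''j'', ''c'', ''di'', ''dj''} = {}"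
  shows "decoded u i j \<tau>"
proof -
  have "words \<tau> a = words \<sigma> a" if "a \<in> {''e'', ''u'', ''i'', ''j'', ''c'', ''di'', ''dj''}" for a
    using agree_words[OF assms(1)] assms(4) that by blast
  then show ?thesis
    using assms(2) prepared_agree[OF assms(1,3)] by (simp add: decoded_def)
qed

lemma prepared_words:
  assumes "prepared \<sigma>"
  shows "words \<sigma> ''n'' 0 = n" "k < n \<Longrightarrow> words \<sigma> ''o'' k = ord k" "k \<le> n \<Longrightarrow> words \<sigma> ''w'' k = 4 ^ k"
    "words \<sigma> ''N'' 0 = n + 1" "words \<sigma> ''sink'' 0 = sink_vertex"
  using assms by (simp_all add: prepared_def)

lemma decoded_words:
  assumes "decoded u i j \<sigma>"
  shows "prepared \<sigma>" "words \<sigma> ''e'' 0 = arc_number u i j" "words \<sigma> ''u'' 0 = u"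
    "words \<sigma> ''i'' 0 = i" "words \<sigma> ''j'' 0 = j" "words \<sigma> ''c'' 0 = u div (n + 1)"
    "words \<sigma> ''di'' 0 = digit (u div (n + 1)) i" "words \<sigma> ''dj'' 0 = digit (u div (n + 1)) j"
  using assms by (simp_all add: decoded_def)

lemma ival_digit:
  assumes "prepared \<sigma>" "words \<sigma> ''c'' 0 = c" "ival k \<sigma> \<le> n"
  shows "ival (digit_exp k) \<sigma> = digit c (ival k \<sigma>)"
  using assms prepared_words(3)[OF assms(1,3)] by (simp add: digit_exp_def digit_def)

lemma digit_less: "digit c k < 4"
  by (simp add: digit_def)

text \<open>The part of the transition test that \<open>decode_prog\<close> settles at once;
  \<open>check_prog\<close> adds \<open>fits\<close> for the points in between. For digits,
  \<open>< 3\<close> means \<open>\<noteq> 3\<close>.\<close>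

definition entry :: "nat \<Rightarrow> nat \<Rightarrow> nat \<Rightarrow> bool" where
  "entry u i j \<longleftrightarrow> i < j \<and> j < n \<and> u mod (n + 1) < j \<and>
     digit (u div (n + 1)) i < 3 \<and> digit (u div (n + 1)) j < 3"

lemma runs_decode:
  assumes "prepared \<sigma>" "words \<sigma> ''e'' 0 = arc_number u i j" "u < sink_vertex" "i \<le> n" "j \<le> n"
  shows "runs w decode_prog \<sigma> (cost_bound decode_prog)
    (\<lambda>\<tau>. agree {''u'', ''i'', ''j'', ''c'', ''di'', ''dj'', ''ok'', ''k''} \<sigma> \<tau> \<and> decoded u i j \<tau> \<and>
       words \<tau> ''k'' 0 = i + 1 \<and> words \<tau> ''ok'' 0 = (if entry u i j then 1 else 0))"
proof -
  note p = prepared_words[OF assms(1)]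
  note dec = arc_number_decode[OF assms(4,5), of u]
  let ?A = "{''u'', ''i'', ''j'', ''c'', ''di'', ''dj'', ''ok'', ''k''}"
  let ?c = "u div (n + 1)"
  have "?c \<le> u" by simp
  then have b: "u < 2 ^ w" "i + 1 < 2 ^ w" "j < 2 ^ w" "?c < 2 ^ w" "(1 :: nat) < 2 ^ w"
    using assms bounds by linarith+
  have d: "digit ?c k < 2 ^ w" for k using digit_less[of ?c k] bounds(6) by linarith
  have "runs w decode_prog \<sigma> (cost_bound decode_prog)
    (\<lambda>\<tau>. agree ?A \<sigma> \<tau> \<and> words \<tau> ''u'' 0 = u \<and> words \<tau> ''i'' 0 = i \<and> words \<tau> ''j'' 0 = j \<and>
       words \<tau> ''c'' 0 = ?c \<and> words \<tau> ''di'' 0 = digit ?c i \<and> words \<tau> ''dj'' 0 = digit ?c j \<and>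
       words \<tau> ''k'' 0 = i + 1 \<and> words \<tau> ''ok'' 0 = (if entry u i j then 1 else 0))"
    unfolding decode_prog_def digit_exp_def
    using b d[unfolded digit_def] p(3)[OF assms(4)] p(3)[OF assms(5)]
    by (intro runs_wp) (simp add: p(1,4) assms(2) dec[simplified] digit_def entry_def)
  then show ?thesis
  proof (rule runs_mono)
    fix \<tau> assume t: "agree ?A \<sigma> \<tau> \<and> words \<tau> ''u'' 0 = u \<and> words \<tau> ''i'' 0 = i \<and> words \<tau> ''j'' 0 = j \<and>
       words \<tau> ''c'' 0 = ?c \<and> words \<tau> ''di'' 0 = digit ?c i \<and> words \<tau> ''dj'' 0 = digit ?c j \<and>
       words \<tau> ''k'' 0 = i + 1 \<and> words \<tau> ''ok'' 0 = (if entry u i j then 1 else 0)"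
    then have "prepared \<tau>" using prepared_agree[of ?A \<sigma> \<tau>] assms(1) by simp
    moreover have "words \<tau> ''e'' 0 = arc_number u i j" using t assms(2) by (simp add: agree_def)
    ultimately show "agree ?A \<sigma> \<tau> \<and> decoded u i j \<tau> \<and>
       words \<tau> ''k'' 0 = i + 1 \<and> words \<tau> ''ok'' 0 = (if entry u i j then 1 else 0)"
      using t by (simp add: decoded_def)
  qed simp
qed

definition fits :: "nat \<Rightarrow> nat \<Rightarrow> nat \<Rightarrow> nat \<Rightarrow> bool" where
  "fits c i j k \<longleftrightarrow> digit c k = (if point_below i k j then 3 else 0)"

lemma entry_fits_iff:
  "entry u i j \<and> (\<forall>k. i < k \<longrightarrow> k < j \<longrightarrow> fits (u div (n + 1)) i j k) \<longleftrightarrow>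
     admissible (digit (u div (n + 1))) i j \<and> u mod (n + 1) < j"
proof -
  have "digit c k < 3 \<longleftrightarrow> digit c k \<noteq> 3" for c k using digit_less[of c k] by linarith
  then show ?thesis by (auto simp: entry_def fits_def admissible_def)
qed

lemma bval_below:
  assumes "decoded u i j \<sigma>" "words \<sigma> ''k'' 0 = k" "i < k" "k < j" "j < n"
  shows "bval below_exp \<sigma> \<longleftrightarrow> point_below i k j"
proof -
  note d = decoded_words[OF assms(1)]
  note p = prepared_words[OF d(1)]
  have r: "input_reals \<sigma>" using d(1) by (simp add: prepared_def)
  have "reals \<sigma> ''x'' (ord l) = fst (v l)" "reals \<sigma> ''y'' (ord l) = snd (v l)" "words \<sigma> ''o'' l = ord l"
    if "l < n" for l
    using read_x[OF r ord_less[OF that]] read_y[OF r ord_less[OF that]] p(2)[OF that] by (simp_all add: v_def)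
  then show ?thesis
    using assms d by (simp add: below_exp_def coordinate_diff_def point_below_iff)
qed

definition check_cost :: nat where
  "check_cost = while_cost n (var_less ''k'' ''j'') (cost_bound check_body)"

lemma runs_check:
  assumes \<sigma>: "decoded u i j \<sigma>" "words \<sigma> ''k'' 0 = i + 1" "words \<sigma> ''ok'' 0 = (if entry u i j then 1 else 0)"
    and ij: "i \<le> n" "j \<le> n"
  shows "runs w check_prog \<sigma> check_cost
    (\<lambda>\<tau>. agree {''k'', ''ok''} \<sigma> \<tau> \<and> decoded u i j \<tau> \<and>
      words \<tau> ''ok'' 0 = (if admissible (digit (u div (n + 1))) i j \<and> u mod (n + 1) < j then 1 else 0))"
proof -
  let ?c = "u div (n + 1)" and ?T = "j - (i + 1)"
  let ?F = "\<lambda>t. entry u i j \<and> (\<forall>k. i < k \<longrightarrow> k < i + 1 + t \<longrightarrow> fits ?c i j k)"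
  let ?I = "\<lambda>t \<tau>. agree {''k'', ''ok''} \<sigma> \<tau> \<and> words \<tau> ''k'' 0 = i + 1 + t \<and>
    words \<tau> ''ok'' 0 = (if ?F t then 1 else 0)"
  have dec: "decoded u i j \<tau>" if "agree {''k'', ''ok''} \<sigma> \<tau>" for \<tau>
    using decoded_agree[OF that \<sigma>(1)] by simp
  have F_Suc: "?F (Suc t) \<longleftrightarrow> ?F t \<and> fits ?c i j (i + 1 + t)" for t
  proof -
    have "k < i + 1 + Suc t \<longleftrightarrow> k < i + 1 + t \<or> k = i + 1 + t" for k by linarith
    moreover have "i < i + 1 + t" by simp
    ultimately show ?thesis by metis
  qed
  have "runs w check_prog \<sigma> (while_cost ?T (var_less ''k'' ''j'') (cost_bound check_body)) (?I ?T)"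
    unfolding check_prog_def
  proof (rule runs_While[where I = ?I])
    show "?I 0 \<sigma>" using \<sigma> by auto
    show "\<not> bval (var_less ''k'' ''j'') \<tau>" if "?I ?T \<tau>" for \<tau>
      using that decoded_words(5)[OF dec] by simp
    fix t \<rho> assume t: "t < ?T" and I: "?I t \<rho>"
    let ?k = "i + 1 + t"
    note d = decoded_words[OF dec[of \<rho>]]
    have \<rho>: "agree {''k'', ''ok''} \<sigma> \<rho>" "words \<rho> ''k'' 0 = ?k" "words \<rho> ''ok'' 0 = (if ?F t then 1 else 0)"
      using I by auto
    have kj: "i < ?k" "?k < j" "?k \<le> n" using t ij by auto
    have dg: "ival (digit_exp (var ''k'')) \<rho> = digit ?c ?k"
      using ival_digit[of \<rho> ?c "var ''k''"] d[OF \<rho>(1)] \<rho>(2) kj(3) by simp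
    have bl: "bval below_exp \<rho> = point_below i ?k j" if "entry u i j"
      using bval_below[OF dec[OF \<rho>(1)] \<rho>(2) kj(1,2)] that by (simp add: entry_def)
    have b: "?k + 1 < 2 ^ w" using kj(2) ij(2) bounds(5) by linarith
    have fit: "fits ?c i j ?k \<longleftrightarrow> (if point_below i ?k j then \<not> digit ?c ?k < 3 else \<not> 0 < digit ?c ?k)"
      using digit_less[of ?c ?k] by (auto simp: fits_def)
    have "runs w check_body \<rho> (cost_bound check_body) (?I (Suc t))"
    \<comment> \<open>Without \<open>entry\<close> the indices need not be below \<open>n\<close>
      and the comparison may read meaningless coordinates. This is harmless, as \<open>ok\<close> is
      0 already and the loop never sets it to 1.\<close>
    proof (cases "entry u i j")
      case True
      show ?thesis
        unfolding F_Suc fit check_body_def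
        by (rule runs_wp) (use \<rho> b bl[OF True] dg True in simp)
    next
      case False
      then show ?thesis
        unfolding check_body_def
        by (intro runs_wp) (use \<rho> b dg False in simp)
    qed
    then show "bval (var_less ''k'' ''j'') \<rho> \<and> runs w check_body \<rho> (cost_bound check_body) (?I (Suc t))"
      using \<rho> d(5)[OF \<rho>(1)] kj by simp
  qed
  then show ?thesis
  proof (rule runs_mono)
    show "while_cost ?T (var_less ''k'' ''j'') (cost_bound check_body) \<le> check_cost"
      unfolding check_cost_def using ij by (intro while_cost_mono) simp
    fix \<tau> assume I: "?I ?T \<tau>"
    \<comment> \<open>The number of rounds is a truncated difference. If \<open>i < j\<close> it
      counts the points in between; otherwise it is 0 and \<open>entry\<close> fails.\<close>
    have "?F ?T \<longleftrightarrow> entry u i j \<and> (\<forall>k. i < k \<longrightarrow> k < j \<longrightarrow> fits ?c i j k)"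
      by (cases "i < j") (auto simp: entry_def)
    then show "agree {''k'', ''ok''} \<sigma> \<tau> \<and> decoded u i j \<tau> \<and>
      words \<tau> ''ok'' 0 = (if admissible (digit ?c) i j \<and> u mod (n + 1) < j then 1 else 0)"
      using I dec entry_fits_iff[of u i j] by simp
  qed
qed

text \<open>\<open>ks\<close> lists the positions that are still unread.\<close>
definition scanning :: "string \<Rightarrow> nat option \<Rightarrow> nat \<Rightarrow> nat \<Rightarrow> word \<Rightarrow> nat list \<Rightarrow> state \<Rightarrow> bool" where
  "scanning res goal x y d ks \<sigma> \<longleftrightarrow> words \<sigma> res 0 \<le> n \<and> words \<sigma> ''h'' 0 + length ks \<le> n \<and>
     goal = (if words \<sigma> res 0 < n then Some (words \<sigma> res 0) else scan x y d (words \<sigma> ''h'' 0) ks)"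

text \<open>A step is idle once the partner is found, which gives the loops a fixed number of
  rounds. The depth is bounded through the number of unread positions, so that it fits into a
  word.\<close>

lemma wp_scan_step:
  assumes "prepared \<sigma>" "words \<sigma> ''c'' 0 = c" "words \<sigma> ''k'' 0 = k" "k < n" "x \<noteq> y"
    and res: "res \<noteq> ''h''" "res \<noteq> ''k''" "res \<noteq> ''n''" "res \<noteq> ''c''"
    and inv: "scanning res goal x y (digit c) (k # ks) \<sigma>"
  shows "wp w (scan_step res x y) (\<lambda>\<tau>. agree {res, ''h''} \<sigma> \<tau> \<and> scanning res goal x y (digit c) ks \<tau>) \<sigma>"
proof -
  have dg: "ival (digit_exp (var ''k'')) \<sigma> = digit c k"
    using ival_digit[OF assms(1,2), of "var ''k''"] assms(3,4) by simp
  have b: "words \<sigma> ''h'' 0 + 1 < 2 ^ w" "k < 2 ^ w" "words \<sigma> ''h'' 0 - 1 < 2 ^ w"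
    using inv bounds(5) assms(4) by (auto simp: scanning_def)
  have n: "words \<sigma> ''n'' 0 = n" using prepared_words(1)[OF assms(1)] .
  show ?thesis
    using inv assms(3-5) res b dg n unfolding scan_step_def scanning_def
    by (auto split: if_splits)
qed

definition right_cost :: nat where
  "right_cost = cost_bound right_init + while_cost n (var_less ''k'' ''n'') (cost_bound right_body)"

definition left_cost :: nat where
  "left_cost = cost_bound left_init + while_cost n (ILess (IConst 0) (var ''k'')) (cost_bound left_body)"

text \<open>The scan is carried out for every arc number, whatever the letters are;
  \<open>relabel_prog\<close> consults the result only for two opening letters.\<close>

lemma runs_right:
  assumes \<sigma>: "decoded u i j \<sigma>" and j: "j \<le> n"
  shows "runs w right_prog \<sigma> right_cost
    (\<lambda>\<tau>. agree {''r'', ''h'', ''k''} \<sigma> \<tau> \<and> decoded u i j \<tau> \<and>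
      scan 1 2 (digit (u div (n + 1))) 0 [Suc j..<n] = (if words \<tau> ''r'' 0 < n then Some (words \<tau> ''r'' 0) else None))"
proof -
  let ?d = "digit (u div (n + 1))" and ?T = "n - Suc j" and ?A = "{''r'', ''h'', ''k''}"
  let ?goal = "scan 1 2 ?d 0 [Suc j..<n]"
  let ?I = "\<lambda>t \<tau>. agree ?A \<sigma> \<tau> \<and> words \<tau> ''k'' 0 = Suc j + t \<and> scanning ''r'' ?goal 1 2 ?d [Suc j + t..<n] \<tau>"
  have dec: "decoded u i j \<tau>" if "agree ?A \<sigma> \<tau>" for \<tau>
    using decoded_agree[OF that \<sigma>] by simp
  have nn: "words \<tau> ''n'' 0 = n" if "agree ?A \<sigma> \<tau>" for \<tau>
    using prepared_words(1)[OF decoded_words(1)[OF dec[OF that]]] .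
  have 1: "runs w right_init \<sigma> (cost_bound right_init) (?I 0)"
    unfolding right_init_def scan_init_def
    by (rule runs_wp) (use nn[OF agree_refl] decoded_words(5)[OF \<sigma>] bounds(5) j in \<open>simp add: scanning_def\<close>)
  have 2: "runs w (While (var_less ''k'' ''n'') right_body) \<tau>
      (while_cost ?T (var_less ''k'' ''n'') (cost_bound right_body)) (?I ?T)" if "?I 0 \<tau>" for \<tau>
  proof (rule runs_While[where I = ?I])
    show "?I 0 \<tau>" by (rule that)
    show "\<not> bval (var_less ''k'' ''n'') \<rho>" if "?I ?T \<rho>" for \<rho>
      using that nn by simp
    fix t \<rho> assume t: "t < ?T" and I: "?I t \<rho>"
    let ?k = "Suc j + t"
    have \<rho>: "agree ?A \<sigma> \<rho>" "words \<rho> ''k'' 0 = ?k" using I by auto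
    note d = decoded_words[OF dec[OF \<rho>(1)]]
    have k: "?k < n" using t by simp
    then have "[?k..<n] = ?k # [Suc j + Suc t..<n]" using upt_conv_Cons by simp
    then have inv: "scanning ''r'' ?goal 1 2 ?d (?k # [Suc j + Suc t..<n]) \<rho>" using I by simp
    have "wp w (scan_step ''r'' 1 2)
      (\<lambda>\<tau>. agree {''r'', ''h''} \<rho> \<tau> \<and> scanning ''r'' ?goal 1 2 ?d [Suc j + Suc t..<n] \<tau>) \<rho>"
      by (rule wp_scan_step[OF d(1,6) \<rho>(2) k]) (use inv in simp_all)
    then have "runs w (scan_step ''r'' 1 2) \<rho> (cost_bound (scan_step ''r'' 1 2))
      (\<lambda>\<tau>. agree {''r'', ''h''} \<rho> \<tau> \<and> scanning ''r'' ?goal 1 2 ?d [Suc j + Suc t..<n] \<tau>)"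
      by (rule runs_wp)
    moreover have "runs w (assign ''k'' (IAdd (var ''k'') (IConst 1))) \<tau>
        (cost_bound (assign ''k'' (IAdd (var ''k'') (IConst 1)))) (?I (Suc t))"
      if "agree {''r'', ''h''} \<rho> \<tau> \<and> scanning ''r'' ?goal 1 2 ?d [Suc j + Suc t..<n] \<tau>" for \<tau>
    proof (rule runs_wp)
      have "words \<tau> ''k'' 0 = ?k" using that \<rho>(2) by (simp add: agree_def)
      moreover have "agree ?A \<sigma> \<tau>"
        using \<rho>(1) that agree_trans[of ?A \<sigma> \<rho> "{''r'', ''h''}" \<tau>] by (simp add: insert_commute)
      ultimately show "wp w (assign ''k'' (IAdd (var ''k'') (IConst 1))) (?I (Suc t)) \<tau>"
        using that k bounds(5) by (simp add: scanning_def)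
    qed
    ultimately have "runs w right_body \<rho> (cost_bound right_body) (?I (Suc t))"
      unfolding right_body_def cost_bound.simps(4) by (rule runs_Seq)
    then show "bval (var_less ''k'' ''n'') \<rho> \<and> runs w right_body \<rho> (cost_bound right_body) (?I (Suc t))"
      using \<rho> nn k by simp
  qed
  show ?thesis
    unfolding right_prog_def
  proof (rule runs_mono[OF runs_Seq[OF 1 2]])
    show "cost_bound right_init + while_cost ?T (var_less ''k'' ''n'') (cost_bound right_body) \<le> right_cost"
      unfolding right_cost_def by (intro add_left_mono while_cost_mono) simp
  qed (use dec in \<open>auto simp: scanning_def\<close>)
qed

lemma runs_left:
  assumes \<sigma>: "decoded u i j \<sigma>" and i: "i \<le> n"
  shows "runs w left_prog \<sigma> left_cost
    (\<lambda>\<tau>. agree {''l'', ''h'', ''k''} \<sigma> \<tau> \<and> decoded u i j \<tau> \<and>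
      scan 2 1 (digit (u div (n + 1))) 0 (rev [0..<i]) = (if words \<tau> ''l'' 0 < n then Some (words \<tau> ''l'' 0) else None))"
proof -
  let ?d = "digit (u div (n + 1))" and ?A = "{''l'', ''h'', ''k''}"
  let ?goal = "scan 2 1 ?d 0 (rev [0..<i])"
  let ?I = "\<lambda>t \<tau>. agree ?A \<sigma> \<tau> \<and> words \<tau> ''k'' 0 = i - t \<and> scanning ''l'' ?goal 2 1 ?d (rev [0..<i - t]) \<tau>"
  have dec: "decoded u i j \<tau>" if "agree ?A \<sigma> \<tau>" for \<tau>
    using decoded_agree[OF that \<sigma>] by simp
  have 1: "runs w left_init \<sigma> (cost_bound left_init) (?I 0)"
    unfolding left_init_def scan_init_def
    by (rule runs_wp)
      (use prepared_words(1)[OF decoded_words(1)[OF \<sigma>]] decoded_words(4)[OF \<sigma>] bounds(5) i in \<open>simp add: scanning_def\<close>)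
  have 2: "runs w (While (ILess (IConst 0) (var ''k'')) left_body) \<tau>
      (while_cost i (ILess (IConst 0) (var ''k'')) (cost_bound left_body)) (?I i)" if "?I 0 \<tau>" for \<tau>
  proof (rule runs_While[where I = ?I])
    show "?I 0 \<tau>" by (rule that)
    show "\<not> bval (ILess (IConst 0) (var ''k'')) \<rho>" if "?I i \<rho>" for \<rho>
      using that by simp
    fix t \<rho> assume t: "t < i" and I: "?I t \<rho>"
    let ?k = "i - Suc t"
    have \<rho>: "agree ?A \<sigma> \<rho>" "words \<rho> ''k'' 0 = Suc ?k" using I t by auto
    have k: "?k < n" using t i by simp
    have "i - t = Suc ?k" using t by simp
    then have "rev [0..<i - t] = ?k # rev [0..<?k]" by simp
    then have inv: "scanning ''l'' ?goal 2 1 ?d (?k # rev [0..<?k]) \<rho>" using I by simp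
    let ?J = "\<lambda>\<tau>. agree {''k''} \<rho> \<tau> \<and> words \<tau> ''k'' 0 = ?k \<and> scanning ''l'' ?goal 2 1 ?d (?k # rev [0..<?k]) \<tau>"
    have "runs w (assign ''k'' (ISub (var ''k'') (IConst 1))) \<rho>
        (cost_bound (assign ''k'' (ISub (var ''k'') (IConst 1)))) ?J"
      by (rule runs_wp) (use \<rho> inv k bounds(5) in \<open>simp add: scanning_def\<close>)
    moreover have "runs w (scan_step ''l'' 2 1) \<tau> (cost_bound (scan_step ''l'' 2 1)) (?I (Suc t))"
      if J: "?J \<tau>" for \<tau>
    proof -
      have a: "agree ?A \<sigma> \<tau>"
        using \<rho>(1) J agree_trans[of ?A \<sigma> \<rho> "{''k''}" \<tau>] by (simp add: insert_commute)
      note d = decoded_words[OF dec[OF a]]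
      have "wp w (scan_step ''l'' 2 1)
        (\<lambda>\<tau>'. agree {''l'', ''h''} \<tau> \<tau>' \<and> scanning ''l'' ?goal 2 1 ?d (rev [0..<?k]) \<tau>') \<tau>"
        by (rule wp_scan_step[OF d(1,6) _ k]) (use J in simp_all)
      then have "runs w (scan_step ''l'' 2 1) \<tau> (cost_bound (scan_step ''l'' 2 1))
        (\<lambda>\<tau>'. agree {''l'', ''h''} \<tau> \<tau>' \<and> scanning ''l'' ?goal 2 1 ?d (rev [0..<?k]) \<tau>')"
        by (rule runs_wp)
      then show ?thesis
      proof (rule runs_mono)
        fix \<tau>' assume s: "agree {''l'', ''h''} \<tau> \<tau>' \<and> scanning ''l'' ?goal 2 1 ?d (rev [0..<?k]) \<tau>'"
        have "words \<tau>' ''k'' 0 = ?k" using s J by (simp add: agree_def)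
        moreover have "agree ?A \<sigma> \<tau>'"
          using a s agree_trans[of ?A \<sigma> \<tau> "{''l'', ''h''}" \<tau>'] by (simp add: insert_commute)
        ultimately show "?I (Suc t) \<tau>'" using s by simp
      qed simp
    qed
    ultimately have "runs w left_body \<rho> (cost_bound left_body) (?I (Suc t))"
      unfolding left_body_def cost_bound.simps(4) by (rule runs_Seq)
    then show "bval (ILess (IConst 0) (var ''k'')) \<rho> \<and> runs w left_body \<rho> (cost_bound left_body) (?I (Suc t))"
      using \<rho> by simp
  qed
  show ?thesis
    unfolding left_prog_def
  proof (rule runs_mono[OF runs_Seq[OF 1 2]])
    show "cost_bound left_init + while_cost i (ILess (IConst 0) (var ''k'')) (cost_bound left_body) \<le> left_cost"
      unfolding left_cost_def using i by (intro add_left_mono while_cost_mono)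
  qed (use dec in \<open>auto simp: scanning_def\<close>)
qed

lemma code_replace: "k < n \<Longrightarrow> code n d + x * 4 ^ k - d k * 4 ^ k = code n (d(k := x))"
  using code_upd[of k n d x] by simp

lemma runs_letters:
  assumes \<sigma>: "decoded u i j \<sigma>"
  shows "runs w letters_prog \<sigma> (cost_bound letters_prog)
    (\<lambda>\<tau>. agree {''a'', ''b''} \<sigma> \<tau> \<and>
      joined (digit (u div (n + 1))) i j =
        (digit (u div (n + 1)))(i := words \<tau> ''a'' 0, j := words \<tau> ''b'' 0))"
proof -
  note d = decoded_words[OF \<sigma>]
  have "digit c k < 2 ^ w" "(3 :: nat) < 2 ^ w" for c k
    using digit_less[of c k] bounds(6) by linarith+
  then show ?thesis
    unfolding letters_prog_def joined_def by (intro runs_wp) (use d in simp)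
qed

text \<open>After the first of the two replacements the value is again the code of a word, which
  keeps it below \<open>4 ^ n\<close> and hence within the word length.\<close>

lemma runs_join:
  assumes \<sigma>: "decoded u i j \<sigma>" and ij: "i < j" "j < n" "u < sink_vertex"
    and jn: "joined (digit (u div (n + 1))) i j =
      (digit (u div (n + 1)))(i := words \<sigma> ''a'' 0, j := words \<sigma> ''b'' 0)"
  shows "runs w join_prog \<sigma> (cost_bound join_prog)
    (\<lambda>\<tau>. agree {''g''} \<sigma> \<tau> \<and> words \<tau> ''g'' 0 = code n (joined (digit (u div (n + 1))) i j))"
proof -
  let ?c = "u div (n + 1)"
  note d = decoded_words[OF \<sigma>]
  note p = prepared_words[OF d(1)]
  note c = vertex_code_less[OF ij(3)]
  have word: "is_word n (joined (digit ?c) i j)"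
    using is_word_digit[OF c] ij(1,2) by (auto simp: is_word_def joined_def)
  then have "joined (digit ?c) i j i < 4" using ij by (simp add: is_word_def)
  then have a4: "words \<sigma> ''a'' 0 < 4" using ij(1) unfolding jn by simp
  have less: "code n e < 2 ^ w" if "is_word n e" for e
    using code_less[of n e] that bounds(3,4) by (auto simp: is_word_def)
  have "is_word n ((digit ?c)(i := words \<sigma> ''a'' 0))"
    using is_word_digit[OF c] a4 ij by (auto simp: is_word_def)
  note less1 = less[OF this] and less2 = less[OF word]
  have r1: "?c + words \<sigma> ''a'' 0 * 4 ^ i - digit ?c i * 4 ^ i = code n ((digit ?c)(i := words \<sigma> ''a'' 0))"
    using code_replace[of i "digit ?c" "words \<sigma> ''a'' 0"] code_digit[OF c] ij by simp
  have r2: "code n ((digit ?c)(i := words \<sigma> ''a'' 0)) + words \<sigma> ''b'' 0 * 4 ^ j - digit ?c j * 4 ^ j =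
      code n (joined (digit ?c) i j)"
    using code_replace[of j "(digit ?c)(i := words \<sigma> ''a'' 0)" "words \<sigma> ''b'' 0"] ij unfolding jn by simp
  have wij: "words \<sigma> ''w'' i = 4 ^ i" "words \<sigma> ''w'' j = 4 ^ j" using p(3) ij by auto
  show ?thesis
    unfolding join_prog_def replace_exp_def
    by (rule runs_wp) (use d wij r1[simplified] r2 less1 less2 in simp)
qed

lemma runs_relabel:
  assumes \<sigma>: "decoded u i j \<sigma>" and ij: "i < j" "j < n" "u < sink_vertex"
    and letters: "digit (u div (n + 1)) i \<le> 2" "digit (u div (n + 1)) j \<le> 2"
    and g: "words \<sigma> ''g'' 0 = code n (joined (digit (u div (n + 1))) i j)" and ok: "words \<sigma> ''ok'' 0 = 1"
    and r: "scan 1 2 (digit (u div (n + 1))) 0 [Suc j..<n] = (if words \<sigma> ''r'' 0 < n then Some (words \<sigma> ''r'' 0) else None)"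
    and l: "scan 2 1 (digit (u div (n + 1))) 0 (rev [0..<i]) = (if words \<sigma> ''l'' 0 < n then Some (words \<sigma> ''l'' 0) else None)"
  shows "runs w relabel_prog \<sigma> (cost_bound relabel_prog)
    (\<lambda>\<tau>. agree {''g'', ''ok''} \<sigma> \<tau> \<and>
      (case next_word n (digit (u div (n + 1))) i j of None \<Rightarrow> words \<tau> ''ok'' 0 = 0
       | Some d \<Rightarrow> words \<tau> ''ok'' 0 = 1 \<and> words \<tau> ''g'' 0 = code n d))"
proof -
  let ?d = "digit (u div (n + 1))"
  let ?J = "joined ?d i j"
  let ?Q = "\<lambda>\<tau>. agree {''g'', ''ok''} \<sigma> \<tau> \<and>
      (case next_word n ?d i j of None \<Rightarrow> words \<tau> ''ok'' 0 = 0
       | Some d \<Rightarrow> words \<tau> ''ok'' 0 = 1 \<and> words \<tau> ''g'' 0 = code n d)"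
  note d = decoded_words[OF \<sigma>]
  note p = prepared_words[OF d(1)]
  note c = vertex_code_less[OF ij(3)]
  have word: "is_word n ?J"
    using is_word_digit[OF c] ij(1,2) by (auto simp: is_word_def joined_def)
  have less: "code n e < 2 ^ w" if "is_word n e" for e
    using code_less[of n e] that bounds(3,4) by (auto simp: is_word_def)
  have cases: "?d i = 0 \<or> ?d i = 1 \<or> ?d i = 2" "?d j = 0 \<or> ?d j = 1 \<or> ?d j = 2"
    using letters by linarith+
  have "wp w relabel_prog ?Q \<sigma>"
  proof (cases "?d i = 1 \<and> ?d j = 1")
    case True
    show ?thesis
    proof (cases "words \<sigma> ''r'' 0 < n")
      case rn: True
      \<comment> \<open>The scanned position lies right of \<open>j\<close>, so it still has the
        letter 2 after joining, and exchanging the digit 2 for 1 is exact.\<close>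
      define q where "q = words \<sigma> ''r'' 0"
      have "q \<in> set [Suc j..<n] \<and> ?d q = 2"
        using scan_SomeD[of 1 2 ?d 0 "[Suc j..<n]" q] r rn by (simp add: q_def)
      then have q: "j < q" "q < n" "?J q = 2" using ij by (auto simp: joined_def)
      have nw: "next_word n ?d i j = Some (?J(q := 1))"
        using True r rn by (simp add: next_word_def q_def)
      have "code n ?J + 1 * 4 ^ q - 2 * 4 ^ q = code n (?J(q := 1))"
        using code_replace[OF q(2), of ?J 1] q(3) by simp
      moreover have "code n (?J(q := 1)) < 2 ^ w"
        using word q by (intro less) (auto simp: is_word_def)
      moreover have "words \<sigma> ''w'' q = 4 ^ q" using p(3) q by simp
      ultimately show ?thesis
        using d(7,8) p(1) True rn ok nw g q(2) by (simp add: relabel_prog_def replace_exp_def q_def[symmetric])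
    next
      case False
      then have "next_word n ?d i j = None" using True r by (simp add: next_word_def)
      then show ?thesis using d(7,8) p(1) True False by (simp add: relabel_prog_def)
    qed
  next
    case n11: False
    show ?thesis
    proof (cases "?d i = 2 \<and> ?d j = 2")
      case True
      show ?thesis
      proof (cases "words \<sigma> ''l'' 0 < n")
        case ln: True
        define q where "q = words \<sigma> ''l'' 0"
        have "q \<in> set (rev [0..<i]) \<and> ?d q = 1"
          using scan_SomeD[of 2 1 ?d 0 "rev [0..<i]" q] l ln by (simp add: q_def)
        then have q: "q < i" "q < n" "?J q = 1" using ij by (auto simp: joined_def)
        have nw: "next_word n ?d i j = Some (?J(q := 2))"
          using True l ln by (simp add: next_word_def q_def)
        have "code n ?J + 2 * 4 ^ q - 1 * 4 ^ q = code n (?J(q := 2))"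
          using code_replace[OF q(2), of ?J 2] q(3) by simp
        moreover have "code n (?J(q := 2)) < 2 ^ w"
          using word q by (intro less) (auto simp: is_word_def)
        moreover have "words \<sigma> ''w'' q = 4 ^ q" using p(3) q by simp
        ultimately show ?thesis
          using d(7,8) p(1) True ln ok nw g q(2) by (simp add: relabel_prog_def replace_exp_def q_def[symmetric])
      next
        case False
        then have "next_word n ?d i j = None" using True l by (simp add: next_word_def)
        then show ?thesis using d(7,8) p(1) True False by (simp add: relabel_prog_def)
      qed
    next
      case n22: False
      show ?thesis
      proof (cases "?d i = 1 \<and> ?d j = 2")
        case True
        \<comment> \<open>The program recognizes a completed cycle by comparing \<open>g + 1\<close>
          with \<open>4 ^ n\<close>.\<close>
        have full: "code n ?J + 1 = 4 ^ n \<longleftrightarrow> (\<forall>k<n. ?J k = 3)" by (rule code_all_3[OF word])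
        show ?thesis
        proof (cases "3 \<le> n \<and> (\<forall>k<n. ?J k = 3)")
          case cl: True
          then have nw: "next_word n ?d i j = Some ?J" using True by (simp add: next_word_def)
          have "code n ?J + 1 = 4 ^ n" "2 < n" using full cl by auto
          then show ?thesis
            using d(7,8) p(1) p(3)[of n] True ok nw g by (simp add: relabel_prog_def)
        next
          case cl: False
          then have nw: "next_word n ?d i j = None" using True by (auto simp: next_word_def)
          have "\<not> (2 < n \<and> code n ?J + 1 = 4 ^ n)" using full cl by auto
          then have "\<not> (2 < n \<and> \<not> 4 ^ n < code n ?J + 1 \<and> \<not> code n ?J + 1 < 4 ^ n)" by linarith
          then show ?thesis
            using d(7,8) p(1) p(3)[of n] True ok nw g by (auto simp: relabel_prog_def)
        qed
      next
        case n12: False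
        have nw: "next_word n ?d i j = Some ?J"
          using n11 n22 n12 by (auto simp: next_word_def)
        have "\<not> bval (BAnd (equal (var ''di'') (IConst 1)) (equal (var ''dj'') (IConst 1))) \<sigma>"
          "\<not> bval (BAnd (equal (var ''di'') (IConst 2)) (equal (var ''dj'') (IConst 2))) \<sigma>"
          "\<not> bval (BAnd (equal (var ''di'') (IConst 1)) (equal (var ''dj'') (IConst 2))) \<sigma>"
          using n11 n22 n12 d(7,8) by auto
        moreover have "?Q \<sigma>" using ok nw g by simp
        ultimately show ?thesis
          unfolding relabel_prog_def wp.simps bval.simps(4) by blast
      qed
    qed
  qed
  then show ?thesis by (rule runs_wp)
qed

lemma runs_update:
  assumes \<sigma>: "decoded u i j \<sigma>" and u: "u < sink_vertex"
    and ok: "words \<sigma> ''ok'' 0 = (if admissible (digit (u div (n + 1))) i j \<and> u mod (n + 1) < j then 1 else 0)"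
    and r: "scan 1 2 (digit (u div (n + 1))) 0 [Suc j..<n] = (if words \<sigma> ''r'' 0 < n then Some (words \<sigma> ''r'' 0) else None)"
    and l: "scan 2 1 (digit (u div (n + 1))) 0 (rev [0..<i]) = (if words \<sigma> ''l'' 0 < n then Some (words \<sigma> ''l'' 0) else None)"
  shows "runs w update_prog \<sigma> (cost_bound update_prog)
    (\<lambda>\<tau>. agree {''a'', ''b'', ''g'', ''ok''} \<sigma> \<tau> \<and> decoded u i j \<tau> \<and>
      (case transition u i j of None \<Rightarrow> words \<tau> ''ok'' 0 = 0
       | Some d \<Rightarrow> words \<tau> ''ok'' 0 = 1 \<and> words \<tau> ''g'' 0 = code n d))"
proof -
  let ?d = "digit (u div (n + 1))" and ?A = "{''a'', ''b'', ''g'', ''ok''}"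
  let ?Q = "\<lambda>\<tau>. agree ?A \<sigma> \<tau> \<and>
      (case transition u i j of None \<Rightarrow> words \<tau> ''ok'' 0 = 0
       | Some d \<Rightarrow> words \<tau> ''ok'' 0 = 1 \<and> words \<tau> ''g'' 0 = code n d)"
  have "runs w update_prog \<sigma> (cost_bound update_prog) ?Q"
  proof (cases "admissible ?d i j \<and> u mod (n + 1) < j")
    case False
    then have tr: "transition u i j = None" by (simp only: transition_def if_False)
    have "words \<sigma> ''ok'' 0 = 0" using False ok by (simp only: if_False)
    then show ?thesis unfolding update_prog_def tr by (intro runs_wp) simp
  next
    case True
    then have tr: "transition u i j = next_word n ?d i j" by (simp add: transition_def)
    have ok1: "words \<sigma> ''ok'' 0 = 1" using True ok by simp
    have ij: "i < j" "j < n" using True by (auto simp: admissible_def)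
    have "?d i < 4" "?d j < 4" by (rule digit_less)+
    moreover have "?d i \<noteq> 3" "?d j \<noteq> 3" using True by (auto simp: admissible_def)
    ultimately have le2: "?d i \<le> 2" "?d j \<le> 2" by linarith+
    have "runs w (Seq letters_prog (Seq join_prog relabel_prog)) \<sigma>
      (cost_bound letters_prog + (cost_bound join_prog + cost_bound relabel_prog)) ?Q"
    proof (rule runs_Seq[OF runs_letters[OF \<sigma>]])
      fix \<tau>1
      assume 1: "agree {''a'', ''b''} \<sigma> \<tau>1 \<and> joined ?d i j = ?d(i := words \<tau>1 ''a'' 0, j := words \<tau>1 ''b'' 0)"
      then have dec1: "decoded u i j \<tau>1" using decoded_agree[of "{''a'', ''b''}" \<sigma> \<tau>1] \<sigma> by simp
      show "runs w (Seq join_prog relabel_prog) \<tau>1 (cost_bound join_prog + cost_bound relabel_prog) ?Q"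
      proof (rule runs_Seq[OF runs_join[OF dec1 ij u conjunct2[OF 1]]])
        fix \<tau>2
        assume 2: "agree {''g''} \<tau>1 \<tau>2 \<and> words \<tau>2 ''g'' 0 = code n (joined ?d i j)"
        then have dec2: "decoded u i j \<tau>2" using decoded_agree[of "{''g''}" \<tau>1 \<tau>2] dec1 by simp
        have same: "words \<tau>2 ''ok'' = words \<sigma> ''ok''" "words \<tau>2 ''r'' = words \<sigma> ''r''" "words \<tau>2 ''l'' = words \<sigma> ''l''"
          using 1 2 by (simp_all add: agree_def)
        have a2: "agree {''a'', ''b'', ''g''} \<sigma> \<tau>2"
          using 1 2 by (simp add: agree_def)
        have "runs w relabel_prog \<tau>2 (cost_bound relabel_prog)
          (\<lambda>\<tau>. agree {''g'', ''ok''} \<tau>2 \<tau> \<and>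
            (case next_word n ?d i j of None \<Rightarrow> words \<tau> ''ok'' 0 = 0
             | Some d \<Rightarrow> words \<tau> ''ok'' 0 = 1 \<and> words \<tau> ''g'' 0 = code n d))"
          by (rule runs_relabel[OF dec2 ij u le2 conjunct2[OF 2]]) (simp_all only: same ok1 r l)
        then show "runs w relabel_prog \<tau>2 (cost_bound relabel_prog) ?Q"
        proof (rule runs_mono)
          fix \<tau> assume t: "agree {''g'', ''ok''} \<tau>2 \<tau> \<and>
            (case next_word n ?d i j of None \<Rightarrow> words \<tau> ''ok'' 0 = 0
             | Some d \<Rightarrow> words \<tau> ''ok'' 0 = 1 \<and> words \<tau> ''g'' 0 = code n d)"
          have "agree ?A \<sigma> \<tau>" using a2 conjunct1[OF t] by (simp add: agree_def)
          then show "?Q \<tau>" using t tr by simp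
        qed simp
      qed
    qed
    then obtain k \<tau> where k: "exec w (Seq letters_prog (Seq join_prog relabel_prog)) \<sigma> k \<tau>"
      "k \<le> cost_bound letters_prog + (cost_bound join_prog + cost_bound relabel_prog)" "?Q \<tau>"
      unfolding runs_def by blast
    have "bval (ILess (IConst 0) (var ''ok'')) \<sigma>" using ok1 by simp
    from exec.CondTrue[OF this k(1), of Skip] show ?thesis
      unfolding runs_def update_prog_def using k(2,3) by (intro exI conjI) auto
  qed
  then show ?thesis
  proof (rule runs_mono)
    fix \<tau> assume Q: "?Q \<tau>"
    then have "decoded u i j \<tau>" using decoded_agree[of ?A \<sigma> \<tau>] \<sigma> by simp
    with Q show "agree ?A \<sigma> \<tau> \<and> decoded u i j \<tau> \<and>
      (case transition u i j of None \<Rightarrow> words \<tau> ''ok'' 0 = 0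
       | Some d \<Rightarrow> words \<tau> ''ok'' 0 = 1 \<and> words \<tau> ''g'' 0 = code n d)" by blast
  qed simp
qed

definition emitted :: "nat \<Rightarrow> nat \<Rightarrow> nat \<Rightarrow> state \<Rightarrow> bool" where
  "emitted u i j \<sigma> \<longleftrightarrow>
     words \<sigma> ''tail'' (arc_number u i j) = arc_tail u i j \<and> words \<sigma> ''head'' (arc_number u i j) = arc_head u i j \<and>
     (transition u i j \<noteq> None \<longrightarrow>
        words \<sigma> ''p'' (arc_number u i j) = ord i \<and> words \<sigma> ''q'' (arc_number u i j) = ord j)"

text \<open>All arcs share the same output arrays, while \<open>agree\<close> speaks of whole arrays
  only. The last clause therefore keeps the entries of the other arcs.\<close>

lemma runs_emit:
  assumes \<sigma>: "decoded u i j \<sigma>" and u: "u < sink_vertex" "i \<le> n" "j \<le> n"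
    and ok: "case transition u i j of None \<Rightarrow> words \<sigma> ''ok'' 0 = 0
      | Some d \<Rightarrow> words \<sigma> ''ok'' 0 = 1 \<and> words \<sigma> ''g'' 0 = code n d"
  shows "runs w emit_prog \<sigma> (cost_bound emit_prog)
    (\<lambda>\<tau>. agree {''tail'', ''head'', ''p'', ''q'', ''e''} \<sigma> \<tau> \<and> words \<tau> ''e'' 0 = arc_number u i j + 1 \<and>
      emitted u i j \<tau> \<and>
      (\<forall>x. x \<noteq> arc_number u i j \<longrightarrow> (\<forall>a\<in>{''tail'', ''head'', ''p'', ''q''}. words \<tau> a x = words \<sigma> a x)))"
proof -
  note d = decoded_words[OF \<sigma>]
  note p = prepared_words[OF d(1)]
  have b: "arc_number u i j < 2 ^ w" "arc_number u i j + 1 < 2 ^ w" "sink_vertex + 1 < 2 ^ w" "u < 2 ^ w"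
    using arc_number_less[OF u] big bounds(4) u(1) by linarith+
  show ?thesis
  proof (cases "transition u i j")
    case None
    then have "words \<sigma> ''ok'' 0 = 0" using ok by simp
    then show ?thesis
      using None p(3)[of n] b
      by (intro runs_wp) (simp add: emit_prog_def d p(1,4,5) emitted_def arc_tail_def arc_head_def; auto)
  next
    case (Some e)
    note tr = transition_SomeD[OF Some u(1)]
    have ok': "words \<sigma> ''ok'' 0 = 1" "words \<sigma> ''g'' 0 = code n e" using ok Some by auto
    have o: "words \<sigma> ''o'' i = ord i" "words \<sigma> ''o'' j = ord j" "ord i < 2 ^ w" "ord j < 2 ^ w"
      using p(2) tr(1,2) ord_less[of i] ord_less[of j] bounds(5) by auto
    have h: "arc_head u i j = code n e * (n + 1) + i" using Some by (simp add: arc_head_def)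
    have "code n e * (n + 1) + i < 2 ^ w" using tr(4) bounds(4) by linarith
    then show ?thesis
      using Some b ok' o
      by (intro runs_wp) (simp add: emit_prog_def d p(1,4,5) emitted_def arc_tail_def h)
  qed
qed

lemma arc_number_eq_iff:
  assumes "i \<le> n" "j \<le> n" "i' \<le> n" "j' \<le> n"
  shows "arc_number u i j = arc_number u' i' j' \<longleftrightarrow> u = u' \<and> i = i' \<and> j = j'"
  using arc_number_decode[OF assms(1,2), of u] arc_number_decode[OF assms(3,4), of u'] by metis

definition arcs_done :: "nat \<Rightarrow> state \<Rightarrow> bool" where
  "arcs_done x \<sigma> \<longleftrightarrow> (\<forall>u<sink_vertex. \<forall>i\<le>n. \<forall>j\<le>n. arc_number u i j < x \<longrightarrow> emitted u i j \<sigma>)"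

lemma arcs_done_Suc:
  assumes "arcs_done (arc_number u i j) \<sigma>" "emitted u i j \<tau>" "i \<le> n" "j \<le> n"
    and same: "\<forall>x. x \<noteq> arc_number u i j \<longrightarrow> (\<forall>a\<in>{''tail'', ''head'', ''p'', ''q''}. words \<tau> a x = words \<sigma> a x)"
  shows "arcs_done (arc_number u i j + 1) \<tau>"
  unfolding arcs_done_def
proof (intro allI impI)
  fix u' i' j' assume a: "u' < sink_vertex" "i' \<le> n" "j' \<le> n" "arc_number u' i' j' < arc_number u i j + 1"
  show "emitted u' i' j' \<tau>"
  proof (cases "arc_number u' i' j' = arc_number u i j")
    case True
    then show ?thesis using arc_number_eq_iff a(2,3) assms(2-4) by metis
  next
    case False
    then have "emitted u' i' j' \<sigma>" using assms(1) a by (simp add: arcs_done_def)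
    then show ?thesis using same False by (simp add: emitted_def)
  qed
qed

definition arc_cost :: nat where
  "arc_cost = cost_bound decode_prog + (check_cost + (right_cost + (left_cost +
     (cost_bound update_prog + cost_bound emit_prog))))"

lemma agree_outside:
  assumes "agree A \<sigma> \<tau>" "a \<in> B" "A \<inter> B = {}"
  shows "words \<tau> a = words \<sigma> a"
  using agree_words[OF assms(1)] assms(2,3) by blast

lemma runs_arc:
  assumes \<sigma>: "prepared \<sigma>" "words \<sigma> ''e'' 0 = x" "x < 4 ^ n * (n + 1) ^ 3" "arcs_done x \<sigma>"
  shows "runs w arc_prog \<sigma> arc_cost (\<lambda>\<tau>. prepared \<tau> \<and> words \<tau> ''e'' 0 = x + 1 \<and> arcs_done (x + 1) \<tau>)"
proof -
  obtain u i j where x: "x = arc_number u i j" and u: "u < sink_vertex" "i \<le> n" "j \<le> n"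
    using arc_number_cases[OF \<sigma>(3)] by metis
  let ?d = "digit (u div (n + 1))"
  have e: "words \<sigma> ''e'' 0 = arc_number u i j" using \<sigma>(2) x by simp
  let ?out = "{''tail'', ''head'', ''p'', ''q''}"
  show ?thesis
    unfolding arc_prog_def arc_cost_def
  proof (rule runs_Seq[OF runs_decode[OF \<sigma>(1) e u]], elim conjE)
    fix \<tau>1
    assume 1: "agree {''u'', ''i'', ''j'', ''c'', ''di'', ''dj'', ''ok'', ''k''} \<sigma> \<tau>1" "decoded u i j \<tau>1"
      "words \<tau>1 ''k'' 0 = i + 1" "words \<tau>1 ''ok'' 0 = (if entry u i j then 1 else 0)"
    have o1: "words \<tau>1 a = words \<sigma> a" if "a \<in> ?out" for a
      using agree_outside[OF 1(1) that] by simp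
    show "runs w (Seq check_prog (Seq right_prog (Seq left_prog (Seq update_prog emit_prog)))) \<tau>1
      (check_cost + (right_cost + (left_cost + (cost_bound update_prog + cost_bound emit_prog))))
      (\<lambda>\<tau>. prepared \<tau> \<and> words \<tau> ''e'' 0 = x + 1 \<and> arcs_done (x + 1) \<tau>)"
    proof (rule runs_Seq[OF runs_check[OF 1(2-4) u(2,3)]], elim conjE)
      fix \<tau>2
      assume 2: "agree {''k'', ''ok''} \<tau>1 \<tau>2" "decoded u i j \<tau>2"
        "words \<tau>2 ''ok'' 0 = (if admissible ?d i j \<and> u mod (n + 1) < j then 1 else 0)"
      have o2: "words \<tau>2 a = words \<sigma> a" if "a \<in> ?out" for a
        using agree_outside[OF 2(1) that] o1[OF that] by simp
      show "runs w (Seq right_prog (Seq left_prog (Seq update_prog emit_prog))) \<tau>2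
        (right_cost + (left_cost + (cost_bound update_prog + cost_bound emit_prog)))
        (\<lambda>\<tau>. prepared \<tau> \<and> words \<tau> ''e'' 0 = x + 1 \<and> arcs_done (x + 1) \<tau>)"
      proof (rule runs_Seq[OF runs_right[OF 2(2) u(3)]], elim conjE)
        fix \<tau>3
        assume 3: "agree {''r'', ''h'', ''k''} \<tau>2 \<tau>3" "decoded u i j \<tau>3"
          "scan 1 2 ?d 0 [Suc j..<n] = (if words \<tau>3 ''r'' 0 < n then Some (words \<tau>3 ''r'' 0) else None)"
        have o3: "words \<tau>3 a = words \<sigma> a" if "a \<in> ?out" for a
          using agree_outside[OF 3(1) that] o2[OF that] by simp
        have ok3: "words \<tau>3 ''ok'' = words \<tau>2 ''ok''" using 3(1) by (simp add: agree_def)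
        show "runs w (Seq left_prog (Seq update_prog emit_prog)) \<tau>3
          (left_cost + (cost_bound update_prog + cost_bound emit_prog))
          (\<lambda>\<tau>. prepared \<tau> \<and> words \<tau> ''e'' 0 = x + 1 \<and> arcs_done (x + 1) \<tau>)"
        proof (rule runs_Seq[OF runs_left[OF 3(2) u(2)]], elim conjE)
          fix \<tau>4
          assume 4: "agree {''l'', ''h'', ''k''} \<tau>3 \<tau>4" "decoded u i j \<tau>4"
            "scan 2 1 ?d 0 (rev [0..<i]) = (if words \<tau>4 ''l'' 0 < n then Some (words \<tau>4 ''l'' 0) else None)"
          have o4: "words \<tau>4 a = words \<sigma> a" if "a \<in> ?out" for a
            using agree_outside[OF 4(1) that] o3[OF that] by simp
          have same4: "words \<tau>4 ''ok'' = words \<tau>2 ''ok''" "words \<tau>4 ''r'' = words \<tau>3 ''r''"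
            using 4(1) ok3 by (simp_all add: agree_def)
          have up: "runs w update_prog \<tau>4 (cost_bound update_prog)
            (\<lambda>\<tau>. agree {''a'', ''b'', ''g'', ''ok''} \<tau>4 \<tau> \<and> decoded u i j \<tau> \<and>
              (case transition u i j of None \<Rightarrow> words \<tau> ''ok'' 0 = 0
               | Some d \<Rightarrow> words \<tau> ''ok'' 0 = 1 \<and> words \<tau> ''g'' 0 = code n d))"
            by (rule runs_update[OF 4(2) u(1) _ _ 4(3)]) (simp_all only: same4 2(3) 3(3))
          show "runs w (Seq update_prog emit_prog) \<tau>4 (cost_bound update_prog + cost_bound emit_prog)
            (\<lambda>\<tau>. prepared \<tau> \<and> words \<tau> ''e'' 0 = x + 1 \<and> arcs_done (x + 1) \<tau>)"
          proof (rule runs_Seq[OF up], elim conjE)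
            fix \<tau>5
            assume 5: "agree {''a'', ''b'', ''g'', ''ok''} \<tau>4 \<tau>5" "decoded u i j \<tau>5"
              "case transition u i j of None \<Rightarrow> words \<tau>5 ''ok'' 0 = 0
               | Some d \<Rightarrow> words \<tau>5 ''ok'' 0 = 1 \<and> words \<tau>5 ''g'' 0 = code n d"
            have o5: "words \<tau>5 a = words \<sigma> a" if "a \<in> ?out" for a
              using agree_outside[OF 5(1) that] o4[OF that] by simp
            show "runs w emit_prog \<tau>5 (cost_bound emit_prog)
              (\<lambda>\<tau>. prepared \<tau> \<and> words \<tau> ''e'' 0 = x + 1 \<and> arcs_done (x + 1) \<tau>)"
            proof (rule runs_mono[OF runs_emit[OF 5(2) u 5(3)]], simp, elim conjE)
              fix \<tau>
              assume 6: "agree {''tail'', ''head'', ''p'', ''q'', ''e''} \<tau>5 \<tau>" "words \<tau> ''e'' 0 = arc_number u i j + 1"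
                "emitted u i j \<tau>"
                "\<forall>x. x \<noteq> arc_number u i j \<longrightarrow> (\<forall>a\<in>?out. words \<tau> a x = words \<tau>5 a x)"
              have "prepared \<tau>"
                using prepared_agree[OF 6(1)] decoded_words(1)[OF 5(2)] by simp
              moreover have "arcs_done (arc_number u i j + 1) \<tau>"
                by (rule arcs_done_Suc[OF \<sigma>(4)[unfolded x] 6(3) u(2,3)]) (use 6(4) o5 in auto)
              ultimately show "prepared \<tau> \<and> words \<tau> ''e'' 0 = x + 1 \<and> arcs_done (x + 1) \<tau>"
                using 6(2) by (simp only: x simp_thms)
            qed
          qed
        qed
      qed
    qed
  qed
qed

end

section \<open>The running time\<close>

context ranked_points_machine
begin

definition arcs_cost :: nat where
  "arcs_cost = while_cost (4 ^ n * (n + 1) ^ 3) (var_less ''e'' ''arcs'') arc_cost"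

lemma runs_arcs:
  assumes "prepared \<sigma>" "words \<sigma> ''e'' 0 = 0"
  shows "runs w arcs_prog \<sigma> arcs_cost (\<lambda>\<tau>. prepared \<tau> \<and> arcs_done (4 ^ n * (n + 1) ^ 3) \<tau>)"
proof -
  let ?A = "4 ^ n * (n + 1) ^ 3"
  let ?I = "\<lambda>x \<tau>. prepared \<tau> \<and> words \<tau> ''e'' 0 = x \<and> arcs_done x \<tau>"
  have arcs: "words \<tau> ''arcs'' 0 = ?A" if "prepared \<tau>" for \<tau>
    using that by (simp add: prepared_def)
  have "runs w arcs_prog \<sigma> arcs_cost (?I ?A)"
    unfolding arcs_prog_def arcs_cost_def
  proof (rule runs_While[where I = ?I])
    show "?I 0 \<sigma>" using assms by (simp add: arcs_done_def)
    show "\<not> bval (var_less ''e'' ''arcs'') \<tau>" if "?I ?A \<tau>" for \<tau>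
      using that arcs by simp
    fix x \<tau> assume "x < ?A" "?I x \<tau>"
    then show "bval (var_less ''e'' ''arcs'') \<tau> \<and> runs w arc_prog \<tau> arc_cost (?I (Suc x))"
      using arcs runs_arc[of \<tau> x] by simp
  qed
  then show ?thesis by (rule runs_mono) auto
qed

definition total_cost :: nat where
  "total_cost = rank_cost + (power_cost + (cost_bound size_prog + arcs_cost))"

lemma runs_cycle:
  "runs w cycle_prog (input_state ps) total_cost (\<lambda>\<tau>. prepared \<tau> \<and> arcs_done (4 ^ n * (n + 1) ^ 3) \<tau>)"
  unfolding cycle_prog_def total_cost_def
proof (rule runs_Seq[OF runs_rank], elim conjE)
  let ?s = "input_state ps"
  fix \<tau>1 assume 1: "agree {''r'', ''b'', ''o'', ''a''} ?s \<tau>1" "\<forall>k<n. words \<tau>1 ''o'' k = ord k"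
  have 0: "words \<tau>1 ''k'' 0 = 0" "words \<tau>1 ''n'' 0 = n" "words \<tau>1 ''e'' 0 = 0" "words \<tau>1 ''source'' 0 = 0"
    "input_reals \<tau>1"
    using 1(1) by (simp_all add: agree_def input_state_def n_def input_reals_def)
  show "runs w (Seq power_prog (Seq size_prog arcs_prog)) \<tau>1 (power_cost + (cost_bound size_prog + arcs_cost))
    (\<lambda>\<tau>. prepared \<tau> \<and> arcs_done (4 ^ n * (n + 1) ^ 3) \<tau>)"
  proof (rule runs_Seq[OF runs_power[OF 0(1,2)]], elim conjE)
    fix \<tau>2 assume 2: "agree {''w'', ''k''} \<tau>1 \<tau>2" "\<forall>k\<le>n. words \<tau>2 ''w'' k = 4 ^ k"
    have 3: "words \<tau>2 ''n'' 0 = n" "words \<tau>2 ''source'' 0 = 0" "input_reals \<tau>2"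
      "\<forall>k<n. words \<tau>2 ''o'' k = ord k" "words \<tau>2 ''e'' 0 = 0"
      using 2(1) 0 1(2) by (simp_all add: agree_def input_reals_def)
    show "runs w (Seq size_prog arcs_prog) \<tau>2 (cost_bound size_prog + arcs_cost)
      (\<lambda>\<tau>. prepared \<tau> \<and> arcs_done (4 ^ n * (n + 1) ^ 3) \<tau>)"
    proof (rule runs_Seq[OF runs_size[OF 3(3,1,4) 2(2) 3(2)]], elim conjE)
      fix \<tau>3 assume 4: "agree {''N'', ''sink'', ''verts'', ''arcs''} \<tau>2 \<tau>3" "prepared \<tau>3"
      have "words \<tau>3 ''e'' 0 = 0" using 4(1) 3(5) by (simp add: agree_def)
      with 4(2) show "runs w arcs_prog \<tau>3 arcs_cost (\<lambda>\<tau>. prepared \<tau> \<and> arcs_done (4 ^ n * (n + 1) ^ 3) \<tau>)"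
        by (rule runs_arcs)
    qed
  qed
qed

text \<open>The output format marks unlabelled arcs by their head, so it matters that transitions
  lead to vertices below the sink.\<close>

lemma output_represents_transitions:
  assumes "prepared \<tau>" "arcs_done (4 ^ n * (n + 1) ^ 3) \<tau>"
  shows "represents_transitions (output_graph ps \<tau>)"
  unfolding represents_transitions_def
proof (intro conjI allI impI)
  fix u i j assume u: "u < sink_vertex" "i \<le> n" "j \<le> n"
  have em: "emitted u i j \<tau>"
    using assms(2) u arc_number_less[OF u] by (simp add: arcs_done_def)
  have s: "words \<tau> ''sink'' 0 = sink_vertex" using assms(1) by (simp add: prepared_def)
  show "tail (multigraph (output_graph ps \<tau>)) (arc_number u i j) = arc_tail u i j"
    "head (multigraph (output_graph ps \<tau>)) (arc_number u i j) = arc_head u i j"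
    using em by (simp_all add: output_graph_def emitted_def)
  show "label (output_graph ps \<tau>) (arc_number u i j) = (if transition u i j = None then None else Some (seg (i, j)))"
  proof (cases "transition u i j")
    case None
    then show ?thesis using em s by (simp add: output_graph_def emitted_def arc_head_def)
  next
    case (Some d)
    then have "arc_head u i j \<noteq> sink_vertex" using arc_head_less[OF u(1) Some] by simp
    then show ?thesis using em s Some by (simp add: output_graph_def emitted_def seg_def v_def)
  qed
qed (use assms(1) in \<open>simp_all add: output_graph_def prepared_def\<close>)

end

text \<open>The summand 10 accounts for the guards of the loops.\<close>
definition step_cost :: nat where
  "step_cost = cost_bound count_init + cost_bound count_body + cost_bound store_rank
     + cost_bound power_init + cost_bound power_body + cost_bound size_prog + cost_bound decode_prog
     + cost_bound check_body + cost_bound right_init + cost_bound right_body + cost_bound left_init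
     + cost_bound left_body + cost_bound update_prog + cost_bound emit_prog + 10"

context ranked_points_machine
begin

text \<open>\<open>step_cost\<close> depends on the program alone and is never evaluated. One arc
  costs a multiple of \<open>M * m\<close> and sorting a multiple of \<open>M * m * m\<close>, so
  the \<open>4 ^ n * (n + 1) ^ 3\<close> arcs dominate.\<close>

lemma total_cost_le: "total_cost \<le> 100 * step_cost * (4 ^ n * (n + 1) ^ 4)"
proof -
  define M where "M = step_cost"
  define m where "m = n + 1"
  have M: "10 \<le> M" "cost_bound count_init \<le> M" "cost_bound count_body \<le> M" "cost_bound store_rank \<le> M"
    "cost_bound power_init \<le> M" "cost_bound power_body \<le> M" "cost_bound size_prog \<le> M"
    "cost_bound decode_prog \<le> M" "cost_bound check_body \<le> M" "cost_bound right_init \<le> M"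
    "cost_bound right_body \<le> M" "cost_bound left_init \<le> M" "cost_bound left_body \<le> M"
    "cost_bound update_prog \<le> M" "cost_bound emit_prog \<le> M"
    by (simp_all add: M_def step_cost_def)
  have b: "bcost (ILess (var a) (var c)) \<le> M" "bcost (ILess (IConst 0) (var c)) \<le> M" for a c
    using M(1) by simp_all
  have nm: "n \<le> m" "1 \<le> m" by (simp_all add: m_def)
  have Mm: "M \<le> M * m" using nm by simp
  have loop: "while_cost n b K \<le> n * x + 2 * M" if "bcost b \<le> M" "bcost b + K + 1 \<le> x" for b K x
  proof -
    have "n * (bcost b + K + 1) \<le> n * x" using that(2) by (rule mult_le_mono2)
    then show ?thesis using that(1) M(1) unfolding while_cost_def by linarith
  qed
  have loop': "while_cost n b K \<le> 5 * M * m" if "bcost b \<le> M" "K \<le> M" for b K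
  proof -
    have "while_cost n b K \<le> n * (3 * M) + 2 * M" using that M(1) by (intro loop) linarith+
    moreover have "n * (3 * M) \<le> m * (3 * M)" using nm(1) by (rule mult_le_mono1)
    moreover have "m * (3 * M) = 3 * (M * m)" by simp
    ultimately show ?thesis using Mm unfolding mult.assoc[of 5] by linarith
  qed
  have count: "count_cost \<le> 6 * M * m"
    unfolding count_cost_def using loop'[OF b(1)[of "''b''" "''n''"] M(3)] M(2) Mm by linarith
  have power: "power_cost \<le> 6 * M * m"
    unfolding power_cost_def using loop'[OF b(1)[of "''k''" "''n''"] M(6)] M(5) Mm by linarith
  have check: "check_cost \<le> 5 * M * m"
    unfolding check_cost_def by (rule loop'[OF b(1) M(9)])
  have right: "right_cost \<le> 6 * M * m"
    unfolding right_cost_def using loop'[OF b(1)[of "''k''" "''n''"] M(11)] M(10) Mm by linarith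
  have left: "left_cost \<le> 6 * M * m"
    unfolding left_cost_def using loop'[OF b(2)[of "''k''"] M(13)] M(12) Mm by linarith
  have arc: "arc_cost \<le> 28 * M * m"
    using check right left M(8,14,15) Mm unfolding arc_cost_def by linarith
  have rank: "rank_cost \<le> 11 * M * m * m"
  proof -
    have "bcost (var_less ''a'' ''n'') + (count_cost + cost_bound store_rank) + 1 \<le> 9 * M * m"
      using count M(1,4) b(1)[of "''a''" "''n''"] Mm by linarith
    then have "rank_cost \<le> n * (9 * M * m) + 2 * M"
      unfolding rank_cost_def by (rule loop[OF b(1)])
    moreover have "n * (9 * M * m) \<le> m * (9 * M * m)" using nm(1) by (rule mult_le_mono1)
    moreover have "2 * M * m \<le> 2 * M * m * m" using nm by simp
    moreover have "m * (9 * M * m) = 9 * M * m * m" by simp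
    ultimately show ?thesis using Mm by linarith
  qed
  define Z where "Z = 4 ^ n * m ^ 4"
  have Z: "4 ^ n * (n + 1) ^ 3 * m = Z"
    by (simp only: Z_def m_def power4_eq_xxxx power3_eq_cube mult.assoc)
  have "m * m \<le> Z"
  proof -
    have "1 * m ^ 2 \<le> 4 ^ n * m ^ 4"
      using nm by (intro mult_le_mono power_increasing) auto
    then show ?thesis by (simp add: Z_def power2_eq_square)
  qed
  then have Zm: "M * m * m \<le> M * Z" "M * m \<le> M * Z" "M \<le> M * Z"
  proof -
    assume mm: "m * m \<le> Z"
    then have "m \<le> Z" "1 \<le> Z" using nm by (meson le_trans mult_le_mono nat_mult_1 le_square)+
    then show "M * m * m \<le> M * Z" "M * m \<le> M * Z" "M \<le> M * Z" using mm by (simp_all add: mult.assoc)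
  qed
  have "bcost (var_less ''e'' ''arcs'') + arc_cost + 1 \<le> 30 * M * m"
    using arc M(1) b(1)[of "''e''" "''arcs''"] Mm by linarith
  then have "4 ^ n * (n + 1) ^ 3 * (bcost (var_less ''e'' ''arcs'') + arc_cost + 1)
      \<le> 4 ^ n * (n + 1) ^ 3 * (30 * M * m)"
    by (rule mult_le_mono2)
  also have "\<dots> = 30 * M * (4 ^ n * (n + 1) ^ 3 * m)" by (simp only: ac_simps)
  also have "\<dots> = 30 * M * Z" by (simp only: Z)
  finally have "arcs_cost \<le> 30 * M * Z + 2 * M"
    using M(1) b(1)[of "''e''" "''arcs''"] unfolding arcs_cost_def while_cost_def by linarith
  then have "total_cost \<le> 11 * (M * m * m) + (6 * (M * m) + (M + (30 * (M * Z) + 2 * M)))"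
    using rank power M(7) unfolding total_cost_def by (simp only: mult.assoc)
  \<comment> \<open>The coefficients sum to 11 + 6 + 1 + 30 + 2 = 50.\<close>
  also have "\<dots> \<le> 100 * (M * Z)" using Zm by linarith
  finally show ?thesis by (simp add: M_def Z_def m_def mult.assoc)
qed

lemma cycle_prog_correct:
  "\<exists>\<Gamma> k. combination_graph (set ps) \<Gamma> \<and> represents \<Gamma> (crossing_free_spanning_cycles (set ps)) \<and>
     graph_size \<Gamma> = 4 ^ n * (n + 1) + 2 + 4 ^ n * (n + 1) ^ 3 \<and>
     constructs w cycle_prog ps k \<Gamma> \<and> k \<le> 100 * step_cost * (4 ^ n * (n + 1) ^ 4)"
proof -
  obtain k \<tau> where k: "exec w cycle_prog (input_state ps) k \<tau>" "k \<le> total_cost"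
    and \<tau>: "prepared \<tau>" "arcs_done (4 ^ n * (n + 1) ^ 3) \<tau>"
    using runs_cycle unfolding runs_def by blast
  note rep = output_represents_transitions[OF \<tau>]
  have "constructs w cycle_prog ps k (output_graph ps \<tau>)"
    using k(1) by (auto simp: constructs_def)
  moreover have "k \<le> 100 * step_cost * (4 ^ n * (n + 1) ^ 4)"
    using k(2) total_cost_le by linarith
  ultimately show ?thesis
    using combination_graph_transitions[OF rep] represents_cycles[OF rep] graph_size_transitions[OF rep]
    unfolding v_image by blast
qed

end

section \<open>Word length and asymptotic bounds\<close>

lemma Suc_power_le: "1 \<le> n \<Longrightarrow> (real n + 1) ^ k \<le> 2 ^ k * real n ^ k"
  unfolding power_mult_distrib[symmetric] by (intro power_mono) auto

text \<open>The summand \<open>5 * n\<close> comes from \<open>4 ^ n = 2 ^ (2 * n)\<close> and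
  \<open>(n + 1) ^ 3 \<le> 2 ^ (3 * n)\<close>; the summand 10 absorbs the additive 4.\<close>

lemma word_length_suffices: "4 ^ n * (n + 1) ^ 3 + 4 < (2 :: nat) ^ (5 * n + 10)"
proof -
  have "n + 1 \<le> 2 ^ n" by (simp add: Suc_leI)
  then have "(n + 1) ^ 3 \<le> (2 ^ n) ^ 3" by (rule power_mono) simp
  then have "4 ^ n * (n + 1) ^ 3 \<le> 4 ^ n * (2 ^ n) ^ 3" by simp
  also have "\<dots> = 2 ^ (5 * n)"
  proof -
    have "(4 :: nat) ^ n = 2 ^ (2 * n)" by (simp add: power_mult)
    then show ?thesis by (simp add: power_mult[symmetric] power_add[symmetric])
  qed
  finally have "4 ^ n * (n + 1) ^ 3 + 4 \<le> 2 ^ (5 * n) + 4" by simp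
  also have "\<dots> < 2 ^ (5 * n) * 1024"
    using one_le_power[of "2 :: nat" "5 * n"] by linarith
  also have "\<dots> = 2 ^ (5 * n + 10)" by (simp add: power_add)
  finally show ?thesis .
qed

theorem theorem18:
  shows "\<exists>(prog :: com) (size_bound :: nat \<Rightarrow> real) (time_bound :: nat \<Rightarrow> real) (word_length :: nat \<Rightarrow> nat).
    size_bound \<in> O(\<lambda>n. 4 ^ n * real n ^ 3) \<and>
    time_bound \<in> O(\<lambda>n. 4 ^ n * real n ^ 4) \<and>
    (\<lambda>n. real (word_length n)) \<in> O(\<lambda>n. real n) \<and>
    (\<forall>(P :: point set) (n :: nat) (ps :: point list).
       general_position P \<and> finite P \<and> card P = n \<and> distinct ps \<and> set ps = P \<longrightarrow>
       (\<exists>(\<Gamma> :: (nat, nat) comb_graph) (k :: nat).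
          combination_graph P \<Gamma> \<and>
          represents \<Gamma> (crossing_free_spanning_cycles P) \<and>
          real (graph_size \<Gamma>) \<le> size_bound n \<and>
          constructs (word_length n) prog ps k \<Gamma> \<and>
          real k \<le> time_bound n))"
proof (intro exI conjI)
  let ?size = "\<lambda>n. real (4 ^ n * (n + 1) + 2 + 4 ^ n * (n + 1) ^ 3)"
  let ?time = "\<lambda>n. real (100 * step_cost * (4 ^ n * (n + 1) ^ 4))"
  \<comment> \<open>The constant is 2 + 2 + 8: for positive n, \<open>n + 1 \<le> 2 * n ^ 3\<close>,
    the summand 2 is at most twice the bound, and
    \<open>(n + 1) ^ 3 \<le> 8 * n ^ 3\<close>.\<close>
  show "?size \<in> O(\<lambda>n. 4 ^ n * real n ^ 3)"
  proof (rule bigoI[of _ 12], rule eventually_sequentiallyI[of 1])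
    fix n :: nat assume n: "1 \<le> n"
    have pow: "(1 :: real) \<le> 4 ^ n" "(1 :: real) \<le> real n ^ 3" using n by simp_all
    have "real n \<le> real n ^ 3" using n power_increasing[of 1 3 "real n"] by simp
    then have "real n + 1 \<le> 2 * real n ^ 3" using pow(2) by linarith
    then have 1: "4 ^ n * (real n + 1) \<le> 4 ^ n * (2 * real n ^ 3)"
      by (rule mult_left_mono) simp
    have 2: "(4 :: real) ^ n * (real n + 1) ^ 3 \<le> 4 ^ n * (8 * real n ^ 3)"
      using Suc_power_le[OF n, of 3] by (intro mult_left_mono) auto
    have 3: "2 \<le> 2 * (4 ^ n * real n ^ 3)"
      using mult_mono[OF pow] by simp
    have "?size n = 4 ^ n * (real n + 1) + 2 + 4 ^ n * (real n + 1) ^ 3" by (simp add: algebra_simps)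
    also have "\<dots> \<le> 12 * (4 ^ n * real n ^ 3)" using 1 2 3 by linarith
    finally show "norm (?size n) \<le> 12 * norm (4 ^ n * real n ^ 3)" by simp
  qed
  \<comment> \<open>The factor 16 comes from \<open>n + 1 \<le> 2 * n\<close>.\<close>
  show "?time \<in> O(\<lambda>n. 4 ^ n * real n ^ 4)"
  proof (rule bigoI[of _ "100 * real step_cost * 16"], rule eventually_sequentiallyI[of 1])
    fix n :: nat assume n: "1 \<le> n"
    have "(4 :: real) ^ n * (real n + 1) ^ 4 \<le> 4 ^ n * (16 * real n ^ 4)"
      using Suc_power_le[OF n, of 4] by (intro mult_left_mono) auto
    then have "100 * real step_cost * (4 ^ n * (real n + 1) ^ 4) \<le> 100 * real step_cost * (4 ^ n * (16 * real n ^ 4))"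
      by (intro mult_left_mono) auto
    then show "norm (?time n) \<le> 100 * real step_cost * 16 * norm (4 ^ n * real n ^ 4)"
      by (simp add: add.commute mult.assoc mult.left_commute)
  qed
  show "(\<lambda>n. real (5 * n + 10)) \<in> O(\<lambda>n. real n)"
    by (rule bigoI[of _ 15], rule eventually_sequentiallyI[of 1]) simp
  show "\<forall>P n ps. general_position P \<and> finite P \<and> card P = n \<and> distinct ps \<and> set ps = P \<longrightarrow>
    (\<exists>\<Gamma> k. combination_graph P \<Gamma> \<and> represents \<Gamma> (crossing_free_spanning_cycles P) \<and>
      real (graph_size \<Gamma>) \<le> ?size n \<and> constructs (5 * n + 10) cycle_prog ps k \<Gamma> \<and> real k \<le> ?time n)"
  proof (intro allI impI)
    fix P n ps
    assume P: "general_position P \<and> finite P \<and> card P = n \<and> distinct ps \<and> set ps = P"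
    then have n: "n = length ps" using distinct_card[of ps] by simp
    interpret R: ranked_points ps
      using P by unfold_locales auto
    interpret ranked_points_machine ps "5 * n + 10"
      by unfold_locales (use word_length_suffices[of n] in \<open>simp add: R.n_def n\<close>)
    have "R.n = n" by (simp add: R.n_def n)
    then obtain \<Gamma> k where G: "combination_graph (set ps) \<Gamma>" "represents \<Gamma> (crossing_free_spanning_cycles (set ps))"
      "graph_size \<Gamma> = 4 ^ n * (n + 1) + 2 + 4 ^ n * (n + 1) ^ 3"
      "constructs (5 * n + 10) cycle_prog ps k \<Gamma>" "k \<le> 100 * step_cost * (4 ^ n * (n + 1) ^ 4)"
      using cycle_prog_correct by auto
    have "real (graph_size \<Gamma>) \<le> ?size n" "real k \<le> ?time n"
      using G(3,5) by (simp_all only: of_nat_le_iff order_refl)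
    then show "\<exists>\<Gamma> k. combination_graph P \<Gamma> \<and> represents \<Gamma> (crossing_free_spanning_cycles P) \<and>
        real (graph_size \<Gamma>) \<le> ?size n \<and> constructs (5 * n + 10) cycle_prog ps k \<Gamma> \<and> real k \<le> ?time n"
      using P G(1,2,4) by blast
  qed
qed

end
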